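(* Let $p\ge 1$ and let $X:[0,T]\to G_{\mathcal L}^{[p]}$ be a branched $p$-rough path. Define $\bar X:[0,T]\to (F_{\mathcal L}^{[p]}\to\mathbb R)$ by $$(\bar X_t,\rho):=\frac{(X_t,\rho)}{\sigma(\rho)},\qquad t\in[0,T],\ \rho\in F_{\mathcal L}^{[p]}.$$ Then $\bar X$ takes values in $\mathcal G_{\mathcal L}^{[p]}$, is continuous and of finite $p$-variation, and $$(\bar X_{s,t},\rho)=\frac{(X_{s,t},\rho)}{\sigma(\rho)}\qquad (\ast)$$ for all $0\le s\le t\le T$ and all $\rho\in F_{\mathcal L}^{[p]}$. For every integer $N\ge [p]+1$, there exists a unique extension of $X$ (respectively of $\bar X$) to a continuous path of finite $p$-variation taking values in $G_{\mathcal L}^{N}$ (respectively in $\mathcal G_{\mathcal L}^{N}$). Denoting these extensions again by $X$ (respectively $\bar X$), the identity $(\ast)$ holds for all $0\le s\le t\le T$ and all $\rho\in F_{\mathcal L}^N$.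
   Context: Trees and forests. Fix $d\ge 1$ and the label set $\mathcal L=\{1,\dots,d\}$. A tree is a finite non-planar rooted tree; a forest is a commutative monomial of trees. An $\mathcal L$-labeled forest has a label from $\mathcal L$ attached to each vertex. The degree $|\rho|$ of a forest is its number of vertices. $F_{\mathcal L}$ (resp. $T_{\mathcal L}$) is the set of $\mathcal L$-labeled forests (resp. trees) of degree $\ge 1$, and $F_{\mathcal L}^N$ (resp. $T_{\mathcal L}^N$) the subset of those of degree $1,\dots,N$. The empty forest is denoted $1$, $|1|=0$. $\bullet_a$ is the one-vertex tree with label $a$; $[\tau_1\cdots\tau_k]_a$ is the tree with root labeled $a$ and children trees $\tau_1,\dots,\tau_k$. The symmetry factor is $\sigma(\bullet_a)=1$, $\sigma(\tau_1^{n_1}\cdots\tau_k^{n_k})=\sigma([\tau_1^{n_1}\cdots\tau_k^{n_k}]_a)=n_1!\cdots n_k!\,\sigma(\tau_1)^{n_1}\cdots\sigma(\tau_k)^{n_k}$ for distinct labeled trees $\tau_i$. The group $G_{\mathcal L}^N$. It is the set of linear maps $a:\mathbb R F_{\mathcal L}^N\to\mathbb R$ with $(a,\rho_1)(a,\rho_2)=(a,\rho_1\rho_2)$ whenever $|\rho_1|+|\rho_2|\le N$, extended by $(a,1)=1$. The product is $(ab,\rho)=(a\otimes b,\Delta\rho)$, where $\Delta$ is the Connes-Kreimer coproduct: $\Delta\rho=\sum_c P^c(\rho)\otimes R^c(\rho)$ over admissible cuts, with $P^c(\rho)$ the forest of pruned branches and $R^c(\rho)$ the part containing the roots, the terms $\rho\otimes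 1$ and $1\otimes\rho$ included, and $\Delta(\rho_1\rho_2)=\Delta\rho_1\Delta\rho_2$. The norm is $\|a\|=\max_{\rho\in F_{\mathcal L}^N}|(a,\rho)|^{1/|\rho|}$. The group $\mathcal G_{\mathcal L}^N$. The $\mathcal L$-labeled Grossman-Larson Hopf algebra $\mathcal H_{\mathcal L}$ is spanned by labeled forests (including $1$; formal series graded by degree are allowed). Its product $\ast$ is: for trees $t_1,\dots,t_k$ and a forest $\rho$, $(t_1\cdots t_k)\ast\rho$ is the sum over all ways of choosing, independently for each $i$, either to link the root of $t_i$ by a new edge to a vertex of $\rho$ (as child of that vertex) or to leave $t_i$ as a separate factor. Its coproduct is $\delta(t_1\cdots t_k)=\sum_{I\subseteq\{1,\dots,k\}}\prod_{i\in I}t_i\otimes\prod_{i\notin I}t_i$. An element $a$ (with coefficient $1$ on the empty forest) is grouplike if $\delta a=a\otimes a$. $\mathcal H_{\mathcal L}^N$ is the quotient of $\mathcal H_{\mathcal L}$ by the ideal of series supported on forests of degree $>N$, and $\mathcal G_{\mathcal L}^N$ is the group (under $\ast$) of truncations in $\mathcal H_{\mathcal L}^N$ of grouplike elements. For $a=1+\sum_{\rho\in F_{\mathcal L}^N}(a,\rho)\rho$, $(a,\rho)$ is the coefficient of $\rho$; a function $F_{\mathcal L}^N\to\mathbb R$ is identified with such an element. $\mathcal G_{\mathcal L}^N$ is equipped with a continuous homogeneous norm, i.e. a continuous norm with $\|\delta_c a\|=c\|a\|$ for $c>0$, where $(\delta_c a,\rho)=c^{|\rho|}(a,\rho)$.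 Paths. For a path $X$ in a group with norm, $X_{s,t}:=X_s^{-1}X_t$ and $\|X\|_{p-var,[0,T]}=\big(\sup_{0=t_0<\cdots<t_n=T,\,n\ge 1}\sum_{i=0}^{n-1}\|X_{t_i,t_{i+1}}\|^p\big)^{1/p}$. $[p]$ is the largest integer $\le p$. A branched $p$-rough path is a continuous path $X:[0,T]\to G_{\mathcal L}^{[p]}$ of finite $p$-variation. An extension to degree $N$ is a path whose restriction to forests of degree $\le[p]$ is the given path.
   Formalization: Uniqueness of the extension is stated as uniqueness of its increments, and of the path once its starting value over X_0 is fixed: left translation by an element trivial in degrees up to [p] gives another extension, so the path itself is never literally unique. *)

theory Defs
  imports
    "HOL-Analysis.Analysis"
    "HOL-Algebra.Group"
    "HOL-Library.Multiset"
    "HOL-Library.Poly_Mapping"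
    "HOL-Library.Product_Plus"
    "HOL-Library.Sublist"
begin

text \<open>
  The label set \<open>{1,\<dots>,d}\<close> is a type \<open>'l::finite\<close> (nonempty, with \<open>CARD('l) = d\<close>).  The empty forest,
  written \<open>1\<close> in the literature, is \<open>{#}\<close>, and the product of forests is multiset union \<open>+\<close>.
\<close>

datatype 'l ltree = Node (root: 'l) (children: "'l ltree multiset")

type_synonym 'l forest = "'l ltree multiset"

primrec tree_degree :: "'l ltree \<Rightarrow> nat" where
  "tree_degree (Node a ts) = Suc (\<Sum>n\<in>#image_mset tree_degree ts. n)"

definition forest_degree :: "'l forest \<Rightarrow> nat" where
  "forest_degree \<rho> = (\<Sum>t\<in>#\<rho>. tree_degree t)"

definition forests :: "nat \<Rightarrow> 'l forest set" where
  "forests N = {\<rho>. 1 \<le> forest_degree \<rho> \<and> forest_degree \<rho> \<le> N}"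

primrec tree_symmetry :: "'l ltree \<Rightarrow> nat" where
  "tree_symmetry (Node a ts) =
     (\<Prod>t\<in>set_mset ts. fact (count ts t)) * (\<Prod>n\<in>#image_mset tree_symmetry ts. n)"

definition forest_symmetry :: "'l forest \<Rightarrow> nat" where
  "forest_symmetry \<rho> = (\<Prod>t\<in>set_mset \<rho>. fact (count \<rho> t) * tree_symmetry t ^ count \<rho> t)"

subsection \<open>Vertices\<close>

text \<open>
  Sums over cuts and over graftings treat the vertices of a forest as distinguishable, although
  isomorphic branches are identified in a multiset.  Equal elements of a multiset are therefore told
  apart by a counter: \<open>occs \<rho>\<close> is an index set for the factors of \<open>\<rho> = t\<^sub>1 \<cdots> t\<^sub>k\<close>, the tree with
  index \<open>i\<close> being \<open>fst i\<close>.
\<close>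

definition occs :: "'a multiset \<Rightarrow> ('a \<times> nat) set" where
  "occs A = (SIGMA x:set_mset A. {..<count A x})"

definition subforest :: "('a \<times> nat) set \<Rightarrow> 'a multiset" where
  "subforest I = image_mset fst (mset_set I)"

text \<open>
  A vertex of a forest is addressed by the nonempty list of branches leading to it: first a factor of
  the forest, then successively one of the children.  The branch hanging at the vertex \<open>v\<close> is
  \<open>fst (last v)\<close>, and \<open>u\<close> is an ancestor of \<open>v\<close> iff \<open>strict_prefix u v\<close>.
\<close>

type_synonym 'l vertex = "('l ltree \<times> nat) list"

fun is_vertex :: "'l forest \<Rightarrow> 'l vertex \<Rightarrow> bool" where
  "is_vertex \<rho> [] \<longleftrightarrow> False"
| "is_vertex \<rho> (i # v) \<longleftrightarrow> i \<in> occs \<rho> \<and> (v = [] \<or> is_vertex (children (fst i)) v)"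

definition vertices :: "'l forest \<Rightarrow> 'l vertex set" where
  "vertices \<rho> = {v. is_vertex \<rho> v}"

lemma degree_children_less:
  assumes "i \<in># mset_set (occs \<rho>)"
  shows "forest_degree (children (fst i)) < forest_degree \<rho>"
proof -
  have "finite (occs \<rho>)" by (auto simp: occs_def)
  with assms have "fst i \<in># \<rho>" by (auto simp: occs_def)
  then obtain \<rho>' where "\<rho> = add_mset (fst i) \<rho>'" by (metis mset_add)
  moreover have "tree_degree (fst i) = Suc (forest_degree (children (fst i)))"
    by (cases "fst i") (simp add: forest_degree_def)
  ultimately show ?thesis by (simp add: forest_degree_def)
qed

subsection \<open>The Connes-Kreimer coproduct\<close>

text \<open>
  The edges of a tree \<open>t\<close> are identified with their lower ends, i.e. with the vertices of the forest
  \<open>children t\<close>.  A set of edges is an admissible cut if no path from the root to a leaf meets it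
  more than once.
\<close>

definition admissible_cuts :: "'l ltree \<Rightarrow> 'l vertex set set" where
  "admissible_cuts t =
     {C. C \<subseteq> vertices (children t) \<and> (\<forall>u\<in>C. \<forall>v\<in>C. \<not> strict_prefix u v)}"

definition pruned :: "'l vertex set \<Rightarrow> 'l forest" where
  "pruned C = image_mset (\<lambda>v. fst (last v)) (mset_set C)"

text \<open>\<open>trunk C \<rho>\<close> removes from \<open>\<rho>\<close> all vertices that lie in or below \<open>C\<close>.\<close>

function trunk :: "'l vertex set \<Rightarrow> 'l forest \<Rightarrow> 'l forest" where
  "trunk C \<rho> =
     image_mset (\<lambda>i. Node (root (fst i)) (trunk {v. i # v \<in> C} (children (fst i))))
       (filter_mset (\<lambda>i. [i] \<notin> C) (mset_set (occs \<rho>)))"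
  by pat_completeness auto
termination
  by (relation "Wellfounded.measure (\<lambda>(C, \<rho>). forest_degree \<rho>)") (auto dest!: degree_children_less)

declare trunk.simps [simp del]

text \<open>
  Finite linear combinations of forests form the ring \<open>'l forest \<Rightarrow>\<^sub>0 real\<close>, and those of tensors
  \<open>\<rho>\<^sub>1 \<otimes> \<rho>\<^sub>2\<close> the ring \<open>('l forest \<times> 'l forest) \<Rightarrow>\<^sub>0 real\<close>; multiplication is the bilinear extension
  of the (componentwise) product of forests.
\<close>

definition tensor :: "'l forest \<Rightarrow> 'l forest \<Rightarrow> ('l forest \<times> 'l forest) \<Rightarrow>\<^sub>0 real" where
  "tensor \<rho>\<^sub>1 \<rho>\<^sub>2 = Poly_Mapping.single (\<rho>\<^sub>1, \<rho>\<^sub>2) 1"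

text \<open>The summand \<open>1 \<otimes> t\<close> is the one of the empty cut.\<close>

definition CK_coproduct_tree :: "'l ltree \<Rightarrow> ('l forest \<times> 'l forest) \<Rightarrow>\<^sub>0 real" where
  "CK_coproduct_tree t = tensor {#t#} {#} +
     (\<Sum>C\<in>admissible_cuts t. tensor (pruned C) {#Node (root t) (trunk C (children t))#})"

definition CK_coproduct :: "'l forest \<Rightarrow> ('l forest \<times> 'l forest) \<Rightarrow>\<^sub>0 real" where
  "CK_coproduct \<rho> = (\<Prod>t\<in>#\<rho>. CK_coproduct_tree t)"

subsection \<open>The truncated group of characters\<close>

text \<open>
  Functions on forests of degree between \<open>1\<close> and \<open>N\<close> are represented by functions on all forests that
  take the value \<open>1\<close> at \<open>{#}\<close> and vanish in degrees greater than \<open>N\<close>.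
\<close>

definition truncate :: "nat \<Rightarrow> ('l forest \<Rightarrow> real) \<Rightarrow> 'l forest \<Rightarrow> real" where
  "truncate N a = (\<lambda>\<rho>. if forest_degree \<rho> \<le> N then a \<rho> else 0)"

definition unit_series :: "'l forest \<Rightarrow> real" where
  "unit_series = (\<lambda>\<rho>. if \<rho> = {#} then 1 else 0)"

definition CK_product :: "('l forest \<Rightarrow> real) \<Rightarrow> ('l forest \<Rightarrow> real) \<Rightarrow> 'l forest \<Rightarrow> real" where
  "CK_product a b = (\<lambda>\<rho>. \<Sum>(\<rho>\<^sub>1, \<rho>\<^sub>2)\<in>Poly_Mapping.keys (CK_coproduct \<rho>).
     Poly_Mapping.lookup (CK_coproduct \<rho>) (\<rho>\<^sub>1, \<rho>\<^sub>2) * (a \<rho>\<^sub>1 * b \<rho>\<^sub>2))"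

definition CK_group :: "nat \<Rightarrow> ('l forest \<Rightarrow> real) monoid" where
  "CK_group N =
     \<lparr>carrier = {a. a {#} = 1 \<and> (\<forall>\<rho>. N < forest_degree \<rho> \<longrightarrow> a \<rho> = 0) \<and>
        (\<forall>\<rho>\<^sub>1 \<rho>\<^sub>2. forest_degree \<rho>\<^sub>1 + forest_degree \<rho>\<^sub>2 \<le> N \<longrightarrow> a \<rho>\<^sub>1 * a \<rho>\<^sub>2 = a (\<rho>\<^sub>1 + \<rho>\<^sub>2))},
      mult = (\<lambda>a b. truncate N (CK_product a b)),
      one = unit_series\<rparr>"

definition CK_norm :: "nat \<Rightarrow> ('l forest \<Rightarrow> real) \<Rightarrow> real" where
  "CK_norm N a = Max ((\<lambda>\<rho>. \<bar>a \<rho>\<bar> powr (1 / real (forest_degree \<rho>))) ` forests N)"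

subsection \<open>The truncated Grossman-Larson group\<close>

text \<open>\<open>graft A \<rho>\<close> links the roots of the trees in \<open>A v\<close> to \<open>v\<close>, for every vertex \<open>v\<close> of \<open>\<rho>\<close>.\<close>

function graft :: "('l vertex \<Rightarrow> 'l forest) \<Rightarrow> 'l forest \<Rightarrow> 'l forest" where
  "graft A \<rho> =
     image_mset (\<lambda>i. Node (root (fst i)) (A [i] + graft (\<lambda>v. A (i # v)) (children (fst i))))
       (mset_set (occs \<rho>))"
  by pat_completeness auto
termination
  by (relation "Wellfounded.measure (\<lambda>(A, \<rho>). forest_degree \<rho>)") (auto dest!: degree_children_less)

declare graft.simps [simp del]

text \<open>
  A choice \<open>\<phi>\<close> sends the index of a factor of \<open>\<pi>\<close> to \<open>Some v\<close> if the factor is linked to the vertex \<open>v\<close>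
  of \<open>\<rho>\<close>, and to \<open>None\<close> if it is left as a separate factor.
\<close>

definition GL_product_forest :: "'l forest \<Rightarrow> 'l forest \<Rightarrow> 'l forest \<Rightarrow>\<^sub>0 real" where
  "GL_product_forest \<pi> \<rho> =
     (\<Sum>\<phi>\<in>occs \<pi> \<rightarrow>\<^sub>E insert None (Some ` vertices \<rho>).
        Poly_Mapping.single
          (subforest {i \<in> occs \<pi>. \<phi> i = None} +
           graft (\<lambda>v. subforest {i \<in> occs \<pi>. \<phi> i = Some v}) \<rho>) 1)"

text \<open>
  Formal series of forests are functions \<open>'l forest \<Rightarrow> real\<close>.  The two sums below are finite for a
  finite set of labels, because product and coproduct preserve the total degree.
\<close>

definition GL_product :: "('l forest \<Rightarrow> real) \<Rightarrow> ('l forest \<Rightarrow> real) \<Rightarrow> 'l forest \<Rightarrow> real" where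
  "GL_product a b = (\<lambda>\<rho>.
     \<Sum>(\<rho>\<^sub>1, \<rho>\<^sub>2) | \<rho> \<in> Poly_Mapping.keys (GL_product_forest \<rho>\<^sub>1 \<rho>\<^sub>2).
       a \<rho>\<^sub>1 * b \<rho>\<^sub>2 * Poly_Mapping.lookup (GL_product_forest \<rho>\<^sub>1 \<rho>\<^sub>2) \<rho>)"

definition GL_coproduct_forest :: "'l forest \<Rightarrow> ('l forest \<times> 'l forest) \<Rightarrow>\<^sub>0 real" where
  "GL_coproduct_forest \<rho> = (\<Sum>I\<in>Pow (occs \<rho>). tensor (subforest I) (subforest (occs \<rho> - I)))"

definition GL_coproduct :: "('l forest \<Rightarrow> real) \<Rightarrow> 'l forest \<times> 'l forest \<Rightarrow> real" where
  "GL_coproduct a = (\<lambda>x. \<Sum>\<rho> | x \<in> Poly_Mapping.keys (GL_coproduct_forest \<rho>).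
     a \<rho> * Poly_Mapping.lookup (GL_coproduct_forest \<rho>) x)"

definition grouplike :: "('l forest \<Rightarrow> real) \<Rightarrow> bool" where
  "grouplike a \<longleftrightarrow> a {#} = 1 \<and> GL_coproduct a = (\<lambda>(\<rho>\<^sub>1, \<rho>\<^sub>2). a \<rho>\<^sub>1 * a \<rho>\<^sub>2)"

definition GL_group :: "nat \<Rightarrow> ('l forest \<Rightarrow> real) monoid" where
  "GL_group N =
     \<lparr>carrier = truncate N ` {a. grouplike a},
      mult = (\<lambda>a b. truncate N (GL_product a b)),
      one = unit_series\<rparr>"

definition dilation :: "real \<Rightarrow> ('l forest \<Rightarrow> real) \<Rightarrow> 'l forest \<Rightarrow> real" where
  "dilation c a = (\<lambda>\<rho>. c ^ forest_degree \<rho> * a \<rho>)"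

text \<open>
  As usual for homogeneous norms on graded groups, neither symmetry nor subadditivity is part of the
  notion.  Continuity refers to the product topology on \<open>'l forest \<Rightarrow> real\<close>, which on the carrier is the
  topology of the coefficients in degrees up to \<open>N\<close>.
\<close>

definition homogeneous_norm :: "nat \<Rightarrow> (('l forest \<Rightarrow> real) \<Rightarrow> real) \<Rightarrow> bool" where
  "homogeneous_norm N nrm \<longleftrightarrow>
     continuous_on (carrier (GL_group N)) nrm \<and>
     (\<forall>a\<in>carrier (GL_group N).
        0 \<le> nrm a \<and> (nrm a = 0 \<longleftrightarrow> a = unit_series) \<and>
        (\<forall>c>0. nrm (dilation c a) = c * nrm a))"

subsection \<open>Rough paths\<close>

definition increment :: "('a, 'b) monoid_scheme \<Rightarrow> (real \<Rightarrow> 'a) \<Rightarrow> real \<Rightarrow> real \<Rightarrow> 'a" where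
  "increment G X s t = mult G (m_inv G (X s)) (X t)"

text \<open>Finiteness of the supremum that defines the \<open>p\<close>-variation on \<open>[0,T]\<close>.\<close>

definition finite_p_variation ::
    "('a, 'b) monoid_scheme \<Rightarrow> ('a \<Rightarrow> real) \<Rightarrow> real \<Rightarrow> real \<Rightarrow> (real \<Rightarrow> 'a) \<Rightarrow> bool" where
  "finite_p_variation G nrm p T X \<longleftrightarrow>
     bdd_above {(\<Sum>i<n. nrm (increment G X (t i) (t (Suc i))) powr p) | n t.
       1 \<le> n \<and> t 0 = 0 \<and> t n = T \<and> (\<forall>i<n. t i < t (Suc i))}"

definition p_variation_path ::
    "('a::topological_space, 'b) monoid_scheme \<Rightarrow> ('a \<Rightarrow> real) \<Rightarrow> real \<Rightarrow> real \<Rightarrow> (real \<Rightarrow> 'a) \<Rightarrow> bool" where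
  "p_variation_path G nrm p T X \<longleftrightarrow>
     X \<in> {0..T} \<rightarrow> carrier G \<and> continuous_on {0..T} X \<and> finite_p_variation G nrm p T X"

abbreviation integer_part :: "real \<Rightarrow> nat" where
  "integer_part p \<equiv> nat \<lfloor>p\<rfloor>"

definition branched_rough_path :: "real \<Rightarrow> real \<Rightarrow> (real \<Rightarrow> 'l forest \<Rightarrow> real) \<Rightarrow> bool" where
  "branched_rough_path p T X \<longleftrightarrow>
     p_variation_path (CK_group (integer_part p)) (CK_norm (integer_part p)) p T X"

definition agree_upto :: "nat \<Rightarrow> ('l forest \<Rightarrow> real) \<Rightarrow> ('l forest \<Rightarrow> real) \<Rightarrow> bool" where
  "agree_upto n a b \<longleftrightarrow> (\<forall>\<rho>\<in>forests n. a \<rho> = b \<rho>)"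

text \<open>\<open>Y\<close> extends \<open>X\<close>, given in degrees up to \<open>[p]\<close>, to a continuous path of finite \<open>p\<close>-variation in \<open>G\<close>.\<close>

definition rough_extension ::
    "('l forest \<Rightarrow> real) monoid \<Rightarrow> (('l forest \<Rightarrow> real) \<Rightarrow> real) \<Rightarrow> real \<Rightarrow> real \<Rightarrow>
     (real \<Rightarrow> 'l forest \<Rightarrow> real) \<Rightarrow> (real \<Rightarrow> 'l forest \<Rightarrow> real) \<Rightarrow> bool" where
  "rough_extension G nrm p T X Y \<longleftrightarrow>
     p_variation_path G nrm p T Y \<and> (\<forall>t\<in>{0..T}. agree_upto (integer_part p) (Y t) (X t))"

text \<open>
  The \<open>p\<close>-variation of a path and its increments do not see a left translation, so the components of
  degree greater than \<open>[p]\<close> of the starting point of an extension are arbitrary.  Uniqueness of the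
  extension therefore means that its increments are unique, equivalently that the extension is
  unique once its starting point is fixed; every starting point above \<open>X 0\<close> is possible.
\<close>

definition unique_rough_extension ::
    "('l forest \<Rightarrow> real) monoid \<Rightarrow> (('l forest \<Rightarrow> real) \<Rightarrow> real) \<Rightarrow> real \<Rightarrow> real \<Rightarrow>
     (real \<Rightarrow> 'l forest \<Rightarrow> real) \<Rightarrow> bool" where
  "unique_rough_extension G nrm p T X \<longleftrightarrow>
     (\<exists>Y. rough_extension G nrm p T X Y) \<and>
     (\<forall>g\<in>carrier G. agree_upto (integer_part p) g (X 0) \<longrightarrow>
        (\<exists>!Y. Y \<in> extensional {0..T} \<and> rough_extension G nrm p T X Y \<and> Y 0 = g)) \<and>
     (\<forall>Y Y'. rough_extension G nrm p T X Y \<and> rough_extension G nrm p T X Y' \<longrightarrow>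
        (\<forall>s t. 0 \<le> s \<and> s \<le> t \<and> t \<le> T \<longrightarrow> increment G Y s t = increment G Y' s t))"

definition rescale :: "(real \<Rightarrow> 'l forest \<Rightarrow> real) \<Rightarrow> real \<Rightarrow> 'l forest \<Rightarrow> real" where
  "rescale X = (\<lambda>t \<rho>. X t \<rho> / real (forest_symmetry \<rho>))"

end

theory Submission
  imports Defs
begin

text \<open>
  The two groups are isomorphic, and the paths in question correspond to each other under the
  isomorphism; the extension theorem then has to be proved in one of the groups only.

  Elements of both groups are functions on forests. Since \<open>\<sigma>(\<rho>\<^sub>1 \<rho>\<^sub>2) / (\<sigma>(\<rho>\<^sub>1) \<sigma>(\<rho>\<^sub>2))\<close> is the multiplicity with
  which \<open>\<rho>\<^sub>1 \<otimes> \<rho>\<^sub>2\<close> occurs in the coproduct of \<open>\<rho>\<^sub>1 \<rho>\<^sub>2\<close>, a function \<open>a\<close> is a character if and only if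
  \<open>a / \<sigma>\<close> is grouplike (\<open>grouplike_by_symmetry\<close>). That \<open>a \<mapsto> a / \<sigma>\<close> is multiplicative
  (\<open>GL_product_by_symmetry\<close>) is the duality of the two Hopf algebras. Fix a character \<open>a\<close>. Grafting with
  \<open>\<Sum>\<pi>. a(\<pi>) / \<sigma>(\<pi>) \<pi>\<close> acts on the trees of a forest independently, while \<open>(a \<otimes> id) \<Delta>\<close> is an algebra
  homomorphism whose derivatives obey the chain rule. As multiplication by a tree is adjoint to a derivative,
  the matrices of both maps satisfy one recursion (\<open>grafting_sum_dual\<close>). The recursion of the
  Connes-Kreimer coproduct, which is derived from the definition by cuts (\<open>coproduct_sum_tree\<close>), also yields
  its coassociativity and its grading and thereby the group structure on characters.

  A continuous path of finite \<open>p\<close>-variation has a control \<open>\<omega>\<close>, a superadditive function of intervals with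
  \<open>|(X\<^sub>s\<^sub>,\<^sub>t, \<rho>)|\<close> at most \<open>\<omega>(s, t)\<close> to the power \<open>|\<rho>| / p\<close> (\<open>control_exists\<close>, \<open>p_variation_path_control\<close>).
  Extension proceeds one degree at a time. The elements that differ from the unit in the top degree only are
  central, and there the group is additive. Changing an arbitrary lift by such elements so that its
  increments have the right size is a problem for real functions, solved by the sewing lemma since
  the power \<open>(n + 1) / p\<close> exceeds \<open>1\<close> (\<open>extend_one_degree\<close>). Two solutions differ by an additive
  function of intervals that is controlled by the same power of a control and therefore vanishes
  (\<open>additive_eq_0\<close>, \<open>extension_unique\<close>).

  Finally, every continuous homogeneous norm is equivalent to the norm of characters by compactness
  (\<open>homogeneous_norm_equivalent\<close>), so that finite \<open>p\<close>-variation has the same meaning in both groups.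
\<close>

section \<open>Evaluating finite linear combinations\<close>

definition lin_eval :: "('a \<Rightarrow> real) \<Rightarrow> ('a \<Rightarrow>\<^sub>0 real) \<Rightarrow> real" where
  "lin_eval f P = (\<Sum>x\<in>Poly_Mapping.keys P. Poly_Mapping.lookup P x * f x)"

lemma lin_eval_superset:
  assumes "finite S" "Poly_Mapping.keys P \<subseteq> S"
  shows "lin_eval f P = (\<Sum>x\<in>S. Poly_Mapping.lookup P x * f x)"
  unfolding lin_eval_def using assms
  by (intro sum.mono_neutral_left) (auto simp: in_keys_iff)

lemma lin_eval_add_right: "lin_eval f (P + Q) = lin_eval f P + lin_eval f Q"
proof -
  let ?S = "Poly_Mapping.keys P \<union> Poly_Mapping.keys Q"
  have "Poly_Mapping.keys (P + Q) \<subseteq> ?S" by (rule keys_add)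
  then show ?thesis
    by (simp add: lin_eval_superset[of ?S] lookup_add distrib_right sum.distrib)
qed

lemma lin_eval_zero_right [simp]: "lin_eval f 0 = 0"
  by (simp add: lin_eval_def)

lemma lin_eval_sum_right: "lin_eval f (sum P A) = (\<Sum>i\<in>A. lin_eval f (P i))"
  by (induction A rule: infinite_finite_induct) (simp_all add: lin_eval_add_right)

lemma lin_eval_single [simp]: "lin_eval f (Poly_Mapping.single x c) = c * f x"
  by (cases "c = 0") (simp_all add: lin_eval_def)

lemma lin_eval_one: "lin_eval f 1 = f 0"
  using lin_eval_single[of f 0 1] by simp

lemma sum_singles: "(\<Sum>x\<in>Poly_Mapping.keys P. Poly_Mapping.single x (Poly_Mapping.lookup P x)) = P"
proof (rule poly_mapping_eqI)
  fix k
  show "Poly_Mapping.lookup (\<Sum>x\<in>Poly_Mapping.keys P.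
      Poly_Mapping.single x (Poly_Mapping.lookup P x)) k = Poly_Mapping.lookup P k"
    by (simp add: lookup_sum lookup_single when_def in_keys_iff sum.If_cases if_distrib sum.delta')
qed

lemma lin_eval_mult:
  fixes f :: "'a::comm_monoid_add \<Rightarrow> real"
  shows "lin_eval f (P * Q) = lin_eval (\<lambda>x. lin_eval (\<lambda>y. f (x + y)) Q) P"
proof -
  have "P * Q = (\<Sum>x\<in>Poly_Mapping.keys P. Poly_Mapping.single x (Poly_Mapping.lookup P x)) *
      (\<Sum>y\<in>Poly_Mapping.keys Q. Poly_Mapping.single y (Poly_Mapping.lookup Q y))"
    by (simp add: sum_singles)
  also have "\<dots> = (\<Sum>x\<in>Poly_Mapping.keys P. \<Sum>y\<in>Poly_Mapping.keys Q.
      Poly_Mapping.single (x + y) (Poly_Mapping.lookup P x * Poly_Mapping.lookup Q y))"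
    by (simp add: sum_product mult_single)
  finally show ?thesis
    by (simp add: lin_eval_sum_right) (simp add: lin_eval_def sum_distrib_left mult.assoc)
qed

lemma lin_eval_plus: "lin_eval (\<lambda>x. f x + g x) P = lin_eval f P + lin_eval g P"
  by (simp add: lin_eval_def sum.distrib distrib_left)

lemma lin_eval_scale: "lin_eval (\<lambda>x. c * f x) P = c * lin_eval f P"
  by (simp add: lin_eval_def sum_distrib_left mult.left_commute)

lemma lin_eval_swap: "lin_eval (\<lambda>x. lin_eval (\<lambda>y. f x y) Q) P = lin_eval (\<lambda>y. lin_eval (\<lambda>x. f x y) P) Q"
  by (simp add: lin_eval_def sum_distrib_left mult.left_commute) (rule sum.swap)

section \<open>Admissible cuts of forests\<close>

lemma finite_occs [simp]: "finite (occs \<rho>)"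
  by (simp add: occs_def)

lemma occs_empty [simp]: "occs {#} = {}"
  by (simp add: occs_def)

lemma occs_add_mset: "occs (add_mset t \<rho>) = insert (t, count \<rho> t) (occs \<rho>)"
  by (auto simp: occs_def less_Suc_eq split: if_splits simp flip: count_greater_zero_iff)

lemma fresh_notin_occs [simp]: "(t, count \<rho> t) \<notin> occs \<rho>"
  by (simp add: occs_def)

lemma vertices_empty [simp]: "vertices {#} = {}"
proof -
  have "\<not> is_vertex {#} v" for v :: "'a vertex" by (cases v) auto
  then show ?thesis by (auto simp: vertices_def)
qed

lemma Nil_notin_vertices [simp]: "[] \<notin> vertices \<rho>"
  by (simp add: vertices_def)

lemma Cons_in_vertices:
  "i # v \<in> vertices \<rho> \<longleftrightarrow> i \<in> occs \<rho> \<and> (v = [] \<or> v \<in> vertices (children (fst i)))"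
  by (simp add: vertices_def)

lemma vertices_add_mset:
  "vertices (add_mset t \<rho>) = vertices \<rho> \<union>
     insert [(t, count \<rho> t)] ((#) (t, count \<rho> t) ` vertices (children t))"
proof (rule Set.set_eqI)
  fix v show "v \<in> vertices (add_mset t \<rho>) \<longleftrightarrow> v \<in> vertices \<rho> \<union>
     insert [(t, count \<rho> t)] ((#) (t, count \<rho> t) ` vertices (children t))"
    by (cases v) (auto simp: Cons_in_vertices occs_add_mset)
qed

lemma finite_vertices [simp]: "finite (vertices \<rho>)"
proof (induction \<rho> rule: measure_induct_rule[of forest_degree])
  case (less \<rho>)
  have "vertices \<rho> \<subseteq> (\<Union>i\<in>occs \<rho>. insert [i] ((#) i ` vertices (children (fst i))))"
  proof
    fix v assume "v \<in> vertices \<rho>"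
    then show "v \<in> (\<Union>i\<in>occs \<rho>. insert [i] ((#) i ` vertices (children (fst i))))"
      by (cases v) (auto simp: Cons_in_vertices)
  qed
  moreover have "finite (vertices (children (fst i)))" if "i \<in> occs \<rho>" for i
    using that by (intro less degree_children_less) simp
  ultimately show ?case by (intro finite_subset[of "vertices \<rho>"]) auto
qed

text \<open>
  The admissible cuts of a tree, as sets of vertices of the forest below its root. Having this
  forest as the argument allows cuts to be built up one branch at a time.
\<close>

definition antichains :: "'l forest \<Rightarrow> 'l vertex set set" where
  "antichains \<rho> = {C. C \<subseteq> vertices \<rho> \<and> (\<forall>u\<in>C. \<forall>v\<in>C. \<not> strict_prefix u v)}"

lemma admissible_cuts_eq: "admissible_cuts t = antichains (children t)"
  by (simp add: admissible_cuts_def antichains_def)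

lemma finite_antichains [simp]: "finite (antichains \<rho>)"
  by (rule finite_subset[of _ "Pow (vertices \<rho>)"]) (auto simp: antichains_def)

lemma finite_antichain: "C \<in> antichains \<rho> \<Longrightarrow> finite C"
  by (auto simp: antichains_def intro: finite_subset)

lemma trunk_cong:
  "C \<inter> vertices \<rho> = D \<inter> vertices \<rho> \<Longrightarrow> trunk C \<rho> = trunk D \<rho>"
proof (induction \<rho> arbitrary: C D rule: measure_induct_rule[of forest_degree])
  case (less \<rho>)
  have "[i] \<in> C \<longleftrightarrow> [i] \<in> D" if "i \<in> occs \<rho>" for i
  proof -
    have "[i] \<in> vertices \<rho>" using that by (simp add: Cons_in_vertices)
    then show ?thesis using less.prems by auto
  qed
  then have "filter_mset (\<lambda>i. [i] \<notin> C) (mset_set (occs \<rho>)) = filter_mset (\<lambda>i. [i] \<notin> D) (mset_set (occs \<rho>))"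
    by (intro filter_mset_cong) auto
  moreover have "trunk {v. i # v \<in> C} (children (fst i)) = trunk {v. i # v \<in> D} (children (fst i))"
    if "i \<in> occs \<rho>" for i
  proof (rule less.IH)
    show "forest_degree (children (fst i)) < forest_degree \<rho>"
      using that by (simp add: degree_children_less)
    have "i # v \<in> vertices \<rho>" if "v \<in> vertices (children (fst i))" for v
      using that \<open>i \<in> occs \<rho>\<close> by (simp add: Cons_in_vertices)
    then show "{v. i # v \<in> C} \<inter> vertices (children (fst i)) = {v. i # v \<in> D} \<inter> vertices (children (fst i))"
      using less.prems by blast
  qed
  ultimately show ?case
    unfolding trunk.simps[of C] trunk.simps[of D]
    by (auto intro!: image_mset_cong)
qed

lemma trunk_add_mset:
  "trunk C (add_mset t \<rho>) = trunk C \<rho> +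
     (if [(t, count \<rho> t)] \<in> C then {#}
      else {#Node (root t) (trunk {v. (t, count \<rho> t) # v \<in> C} (children t))#})"
proof -
  have "mset_set (occs (add_mset t \<rho>)) = add_mset (t, count \<rho> t) (mset_set (occs \<rho>))"
    by (simp add: occs_add_mset)
  then show ?thesis
    by (simp add: trunk.simps[of C "add_mset t \<rho>"] trunk.simps[of C \<rho>])
qed

lemma trunk_empty [simp]: "trunk C {#} = {#}"
  by (subst trunk.simps) simp

lemma pruned_union:
  assumes "finite C" "finite D" "C \<inter> D = {}"
  shows "pruned (C \<union> D) = pruned C + pruned D"
  using assms by (simp add: pruned_def mset_set_Union)

lemma pruned_Cons:
  assumes "[] \<notin> C"
  shows "pruned ((#) i ` C) = pruned C"
proof -
  have "mset_set ((#) i ` C) = image_mset ((#) i) (mset_set C)"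
    by (rule image_mset_mset_set[symmetric]) simp
  moreover have "last (i # v) = last v" if "v \<in># mset_set C" for v
    using that assms by (metis elem_mset_set infinite_set_mset_mset_set empty_iff last_ConsR)
  ultimately show ?thesis by (auto simp: pruned_def image_mset.compositionality o_def simp del: last.simps intro!: image_mset_cong)
qed

text \<open>
  A further branch \<open>t\<close> at the root is either cut off as a whole, or an admissible cut of \<open>t\<close> itself is
  made; this choice is independent of the cut of the remaining branches \<open>\<rho>\<close>.
\<close>

lemma sum_antichains_add_mset:
  fixes t :: "'l ltree" and g :: "'l forest \<Rightarrow> 'l forest \<Rightarrow> real"
  shows "(\<Sum>C\<in>antichains (add_mset t \<rho>). g (pruned C) (trunk C (add_mset t \<rho>))) =
     (\<Sum>C\<in>antichains \<rho>. g (pruned C + {#t#}) (trunk C \<rho>) +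
        (\<Sum>D\<in>antichains (children t). g (pruned C + pruned D)
           (trunk C \<rho> + {#Node (root t) (trunk D (children t))#})))"
proof -
  define i where "i = (t, count \<rho> t)"
  \<comment> \<open>\<open>None\<close> stands for cutting off \<open>t\<close>, and \<open>i\<close> is the address of the new branch.\<close>
  define join where "join = (\<lambda>(C, D). C \<union> (case D of None \<Rightarrow> {[i]} | Some D \<Rightarrow> (#) i ` D))"
  define split where "split = (\<lambda>C. (C \<inter> vertices \<rho>, if [i] \<in> C then None else Some {v. i # v \<in> C}))"
  have ni: "i # v \<notin> vertices \<rho>" for v by (simp add: i_def Cons_in_vertices)
  have V: "vertices (add_mset t \<rho>) = vertices \<rho> \<union> insert [i] ((#) i ` vertices (children t))"
    by (simp add: vertices_add_mset i_def)
  let ?A = "antichains \<rho> \<times> insert None (Some ` antichains (children t))"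
  have cross: "\<not> strict_prefix u (i # v)" "\<not> strict_prefix (i # v) u" if "u \<in> vertices \<rho>" for u v
    using that by (cases u; auto simp: i_def Cons_in_vertices strict_prefix_def)+
  have "(\<Sum>C\<in>antichains (add_mset t \<rho>). g (pruned C) (trunk C (add_mset t \<rho>))) =
      (\<Sum>x\<in>?A. g (pruned (join x)) (trunk (join x) (add_mset t \<rho>)))"
  proof (rule sum.reindex_bij_witness[of _ join split])
    fix C assume C: "C \<in> antichains (add_mset t \<rho>)"
    show js: "join (split C) = C"
    proof (cases "[i] \<in> C")
      case True
      have "i # v \<notin> C" if "v \<in> vertices (children t)" for v
      proof -
        have "strict_prefix [i] (i # v)" using that by (cases v) (auto simp: strict_prefix_def)
        then show ?thesis using True C unfolding antichains_def by blast
      qed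
      then show ?thesis using True C by (auto simp: join_def split_def antichains_def V)
    next
      case False
      then show ?thesis using C by (auto simp: join_def split_def antichains_def V)
    qed
    have "{v. i # v \<in> C} \<in> antichains (children t)" if "[i] \<notin> C"
    proof -
      have "v \<in> vertices (children t)" if "i # v \<in> C" for v
      proof -
        have "i # v \<in> vertices (add_mset t \<rho>)" using that C by (auto simp: antichains_def)
        then show ?thesis using \<open>[i] \<notin> C\<close> that by (auto simp: V ni)
      qed
      moreover have "\<not> strict_prefix u v" if "i # u \<in> C" "i # v \<in> C" for u v
      proof -
        have "\<not> strict_prefix (i # u) (i # v)" using that C unfolding antichains_def by blast
        then show ?thesis by (simp add: strict_prefix_def)
      qed
      ultimately show ?thesis by (simp add: antichains_def subset_iff)
    qed
    then show "split C \<in> ?A"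
      using C by (auto simp: split_def antichains_def)
    show "g (pruned (join (split C))) (trunk (join (split C)) (add_mset t \<rho>)) =
        g (pruned C) (trunk C (add_mset t \<rho>))" by (simp only: js)
  next
    fix x assume "x \<in> ?A"
    then obtain C D where x: "x = (C, D)" and C: "C \<in> antichains \<rho>"
      and D: "D = None \<or> (\<exists>E\<in>antichains (children t). D = Some E)" by auto
    have Cv: "C \<subseteq> vertices \<rho>" using C by (simp add: antichains_def)
    have niC: "i # v \<notin> C" for v using Cv ni by auto
    show "split (join x) = x"
    proof (cases D)
      case None
      then show ?thesis using Cv ni[of "[]"] by (auto simp: x join_def split_def)
    next
      case (Some E)
      then have "[] \<notin> E" using D by (auto simp: antichains_def)
      moreover have "(C \<union> (#) i ` E) \<inter> vertices \<rho> = C" using Cv ni by auto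
      ultimately show ?thesis using niC by (simp add: x join_def split_def Some image_iff)
    qed
    have CC: "\<not> strict_prefix u v" if "u \<in> C" "v \<in> C" for u v
      using C that by (simp add: antichains_def)
    show "join x \<in> antichains (add_mset t \<rho>)"
    proof (cases D)
      case None
      then have "join x = insert [i] C" by (simp add: x join_def)
      then show ?thesis using Cv cross CC by (auto simp: antichains_def V)
    next
      case (Some E)
      then have "E \<in> antichains (children t)" using D by auto
      then have E: "E \<subseteq> vertices (children t)" "\<And>u v. u \<in> E \<Longrightarrow> v \<in> E \<Longrightarrow> \<not> strict_prefix u v"
        by (auto simp: antichains_def)
      have "join x = C \<union> (#) i ` E" by (simp add: x join_def Some)
      moreover have "\<not> strict_prefix u v" if "u \<in> C \<union> (#) i ` E" "v \<in> C \<union> (#) i ` E" for u v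
        using that Cv by (auto simp: E CC cross subset_iff)
      ultimately show ?thesis using Cv E(1) unfolding antichains_def V by blast
    qed
  qed
  also have "\<dots> = (\<Sum>C\<in>antichains \<rho>. \<Sum>D\<in>insert None (Some ` antichains (children t)).
      g (pruned (join (C, D))) (trunk (join (C, D)) (add_mset t \<rho>)))"
    unfolding sum.cartesian_product by (rule sum.cong) auto
  also have "\<dots> = (\<Sum>C\<in>antichains \<rho>. g (pruned C + {#t#}) (trunk C \<rho>) +
        (\<Sum>D\<in>antichains (children t). g (pruned C + pruned D)
           (trunk C \<rho> + {#Node (root t) (trunk D (children t))#})))"
  proof (rule sum.cong[OF refl])
    fix C assume C: "C \<in> antichains \<rho>"
    then have Cv: "C \<subseteq> vertices \<rho>" and fC: "finite C" by (auto simp: antichains_def intro: finite_subset)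
    have niC: "i # v \<notin> C" for v using Cv ni by auto
    have p0: "pruned (join (C, None)) = pruned C + {#t#}"
      using fC niC[of "[]"] by (simp add: join_def pruned_def i_def)
    have tr: "trunk (join (C, D)) \<rho> = trunk C \<rho>" for D
      by (rule trunk_cong) (use ni in \<open>auto simp: join_def split: option.splits\<close>)
    then have t0: "trunk (join (C, None)) (add_mset t \<rho>) = trunk C \<rho>"
      by (simp add: trunk_add_mset[of C] trunk_add_mset) (simp add: join_def i_def)
    have p1: "pruned (join (C, Some D)) = pruned C + pruned D" if "D \<in> antichains (children t)" for D
    proof -
      have "[] \<notin> D" using that by (auto simp: antichains_def)
      have "finite D" using that by (rule finite_antichain)
      have "C \<inter> (#) i ` D = {}" using niC by auto
      then show ?thesis
        using \<open>finite D\<close> fC pruned_Cons[OF \<open>[] \<notin> D\<close>] by (simp add: join_def pruned_union)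
    qed
    have t1: "trunk (join (C, Some D)) (add_mset t \<rho>) =
        trunk C \<rho> + {#Node (root t) (trunk D (children t))#}" if "D \<in> antichains (children t)" for D
    proof -
      have "[] \<notin> D" using that by (auto simp: antichains_def)
      moreover have "{v. i # v \<in> join (C, Some D)} = D" using niC by (auto simp: join_def)
      ultimately show ?thesis
        using niC[of "[]"] tr[of "Some D"] by (auto simp add: trunk_add_mset i_def[symmetric] join_def)
    qed
    show "(\<Sum>D\<in>insert None (Some ` antichains (children t)).
      g (pruned (join (C, D))) (trunk (join (C, D)) (add_mset t \<rho>))) = g (pruned C + {#t#}) (trunk C \<rho>) +
        (\<Sum>D\<in>antichains (children t). g (pruned C + pruned D)
           (trunk C \<rho> + {#Node (root t) (trunk D (children t))#}))"
      by (subst sum.insert) (auto simp: sum.reindex p0 t0 p1 t1 intro!: sum.cong)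
  qed
  finally show ?thesis .
qed

section \<open>The Connes-Kreimer coproduct as a bilinear pairing\<close>

text \<open>
  A linear functional \<open>g\<close> on tensors, evaluated at the coproduct. Identities between iterated
  coproducts become identities between iterated sums that hold for all \<open>g\<close>, which avoids threefold
  tensor products.
\<close>

definition coproduct_sum :: "('l forest \<Rightarrow> 'l forest \<Rightarrow> real) \<Rightarrow> 'l forest \<Rightarrow> real" where
  "coproduct_sum g \<rho> = lin_eval (\<lambda>(x, y). g x y) (CK_coproduct \<rho>)"

lemma lin_eval_tensor [simp]: "lin_eval f (tensor x y) = f (x, y)"
  by (simp add: tensor_def)

lemma lin_eval_CK_coproduct_tree:
  "lin_eval (\<lambda>(x, y). g x y) (CK_coproduct_tree t) = g {#t#} {#} +
     (\<Sum>C\<in>antichains (children t). g (pruned C) {#Node (root t) (trunk C (children t))#})"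
  by (simp add: CK_coproduct_tree_def admissible_cuts_eq lin_eval_add_right lin_eval_sum_right)

lemma coproduct_sum_empty [simp]: "coproduct_sum g {#} = g {#} {#}"
  by (simp add: coproduct_sum_def CK_coproduct_def lin_eval_one zero_prod_def)

lemma coproduct_sum_plus:
  "coproduct_sum g (\<rho> + \<rho>') =
     coproduct_sum (\<lambda>x y. coproduct_sum (\<lambda>x' y'. g (x + x') (y + y')) \<rho>') \<rho>"
  by (simp add: coproduct_sum_def CK_coproduct_def lin_eval_mult case_prod_unfold)

text \<open>
  Cuts in different branches are chosen independently, just as the terms in a product of coproducts.
\<close>

lemma sum_antichains:
  "(\<Sum>C\<in>antichains (\<rho> :: 'l forest). g (pruned C) (trunk C \<rho>)) = coproduct_sum g \<rho>"
proof (induction \<rho> arbitrary: g)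
  case empty
  have "antichains ({#} :: 'l forest) = {{}}" by (auto simp: antichains_def)
  then show ?case by (simp add: pruned_def)
next
  case (add t \<rho>)
  have "(\<Sum>C\<in>antichains (add_mset t \<rho>). g (pruned C) (trunk C (add_mset t \<rho>))) =
      (\<Sum>C\<in>antichains \<rho>. lin_eval (\<lambda>(x, y). g (pruned C + x) (trunk C \<rho> + y)) (CK_coproduct_tree t))"
    by (simp add: sum_antichains_add_mset lin_eval_CK_coproduct_tree)
  also have "\<dots> = coproduct_sum (\<lambda>x' y'. lin_eval (\<lambda>(x, y). g (x' + x) (y' + y)) (CK_coproduct_tree t)) \<rho>"
    by (rule add)
  also have "\<dots> = coproduct_sum g (add_mset t \<rho>)"
    unfolding coproduct_sum_def CK_coproduct_def
    by (simp add: mult.commute[of "CK_coproduct_tree t"] lin_eval_mult case_prod_unfold)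
  finally show ?case .
qed

text \<open>
  The recursion \<open>\<Delta> [\<rho>]\<^sub>r = [\<rho>]\<^sub>r \<otimes> 1 + (id \<otimes> B\<^sub>r) \<Delta> \<rho>\<close>, where \<open>B\<^sub>r\<close> joins the trees of a forest to a
  root labeled \<open>r\<close>. Together with multiplicativity it determines the coproduct and replaces cuts from
  here on.
\<close>

lemma coproduct_sum_tree:
  "coproduct_sum g {#Node r \<rho>#} = g {#Node r \<rho>#} {#} + coproduct_sum (\<lambda>x y. g x {#Node r y#}) \<rho>"
proof -
  have "coproduct_sum g {#Node r \<rho>#} = lin_eval (\<lambda>(x, y). g x y) (CK_coproduct_tree (Node r \<rho>))"
    by (simp add: coproduct_sum_def CK_coproduct_def)
  also have "\<dots> = g {#Node r \<rho>#} {#} + (\<Sum>C\<in>antichains \<rho>. g (pruned C) {#Node r (trunk C \<rho>)#})"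
    unfolding lin_eval_CK_coproduct_tree by simp
  also have "(\<Sum>C\<in>antichains \<rho>. g (pruned C) {#Node r (trunk C \<rho>)#}) =
      coproduct_sum (\<lambda>x y. g x {#Node r y#}) \<rho>"
    by (rule sum_antichains)
  finally show ?thesis .
qed

section \<open>Degrees and symmetry factors\<close>

lemma forest_degree_empty [simp]: "forest_degree {#} = 0"
  by (simp add: forest_degree_def)

lemma forest_degree_add_mset [simp]: "forest_degree (add_mset t \<rho>) = tree_degree t + forest_degree \<rho>"
  by (simp add: forest_degree_def)

lemma forest_degree_plus [simp]: "forest_degree (\<rho> + \<rho>') = forest_degree \<rho> + forest_degree \<rho>'"
  by (simp add: forest_degree_def)

lemma tree_degree_Node [simp]: "tree_degree (Node r \<rho>) = Suc (forest_degree \<rho>)"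
  by (simp add: forest_degree_def)

declare tree_degree.simps [simp del]

lemma tree_degree_pos: "0 < tree_degree t"
  by (cases t) simp

lemma forest_degree_eq_0 [simp]: "forest_degree \<rho> = 0 \<longleftrightarrow> \<rho> = {#}"
  by (cases \<rho>) (auto simp: tree_degree_pos)

lemma size_le_forest_degree: "size \<rho> \<le> forest_degree \<rho>"
proof (induction \<rho>)
  case (add t \<rho>)
  have "0 < tree_degree t" by (rule tree_degree_pos)
  with add show ?case by simp
qed simp

lemma tree_degree_le: "t \<in># \<rho> \<Longrightarrow> tree_degree t \<le> forest_degree \<rho>"
  by (auto dest!: multi_member_split)

text \<open>
  A forest of degree at most \<open>n + 1\<close> consists of at most \<open>n + 1\<close> trees, each of which is a root with a
  forest of degree at most \<open>n\<close> below it.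
\<close>

lemma finite_forest_degree_le: "finite {\<rho> :: 'l::finite forest. forest_degree \<rho> \<le> n}"
proof (induction n)
  case 0
  then show ?case by simp
next
  case (Suc n)
  define T where "T = (\<lambda>(r, \<rho>). Node r \<rho>) ` (UNIV \<times> {\<rho> :: 'l forest. forest_degree \<rho> \<le> n})"
  have "finite T" using Suc by (simp add: T_def)
  have T: "t \<in> T" if "tree_degree t \<le> Suc n" for t :: "'l ltree"
    using that by (cases t) (auto simp: T_def)
  have "{\<rho> :: 'l forest. forest_degree \<rho> \<le> Suc n} \<subseteq> mset ` {xs. set xs \<subseteq> T \<and> length xs \<le> Suc n}"
  proof
    fix \<rho> :: "'l forest" assume "\<rho> \<in> {\<rho>. forest_degree \<rho> \<le> Suc n}"
    then have d: "forest_degree \<rho> \<le> Suc n" by simp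
    obtain xs where xs: "mset xs = \<rho>" using ex_mset by blast
    have "length xs = size \<rho>" using xs by auto
    also have "\<dots> \<le> forest_degree \<rho>" by (rule size_le_forest_degree)
    finally have "length xs \<le> Suc n" using d by simp
    moreover have "set xs \<subseteq> T"
    proof
      fix t assume "t \<in> set xs"
      then have "t \<in># \<rho>" using xs by auto
      then have "tree_degree t \<le> forest_degree \<rho>" by (rule tree_degree_le)
      then show "t \<in> T" using T d by force
    qed
    ultimately show "\<rho> \<in> mset ` {xs. set xs \<subseteq> T \<and> length xs \<le> Suc n}" using xs by blast
  qed
  then show ?case
    by (rule finite_subset) (intro finite_imageI finite_lists_length_le \<open>finite T\<close>)
qed

lemma finite_forests: "finite (forests n :: 'l::finite forest set)"
  by (rule finite_subset[OF _ finite_forest_degree_le[of n]]) (auto simp: forests_def)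

lemma forest_symmetry_empty [simp]: "forest_symmetry {#} = 1"
  by (simp add: forest_symmetry_def)

lemma forest_symmetry_superset:
  assumes "finite S" "set_mset \<rho> \<subseteq> S"
  shows "forest_symmetry \<rho> = (\<Prod>t\<in>S. fact (count \<rho> t) * tree_symmetry t ^ count \<rho> t)"
  unfolding forest_symmetry_def using assms
  by (intro prod.mono_neutral_left) (auto simp: not_in_iff)

lemma forest_symmetry_add_mset:
  "forest_symmetry (add_mset t \<rho>) = Suc (count \<rho> t) * tree_symmetry t * forest_symmetry \<rho>"
proof -
  let ?S = "insert t (set_mset \<rho>)"
  have "forest_symmetry (add_mset t \<rho>) =
      (\<Prod>s\<in>?S. fact (count (add_mset t \<rho>) s) * tree_symmetry s ^ count (add_mset t \<rho>) s)"
    by (rule forest_symmetry_superset) auto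
  also have "\<dots> = (fact (Suc (count \<rho> t)) * tree_symmetry t ^ Suc (count \<rho> t)) *
      (\<Prod>s\<in>?S - {t}. fact (count \<rho> s) * tree_symmetry s ^ count \<rho> s)"
    by (subst prod.remove[of _ t]) (auto intro!: prod.cong)
  also have "\<dots> = Suc (count \<rho> t) * tree_symmetry t *
      (\<Prod>s\<in>?S. fact (count \<rho> s) * tree_symmetry s ^ count \<rho> s)"
    by (subst (2) prod.remove[of _ t]) (auto simp: algebra_simps)
  also have "(\<Prod>s\<in>?S. fact (count \<rho> s) * tree_symmetry s ^ count \<rho> s) = forest_symmetry \<rho>"
    by (rule forest_symmetry_superset[symmetric]) auto
  finally show ?thesis .
qed

lemma tree_symmetry_Node [simp]: "tree_symmetry (Node r \<rho>) = forest_symmetry \<rho>"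
proof -
  have "(\<Prod>n\<in>#image_mset tree_symmetry \<rho>. n) = (\<Prod>t\<in>set_mset \<rho>. tree_symmetry t ^ count \<rho> t)"
    by (simp add: image_prod_mset_multiplicity)
  then show ?thesis by (simp add: forest_symmetry_def prod.distrib)
qed

declare tree_symmetry.simps [simp del]

lemma forest_symmetry_single [simp]: "forest_symmetry {#t#} = tree_symmetry t"
  by (simp add: forest_symmetry_def)

lemma forest_symmetry_pos [simp]: "0 < forest_symmetry \<rho>"
proof (induction \<rho> rule: measure_induct_rule[of forest_degree])
  case (less \<rho>)
  show ?case
  proof (cases \<rho>)
    case (add t \<rho>')
    obtain r \<pi> where t: "t = Node r \<pi>" by (cases t)
    have "0 < forest_symmetry \<pi>" "0 < forest_symmetry \<rho>'"
      by (rule less; simp add: add t)+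
    then show ?thesis by (simp add: add t forest_symmetry_add_mset)
  qed simp
qed

lemma forest_symmetry_neq_0 [simp]: "forest_symmetry \<rho> \<noteq> 0"
  using forest_symmetry_pos[of \<rho>] by linarith

section \<open>Grading and coassociativity of the Connes-Kreimer coproduct\<close>

lemma coproduct_sum_add: "coproduct_sum (\<lambda>x y. f x y + g x y) \<rho> = coproduct_sum f \<rho> + coproduct_sum g \<rho>"
  unfolding coproduct_sum_def lin_eval_plus[symmetric] by (rule arg_cong[of _ _ "\<lambda>f. lin_eval f _"]) auto

lemma coproduct_sum_scale: "coproduct_sum (\<lambda>x y. c * f x y) \<rho> = c * coproduct_sum f \<rho>"
  unfolding coproduct_sum_def lin_eval_scale[symmetric] by (rule arg_cong[of _ _ "\<lambda>f. lin_eval f _"]) auto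

lemma coproduct_sum_zero [simp]: "coproduct_sum (\<lambda>x y. 0) \<rho> = 0"
  using coproduct_sum_scale[of 0 "\<lambda>x y. 0" \<rho>] by simp

lemma coproduct_sum_scale_right: "coproduct_sum (\<lambda>x y. f x y * c) \<rho> = coproduct_sum f \<rho> * c"
  using coproduct_sum_scale[of c f \<rho>] by (simp add: mult.commute)

lemma coproduct_sum_sum: "coproduct_sum (\<lambda>x y. \<Sum>i\<in>A. f i x y) \<rho> = (\<Sum>i\<in>A. coproduct_sum (f i) \<rho>)"
  by (induction A rule: infinite_finite_induct) (simp_all add: coproduct_sum_add)

lemma coproduct_sum_swap:
  "coproduct_sum (\<lambda>x y. coproduct_sum (\<lambda>x' y'. f x y x' y') \<rho>') \<rho> =
   coproduct_sum (\<lambda>x' y'. coproduct_sum (\<lambda>x y. f x y x' y') \<rho>) \<rho>'"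
  using lin_eval_swap[of "\<lambda>(x, y) (x', y'). f x y x' y'" "CK_coproduct \<rho>'" "CK_coproduct \<rho>"]
  by (simp add: coproduct_sum_def case_prod_unfold)

lemma coproduct_sum_add_mset:
  "coproduct_sum g (add_mset (Node r \<pi>) \<rho>) =
     coproduct_sum (\<lambda>x y. g (add_mset (Node r \<pi>) x) y) \<rho> +
     coproduct_sum (\<lambda>x y. coproduct_sum (\<lambda>x' y'. g (x + x') (add_mset (Node r y) y')) \<rho>) \<pi>"
  using coproduct_sum_plus[of g "{#Node r \<pi>#}" \<rho>] by (simp add: coproduct_sum_tree)

text \<open>
  The induction that fits the recursion of the coproduct: one tree is taken off the forest, and the
  hypothesis is available both for the rest and for the forest below the root of that tree.
\<close>

lemma forest_induct [case_names empty add]: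
  assumes "P {#}" "\<And>r \<pi> \<rho>. P \<pi> \<Longrightarrow> P \<rho> \<Longrightarrow> P (add_mset (Node r \<pi>) \<rho>)"
  shows "P \<rho>"
proof (induction \<rho> rule: measure_induct_rule[of forest_degree])
  case (less \<rho>)
  show ?case
  proof (cases \<rho>)
    case empty
    then show ?thesis using assms(1) by simp
  next
    case (add t \<rho>')
    obtain r \<pi> where t: "t = Node r \<pi>" by (cases t)
    have "P \<pi>" "P \<rho>'" by (rule less; simp add: add t)+
    then show ?thesis using assms(2) by (simp add: add t)
  qed
qed

text \<open>
  The terms \<open>x \<otimes> y\<close> of the coproduct have total degree \<open>|\<rho>|\<close>, so other values of the functional are
  immaterial.
\<close>

lemma coproduct_sum_cong:
  assumes "\<And>x y. forest_degree x + forest_degree y = forest_degree \<rho> \<Longrightarrow> f x y = g x y"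
  shows "coproduct_sum f \<rho> = coproduct_sum g \<rho>"
  using assms
proof (induction \<rho> arbitrary: f g rule: forest_induct)
  case empty
  then show ?case by simp
next
  case (add r \<pi> \<rho>)
  have "coproduct_sum (\<lambda>x y. f (add_mset (Node r \<pi>) x) y) \<rho> = coproduct_sum (\<lambda>x y. g (add_mset (Node r \<pi>) x) y) \<rho>"
    by (rule add.IH) (simp add: add.prems)
  moreover have "coproduct_sum (\<lambda>x y. coproduct_sum (\<lambda>x' y'. f (x + x') (add_mset (Node r y) y')) \<rho>) \<pi> =
      coproduct_sum (\<lambda>x y. coproduct_sum (\<lambda>x' y'. g (x + x') (add_mset (Node r y) y')) \<rho>) \<pi>"
  proof (rule add.IH(1), rule add.IH(2))
    fix x y x' y' :: "'a forest"
    assume "forest_degree x + forest_degree y = forest_degree \<pi>"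
      "forest_degree x' + forest_degree y' = forest_degree \<rho>"
    then show "f (x + x') (add_mset (Node r y) y') = g (x + x') (add_mset (Node r y) y')"
      by (intro add.prems) simp
  qed
  ultimately show ?case by (simp add: coproduct_sum_add_mset)
qed

lemma coproduct_sum_left:
  assumes "\<And>x y. y \<noteq> {#} \<Longrightarrow> g x y = 0"
  shows "coproduct_sum g \<rho> = g \<rho> {#}"
  using assms
  by (induction \<rho> arbitrary: g rule: forest_induct) (simp_all add: coproduct_sum_add_mset)

lemma coproduct_sum_right:
  assumes "\<And>x y. x \<noteq> {#} \<Longrightarrow> g x y = 0"
  shows "coproduct_sum g \<rho> = g {#} \<rho>"
  using assms
proof (induction \<rho> arbitrary: g rule: forest_induct)
  case (add r \<pi> \<rho>)
  have "coproduct_sum (\<lambda>x' y'. g (x + x') (add_mset (Node r y) y')) \<rho> = g x (add_mset (Node r y) \<rho>)" for x y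
    by (subst add.IH(2)) (auto simp: add.prems)
  moreover have "coproduct_sum (\<lambda>x y. g x (add_mset (Node r y) \<rho>)) \<pi> = g {#} (add_mset (Node r \<pi>) \<rho>)"
    by (subst add.IH(1)) (auto simp: add.prems)
  ultimately show ?case by (simp add: coproduct_sum_add_mset add.prems)
qed simp

text \<open>
  The coproduct without its primitive terms \<open>\<rho> \<otimes> 1\<close> and \<open>1 \<otimes> \<rho>\<close>.
\<close>

definition reduced_sum :: "('l forest \<Rightarrow> 'l forest \<Rightarrow> real) \<Rightarrow> 'l forest \<Rightarrow> real" where
  "reduced_sum g = coproduct_sum (\<lambda>x y. if x = {#} \<or> y = {#} then 0 else g x y)"

lemma coproduct_sum_primitive:
  assumes "\<rho> \<noteq> {#}"
  shows "coproduct_sum g \<rho> = g \<rho> {#} + g {#} \<rho> + reduced_sum g \<rho>"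
proof -
  have "coproduct_sum g \<rho> = coproduct_sum (\<lambda>x y. ((if y = {#} then g x y else 0) +
      (if x = {#} then g x y else 0)) + (if x = {#} \<or> y = {#} then 0 else g x y)) \<rho>"
    by (rule coproduct_sum_cong) (use assms in auto)
  also have "\<dots> = g \<rho> {#} + g {#} \<rho> + reduced_sum g \<rho>"
    unfolding coproduct_sum_add reduced_sum_def
    by (simp add: coproduct_sum_left coproduct_sum_right)
  finally show ?thesis .
qed

lemma reduced_sum_cong:
  assumes "\<And>x y. x \<noteq> {#} \<Longrightarrow> y \<noteq> {#} \<Longrightarrow> forest_degree x + forest_degree y = forest_degree \<rho> \<Longrightarrow> f x y = g x y"
  shows "reduced_sum f \<rho> = reduced_sum g \<rho>"
  unfolding reduced_sum_def by (rule coproduct_sum_cong) (use assms in auto)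

lemma reduced_sum_zero [simp]: "reduced_sum (\<lambda>x y. 0) \<rho> = 0"
  by (simp add: reduced_sum_def)

text \<open>
  Coassociativity. Both sides are multiplicative in the forest, and applying the recursion for a tree
  twice yields on both sides one term with the whole tree on the left, one with its root in the middle
  and one with its root on the right.
\<close>

lemma coproduct_sum_coassoc:
  "coproduct_sum (\<lambda>x y. coproduct_sum (\<lambda>u v. g u v y) x) \<rho> =
   coproduct_sum (\<lambda>x y. coproduct_sum (\<lambda>v w. g x v w) y) \<rho>"
proof (induction \<rho> arbitrary: g rule: forest_induct)
  case empty
  then show ?case by simp
next
  case (add r \<pi> \<rho>)
  let ?t = "Node r \<pi>"
  have *: "coproduct_sum (\<lambda>x' y'. coproduct_sum (\<lambda>u v. g u v (add_mset (Node r y) y')) (x + x')) \<rho> =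
      coproduct_sum (\<lambda>u v. coproduct_sum (\<lambda>x' y'. coproduct_sum
         (\<lambda>u' v'. g (u + u') (v + v') (add_mset (Node r y) y')) x') \<rho>) x" for x y
    by (simp only: coproduct_sum_plus) (rule coproduct_sum_swap)
  have "coproduct_sum (\<lambda>x y. coproduct_sum (\<lambda>u v. g u v y) x) (add_mset ?t \<rho>) =
      coproduct_sum (\<lambda>x y. coproduct_sum (\<lambda>u v. g (add_mset ?t u) v y) x) \<rho> +
      coproduct_sum (\<lambda>x y. coproduct_sum (\<lambda>u v. coproduct_sum (\<lambda>u' v'. g (u + u') (add_mset (Node r v) v') y) x) \<pi>) \<rho> +
      coproduct_sum (\<lambda>x y. coproduct_sum (\<lambda>u v. coproduct_sum (\<lambda>x' y'. coproduct_sum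
         (\<lambda>u' v'. g (u + u') (v + v') (add_mset (Node r y) y')) x') \<rho>) x) \<pi>"
    by (simp only: coproduct_sum_add_mset[of _ r \<pi> \<rho>] coproduct_sum_add_mset[of _ r \<pi> for x] coproduct_sum_add *)
  also have "coproduct_sum (\<lambda>x y. coproduct_sum (\<lambda>u v. g (add_mset ?t u) v y) x) \<rho> =
     coproduct_sum (\<lambda>x y. coproduct_sum (\<lambda>v w. g (add_mset ?t x) v w) y) \<rho>"
    by (rule add.IH)
  also have "coproduct_sum (\<lambda>x y. coproduct_sum (\<lambda>u v. coproduct_sum (\<lambda>u' v'. g (u + u') (add_mset (Node r v) v') y) x) \<pi>) \<rho> =
     coproduct_sum (\<lambda>u v. coproduct_sum (\<lambda>x y. coproduct_sum (\<lambda>u' v'. g (u + u') (add_mset (Node r v) v') y) x) \<rho>) \<pi>"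
    by (rule coproduct_sum_swap)
  also have "\<dots> = coproduct_sum (\<lambda>u v. coproduct_sum (\<lambda>x y. coproduct_sum (\<lambda>v' w'. g (u + x) (add_mset (Node r v) v') w') y) \<rho>) \<pi>"
    by (simp only: add.IH(2))
  also have "coproduct_sum (\<lambda>x y. coproduct_sum (\<lambda>u v. coproduct_sum (\<lambda>x' y'. coproduct_sum
         (\<lambda>u' v'. g (u + u') (v + v') (add_mset (Node r y) y')) x') \<rho>) x) \<pi> =
      coproduct_sum (\<lambda>x y. coproduct_sum (\<lambda>v w. coproduct_sum (\<lambda>x' y'. coproduct_sum
         (\<lambda>v' w'. g (x + x') (v + v') (add_mset (Node r w) w')) y') \<rho>) y) \<pi>"
    by (simp only: add.IH(2)) (rule add.IH(1))
  also have "\<dots> = coproduct_sum (\<lambda>x y. coproduct_sum (\<lambda>x' y'. coproduct_sum (\<lambda>v w. coproduct_sum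
         (\<lambda>v' w'. g (x + x') (v + v') (add_mset (Node r w) w')) y') y) \<rho>) \<pi>"
    by (subst coproduct_sum_swap) simp
  finally show ?case
    by (simp only: coproduct_sum_add_mset[of _ r \<pi> \<rho>] coproduct_sum_add_mset coproduct_sum_add)
qed

section \<open>Characters\<close>

definition character :: "('l forest \<Rightarrow> real) \<Rightarrow> bool" where
  "character a \<longleftrightarrow> a {#} = 1 \<and> (\<forall>x y. a (x + y) = a x * a y)"

lemma character_empty: "character a \<Longrightarrow> a {#} = 1"
  and character_plus: "character a \<Longrightarrow> a (x + y) = a x * a y"
  and character_add_mset: "character a \<Longrightarrow> a (add_mset t x) = a {#t#} * a x"
  unfolding character_def by (blast, blast, metis add_mset_add_single union_commute)

lemma CK_product_eq: "CK_product a b \<rho> = coproduct_sum (\<lambda>x y. a x * b y) \<rho>"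
  by (simp add: CK_product_def coproduct_sum_def lin_eval_def case_prod_beta)

lemma character_CK_product:
  assumes "character a" "character b"
  shows "character (CK_product a b)"
proof -
  have "CK_product a b (x + y) = CK_product a b x * CK_product a b y" for x y
  proof -
    have "CK_product a b (x + y) = coproduct_sum (\<lambda>u v. coproduct_sum (\<lambda>u' v'. (a u * b v) * (a u' * b v')) y) x"
      by (simp add: CK_product_eq coproduct_sum_plus character_plus assms mult_ac)
    also have "\<dots> = coproduct_sum (\<lambda>u v. (a u * b v) * CK_product a b y) x"
      by (simp only: coproduct_sum_scale CK_product_eq)
    finally show ?thesis by (simp only: coproduct_sum_scale_right CK_product_eq)
  qed
  then show ?thesis using assms by (simp add: character_def CK_product_eq)
qed

lemma CK_product_assoc: "CK_product (CK_product a b) c = CK_product a (CK_product b c)"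
proof
  fix \<rho>
  have "CK_product (CK_product a b) c \<rho> = coproduct_sum (\<lambda>x y. coproduct_sum (\<lambda>u v. a u * b v * c y) x) \<rho>"
    by (simp add: CK_product_eq coproduct_sum_scale_right)
  also have "\<dots> = coproduct_sum (\<lambda>x y. coproduct_sum (\<lambda>v w. a x * b v * c w) y) \<rho>"
    by (rule coproduct_sum_coassoc)
  also have "\<dots> = CK_product a (CK_product b c) \<rho>"
    by (simp add: CK_product_eq coproduct_sum_scale mult.assoc)
  finally show "CK_product (CK_product a b) c \<rho> = CK_product a (CK_product b c) \<rho>" .
qed

section \<open>Splitting a forest over a set of slots\<close>

lemma subforest_insert:
  assumes "finite I" "i \<notin> I"
  shows "subforest (insert i I) = add_mset (fst i) (subforest I)"
  using assms by (simp add: subforest_def)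

lemma subforest_empty [simp]: "subforest {} = {#}"
  by (simp add: subforest_def)

definition fibres :: "'a multiset \<Rightarrow> ('a \<times> nat \<Rightarrow> 's) \<Rightarrow> 's \<Rightarrow> 'a multiset" where
  "fibres \<pi> \<phi> = (\<lambda>v. subforest {i \<in> occs \<pi>. \<phi> i = v})"

lemma fibres_add_mset:
  assumes "\<phi> (x, count \<pi> x) = v"
  shows "fibres (add_mset x \<pi>) \<phi> = (fibres \<pi> \<phi>)(v := add_mset x (fibres \<pi> \<phi> v))"
proof
  fix w
  have "{i \<in> occs (add_mset x \<pi>). \<phi> i = w} =
      (if w = v then insert (x, count \<pi> x) {i \<in> occs \<pi>. \<phi> i = w} else {i \<in> occs \<pi>. \<phi> i = w})"
    using assms by (auto simp: occs_add_mset)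
  then show "fibres (add_mset x \<pi>) \<phi> w = ((fibres \<pi> \<phi>)(v := add_mset x (fibres \<pi> \<phi> v))) w"
    by (simp add: fibres_def subforest_insert)
qed

lemma fibres_cong: "(\<And>i. i \<in> occs \<pi> \<Longrightarrow> \<phi> i = \<psi> i) \<Longrightarrow> fibres \<pi> \<phi> = fibres \<pi> \<psi>"
  unfolding fibres_def by (intro ext arg_cong[of _ _ subforest]) auto

lemma card_fibres_add_mset:
  assumes "finite S"
  shows "card {\<phi> \<in> occs (add_mset x \<pi>) \<rightarrow>\<^sub>E S. fibres (add_mset x \<pi>) \<phi> = A} =
    (\<Sum>v | v \<in> S \<and> x \<in># A v. card {\<psi> \<in> occs \<pi> \<rightarrow>\<^sub>E S. fibres \<pi> \<psi> = A(v := A v - {#x#})})"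
proof -
  define i where "i = (x, count \<pi> x)"
  have i: "i \<notin> occs \<pi>" by (simp add: i_def)
  have fib: "fibres (add_mset x \<pi>) (\<psi>(i := v)) = A \<longleftrightarrow>
      x \<in># A v \<and> fibres \<pi> \<psi> = A(v := A v - {#x#})" for \<psi> v
  proof -
    have "fibres \<pi> (\<psi>(i := v)) = fibres \<pi> \<psi>" by (rule fibres_cong) (use i in auto)
    then have "fibres (add_mset x \<pi>) (\<psi>(i := v)) = (fibres \<pi> \<psi>)(v := add_mset x (fibres \<pi> \<psi> v))"
      using fibres_add_mset[of "\<psi>(i := v)" x \<pi> v] by (simp add: i_def)
    moreover have "f(v := add_mset x (f v)) = A \<longleftrightarrow> x \<in># A v \<and> f = A(v := A v - {#x#})" for f
    proof
      assume "f(v := add_mset x (f v)) = A"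
      then have A: "A = f(v := add_mset x (f v))" by simp
      show "x \<in># A v \<and> f = A(v := A v - {#x#})" unfolding A by simp
    qed auto
    ultimately show ?thesis by simp
  qed
  let ?Y = "occs \<pi> \<rightarrow>\<^sub>E S"
  have "{\<phi> \<in> occs (add_mset x \<pi>) \<rightarrow>\<^sub>E S. fibres (add_mset x \<pi>) \<phi> = A} =
      {\<phi> \<in> (\<lambda>(v, \<psi>). \<psi>(i := v)) ` (S \<times> ?Y). fibres (add_mset x \<pi>) \<phi> = A}"
    unfolding occs_add_mset i_def[symmetric] PiE_insert_eq ..
  also have "\<dots> = (\<lambda>(v, \<psi>). \<psi>(i := v)) ` {(v, \<psi>) \<in> S \<times> ?Y. fibres (add_mset x \<pi>) (\<psi>(i := v)) = A}"
    by auto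
  also have "{(v, \<psi>) \<in> S \<times> ?Y. fibres (add_mset x \<pi>) (\<psi>(i := v)) = A} =
      (SIGMA v:{v \<in> S. x \<in># A v}. {\<psi> \<in> ?Y. fibres \<pi> \<psi> = A(v := A v - {#x#})})"
    unfolding fib by blast
  finally have "{\<phi> \<in> occs (add_mset x \<pi>) \<rightarrow>\<^sub>E S. fibres (add_mset x \<pi>) \<phi> = A} =
      (\<lambda>(v, \<psi>). \<psi>(i := v)) ` (SIGMA v:{v \<in> S. x \<in># A v}. {\<psi> \<in> ?Y. fibres \<pi> \<psi> = A(v := A v - {#x#})})" .
  moreover have "inj_on (\<lambda>(v, \<psi>). \<psi>(i := v))
      (SIGMA v:{v \<in> S. x \<in># A v}. {\<psi> \<in> occs \<pi> \<rightarrow>\<^sub>E S. fibres \<pi> \<psi> = A(v := A v - {#x#})})"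
    by (rule inj_on_subset[OF inj_combinator[OF i, of "\<lambda>_. S"]]) auto
  ultimately show ?thesis
    using assms by (simp add: card_image card_SigmaI finite_PiE)
qed

text \<open>
  The number of ways to distribute the factors of \<open>\<pi>\<close> over slots, with prescribed forest \<open>A v\<close> in each
  slot \<open>v\<close>, is a product of multinomial coefficients. Weighted by a function \<open>e\<close> with divided powers, for
  instance \<open>e \<pi> = 1 / \<sigma>(\<pi>)\<close>, it becomes a product over the slots. In the induction the new factor \<open>x\<close>
  goes to some slot \<open>v\<close> with \<open>x\<close> in \<open>A v\<close>.
\<close>

lemma card_fibres:
  fixes e :: "'a multiset \<Rightarrow> real"
  assumes S: "finite S" and e0: "e {#} = 1"
    and e: "\<And>x \<pi>. real (Suc (count \<pi> x)) * e (add_mset x \<pi>) = q x * e \<pi>"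
  shows "e \<pi> * real (card {\<phi> \<in> occs \<pi> \<rightarrow>\<^sub>E S. fibres \<pi> \<phi> = A}) =
    (if (\<forall>v. v \<notin> S \<longrightarrow> A v = {#}) \<and> sum A S = \<pi> then \<Prod>v\<in>S. e (A v) else 0)"
proof (induction \<pi> arbitrary: A)
  case empty
  have f: "fibres {#} \<phi> = (\<lambda>_. {#})" for \<phi> :: "'a \<times> nat \<Rightarrow> 'b" by (simp add: fibres_def)
  have "(\<forall>v. v \<notin> S \<longrightarrow> A v = {#}) \<and> sum A S = {#} \<longleftrightarrow> A = (\<lambda>_. {#})"
  proof
    assume *: "(\<forall>v. v \<notin> S \<longrightarrow> A v = {#}) \<and> sum A S = {#}"
    have "A v = {#}" for v
    proof (cases "v \<in> S")
      case True
      then have "sum A S = A v + sum A (S - {v})" using S by (simp add: sum.remove)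
      then show ?thesis using * by simp
    qed (use * in auto)
    then show "A = (\<lambda>_. {#})" by auto
  qed simp
  then show ?case by (auto simp: f e0)
next
  case (add x \<pi>)
  let ?c = "real (Suc (count \<pi> x))"
  let ?N = "\<lambda>A. card {\<psi> \<in> occs \<pi> \<rightarrow>\<^sub>E S. fibres \<pi> \<psi> = A}"
  let ?C = "(\<forall>v. v \<notin> S \<longrightarrow> A v = {#}) \<and> sum A S = add_mset x \<pi>"
  have "?c * (e (add_mset x \<pi>) * real (card {\<phi> \<in> occs (add_mset x \<pi>) \<rightarrow>\<^sub>E S. fibres (add_mset x \<pi>) \<phi> = A})) =
      (\<Sum>v | v \<in> S \<and> x \<in># A v. q x * (e \<pi> * ?N (A(v := A v - {#x#}))))"
    unfolding card_fibres_add_mset[OF S] using e[of \<pi> x]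
    by (simp add: sum_distrib_left mult.assoc[symmetric])
  also have "\<dots> = (\<Sum>v | v \<in> S \<and> x \<in># A v. if ?C then real (count (A v) x) * (\<Prod>w\<in>S. e (A w)) else 0)"
  proof (rule sum.cong[OF refl])
    fix v assume "v \<in> {v. v \<in> S \<and> x \<in># A v}"
    then have v: "v \<in> S" "x \<in># A v" by auto
    then obtain B where B: "A v = add_mset x B" by (blast dest: multi_member_split)
    let ?A = "A(v := A v - {#x#})"
    \<comment> \<open>The constraint on the slots and the weight are compared with those for the filling without \<open>x\<close>.\<close>
    have "sum A S = A v + sum A (S - {v})" "sum ?A S = ?A v + sum ?A (S - {v})"
      using S v by (simp_all add: sum.remove)
    moreover have "sum ?A (S - {v}) = sum A (S - {v})" by (rule sum.cong) auto
    ultimately have "sum A S = add_mset x (sum ?A S)" by (simp add: B)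
    then have C: "(\<forall>w. w \<notin> S \<longrightarrow> ?A w = {#}) \<and> sum ?A S = \<pi> \<longleftrightarrow> ?C" using v by auto
    have "(\<Prod>w\<in>S. e (A w)) = e (A v) * (\<Prod>w\<in>S - {v}. e (A w))"
      "(\<Prod>w\<in>S. e (?A w)) = e B * (\<Prod>w\<in>S - {v}. e (?A w))"
      using S v by (simp_all add: prod.remove[of S v] B)
    moreover have "(\<Prod>w\<in>S - {v}. e (?A w)) = (\<Prod>w\<in>S - {v}. e (A w))" by (rule prod.cong) auto
    ultimately have "q x * (\<Prod>w\<in>S. e (?A w)) = real (count (A v) x) * (\<Prod>w\<in>S. e (A w))"
      using e[of B x] by (simp add: B)
    moreover have "e \<pi> * ?N ?A = (if ?C then \<Prod>w\<in>S. e (?A w) else 0)" unfolding add[of ?A] C by (rule HOL.refl)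
    ultimately show "q x * (e \<pi> * ?N ?A) = (if ?C then real (count (A v) x) * (\<Prod>w\<in>S. e (A w)) else 0)"
      by (simp only: mult_zero_right split: if_split) blast
  qed
  also have "\<dots> = (if ?C then (\<Sum>v | v \<in> S \<and> x \<in># A v. real (count (A v) x)) * (\<Prod>w\<in>S. e (A w)) else 0)"
  proof (cases ?C)
    case True
    show ?thesis unfolding if_P[OF True] sum_distrib_right ..
  next
    case False
    show ?thesis unfolding if_not_P[OF False] by simp
  qed
  also have "(\<Sum>v | v \<in> S \<and> x \<in># A v. real (count (A v) x)) = (\<Sum>v\<in>S. real (count (A v) x))"
    using S by (intro sum.mono_neutral_left) (auto simp: not_in_iff)
  also have "\<dots> = real (count (sum A S) x)"
    by (simp add: count_sum)
  finally have "?c * (e (add_mset x \<pi>) * real (card {\<phi> \<in> occs (add_mset x \<pi>) \<rightarrow>\<^sub>E S. fibres (add_mset x \<pi>) \<phi> = A})) =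
      ?c * (if ?C then (\<Prod>w\<in>S. e (A w)) else 0)"
    by auto
  then show ?case by (subst (asm) mult_cancel_left) auto
qed

section \<open>The Grossman-Larson product\<close>

text \<open>
  The places to which a tree can go in a product \<open>\<pi> \<ast> \<rho>\<close>: a vertex of \<open>\<rho>\<close>, or \<open>None\<close> for the trees that
  become separate factors.
\<close>

definition slots :: "'l forest \<Rightarrow> 'l vertex option set" where
  "slots \<rho> = insert None (Some ` vertices \<rho>)"

definition graft_all :: "'l forest \<Rightarrow> ('l vertex option \<Rightarrow> 'l forest) \<Rightarrow> 'l forest" where
  "graft_all \<rho> A = A None + graft (\<lambda>v. A (Some v)) \<rho>"

lemma finite_slots [simp]: "finite (slots \<rho>)"
  by (simp add: slots_def)

lemma graft_cong:
  "(\<And>v. v \<in> vertices \<rho> \<Longrightarrow> A v = B v) \<Longrightarrow> graft A \<rho> = graft B \<rho>"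
proof (induction \<rho> arbitrary: A B rule: measure_induct_rule[of forest_degree])
  case (less \<rho>)
  have "graft (\<lambda>v. A (i # v)) (children (fst i)) = graft (\<lambda>v. B (i # v)) (children (fst i))"
    "A [i] = B [i]" if "i \<in> occs \<rho>" for i
    by (rule less.IH, use that in \<open>simp add: degree_children_less\<close>)
      (rule less.prems, use that in \<open>simp add: Cons_in_vertices\<close>)+
  then show ?case
    unfolding graft.simps[of A] graft.simps[of B] by (intro image_mset_cong) simp
qed

lemma graft_empty [simp]: "graft A {#} = {#}"
  by (subst graft.simps) simp

lemma graft_add_mset:
  "graft A (add_mset t \<rho>) = add_mset (Node (root t) (A [(t, count \<rho> t)] +
     graft (\<lambda>v. A ((t, count \<rho> t) # v)) (children t))) (graft A \<rho>)"
proof -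
  have "mset_set (occs (add_mset t \<rho>)) = add_mset (t, count \<rho> t) (mset_set (occs \<rho>))"
    by (simp add: occs_add_mset)
  then show ?thesis
    by (simp add: graft.simps[of A "add_mset t \<rho>"] graft.simps[of A \<rho>])
qed

text \<open>
  The slots of a tree with index \<open>i\<close> in a forest are those of the forest of its children; the root of the
  tree plays the part of the slot for separate factors.
\<close>

definition slot_below :: "'l ltree \<times> nat \<Rightarrow> 'l vertex option \<Rightarrow> 'l vertex option" where
  "slot_below i w = Some (i # (case w of None \<Rightarrow> [] | Some v \<Rightarrow> v))"

lemma slots_add_mset:
  "slots (add_mset t \<rho>) = slots \<rho> \<union> slot_below (t, count \<rho> t) ` slots (children t)"
  by (auto simp: slots_def vertices_add_mset slot_below_def image_iff)

lemma slots_disjoint: "slots \<rho> \<inter> slot_below (t, count \<rho> t) ` slots \<pi> = {}"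
  by (auto simp: slots_def slot_below_def Cons_in_vertices)

lemma inj_on_slot_below: "inj_on (slot_below i) (slots \<rho>)"
  by (auto simp: inj_on_def slots_def slot_below_def split: option.splits)

lemma graft_all_add_mset:
  "graft_all (add_mset t \<rho>) A =
     add_mset (Node (root t) (graft_all (children t) (A \<circ> slot_below (t, count \<rho> t)))) (graft_all \<rho> A)"
  by (simp add: graft_all_def graft_add_mset slot_below_def)

lemma graft_all_cong: "(\<And>w. w \<in> slots \<rho> \<Longrightarrow> A w = B w) \<Longrightarrow> graft_all \<rho> A = graft_all \<rho> B"
  by (simp add: graft_all_def slots_def cong: graft_cong)

lemma degree_graft_all: "forest_degree (graft_all \<rho> A) = (\<Sum>w\<in>slots \<rho>. forest_degree (A w)) + forest_degree \<rho>"
proof (induction \<rho> arbitrary: A rule: forest_induct)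
  case empty
  then show ?case by (simp add: graft_all_def slots_def)
next
  case (add r \<pi> \<rho>)
  let ?i = "(Node r \<pi>, count \<rho> (Node r \<pi>))"
  have "(\<Sum>w\<in>slots (add_mset (Node r \<pi>) \<rho>). forest_degree (A w)) =
      (\<Sum>w\<in>slots \<rho>. forest_degree (A w)) + (\<Sum>w\<in>slots \<pi>. forest_degree (A (slot_below ?i w)))"
    by (simp add: slots_add_mset sum.union_disjoint slots_disjoint sum.reindex[OF inj_on_slot_below])
  then show ?case by (simp add: graft_all_add_mset add)
qed

lemma lookup_GL_product_forest:
  "Poly_Mapping.lookup (GL_product_forest \<pi> \<rho>) \<mu> =
     real (card {\<phi> \<in> occs \<pi> \<rightarrow>\<^sub>E slots \<rho>. graft_all \<rho> (fibres \<pi> \<phi>) = \<mu>})"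
proof -
  have fin: "finite (occs \<pi> \<rightarrow>\<^sub>E slots \<rho>)" by (simp add: finite_PiE)
  have "Poly_Mapping.lookup (GL_product_forest \<pi> \<rho>) \<mu> =
      (\<Sum>\<phi>\<in>occs \<pi> \<rightarrow>\<^sub>E slots \<rho>. if graft_all \<rho> (fibres \<pi> \<phi>) = \<mu> then 1 else 0)"
    unfolding GL_product_forest_def slots_def[symmetric]
    by (simp add: lookup_sum lookup_single when_def graft_all_def fibres_def)
  also have "\<dots> = real (card {\<phi> \<in> occs \<pi> \<rightarrow>\<^sub>E slots \<rho>. graft_all \<rho> (fibres \<pi> \<phi>) = \<mu>})"
    using fin by (simp add: sum.If_cases Int_def)
  finally show ?thesis .
qed

lemma sum_fibres:
  assumes "finite S" "\<phi> \<in> occs \<pi> \<rightarrow>\<^sub>E S"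
  shows "sum (fibres \<pi> \<phi>) S = \<pi>"
  using assms(2)
proof (induction \<pi> arbitrary: \<phi>)
  case empty
  then show ?case by (simp add: fibres_def)
next
  case (add x \<pi>)
  let ?v = "\<phi> (x, count \<pi> x)"
  have v: "?v \<in> S" and "restrict \<phi> (occs \<pi>) \<in> occs \<pi> \<rightarrow>\<^sub>E S" using add.prems by (auto simp: occs_add_mset)
  then have "sum (fibres \<pi> (restrict \<phi> (occs \<pi>))) S = \<pi>" by (intro add.IH)
  moreover have "fibres \<pi> (restrict \<phi> (occs \<pi>)) = fibres \<pi> \<phi>" by (rule fibres_cong) simp
  ultimately have "sum (fibres \<pi> \<phi>) S = \<pi>" by simp
  moreover have "sum (fibres (add_mset x \<pi>) \<phi>) S = add_mset x (sum (fibres \<pi> \<phi>) S)"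
    using v assms(1) by (simp add: fibres_add_mset[OF refl] sum.remove[of S ?v])
  ultimately show ?case by simp
qed

lemma degree_sum: "forest_degree (sum A S) = (\<Sum>v\<in>S. forest_degree (A v))"
  by (induction S rule: infinite_finite_induct) auto

lemma degree_GL_product_forest:
  assumes "\<mu> \<in> Poly_Mapping.keys (GL_product_forest \<pi> \<rho>)"
  shows "forest_degree \<mu> = forest_degree \<pi> + forest_degree \<rho>"
proof -
  have "card {\<phi> \<in> occs \<pi> \<rightarrow>\<^sub>E slots \<rho>. graft_all \<rho> (fibres \<pi> \<phi>) = \<mu>} \<noteq> 0"
    using assms by (simp add: in_keys_iff lookup_GL_product_forest)
  then have "{\<phi> \<in> occs \<pi> \<rightarrow>\<^sub>E slots \<rho>. graft_all \<rho> (fibres \<pi> \<phi>) = \<mu>} \<noteq> {}" by (metis card.empty)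
  then obtain \<phi> where "\<phi> \<in> occs \<pi> \<rightarrow>\<^sub>E slots \<rho>" "graft_all \<rho> (fibres \<pi> \<phi>) = \<mu>" by blast
  then show ?thesis
    by (auto simp: degree_graft_all sum_fibres simp flip: degree_sum)
qed

text \<open>
  The degree bound makes this set finite; it is harmless because only fillings of degree at most \<open>|\<mu>|\<close> can
  produce a given forest \<open>\<mu>\<close>.
\<close>

definition slot_fillings :: "'s set \<Rightarrow> nat \<Rightarrow> ('s \<Rightarrow> 'l forest) set" where
  "slot_fillings S n = {A. (\<forall>v. v \<notin> S \<longrightarrow> A v = {#}) \<and> (\<forall>v. forest_degree (A v) \<le> n)}"

lemma finite_slot_fillings: "finite S \<Longrightarrow> finite (slot_fillings S n :: ('s \<Rightarrow> 'l::finite forest) set)"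
  by (rule finite_subset[OF _ finite_set_of_finite_funs[OF _ finite_forest_degree_le[of n], of S "{#}"]])
    (auto simp: slot_fillings_def)

text \<open>
  For \<open>e\<close> with divided powers and \<open>n \<ge> |\<mu>|\<close> this is the coefficient of \<open>\<mu>\<close> in \<open>(\<Sum>\<pi>. e \<pi> \<pi>) \<ast> \<rho>\<close>: the trees that
  go to the different slots are chosen independently of each other.
\<close>

definition grafting_sum :: "('l forest \<Rightarrow> real) \<Rightarrow> nat \<Rightarrow> 'l forest \<Rightarrow> 'l forest \<Rightarrow> real" where
  "grafting_sum e n \<rho> \<mu> =
     (\<Sum>A\<in>slot_fillings (slots \<rho>) n. if graft_all \<rho> A = \<mu> then \<Prod>v\<in>slots \<rho>. e (A v) else 0)"

lemma sum_GL_product_forest: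
  fixes e :: "'l::finite forest \<Rightarrow> real"
  assumes e0: "e {#} = 1"
    and e: "\<And>x \<pi>. real (Suc (count \<pi> x)) * e (add_mset x \<pi>) = q x * e \<pi>"
    and n: "forest_degree \<mu> \<le> n"
  shows "(\<Sum>\<pi> | forest_degree \<pi> \<le> n. e \<pi> * Poly_Mapping.lookup (GL_product_forest \<pi> \<rho>) \<mu>) = grafting_sum e n \<rho> \<mu>"
proof -
  let ?S = "slots \<rho>"
  let ?N = "\<lambda>\<pi> A. card {\<phi> \<in> occs \<pi> \<rightarrow>\<^sub>E ?S. fibres \<pi> \<phi> = A}"
  let ?F = "{\<pi> :: 'l forest. forest_degree \<pi> \<le> n}"
  let ?B = "slot_fillings ?S n :: ('l vertex option \<Rightarrow> 'l forest) set"
  have finB: "finite ?B" by (simp add: finite_slot_fillings)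
  have "e \<pi> * Poly_Mapping.lookup (GL_product_forest \<pi> \<rho>) \<mu> =
      (\<Sum>A\<in>?B. if graft_all \<rho> A = \<mu> then e \<pi> * real (?N \<pi> A) else 0)" if "\<pi> \<in> ?F" for \<pi>
  proof -
    have inB: "fibres \<pi> \<phi> \<in> ?B" if "\<phi> \<in> occs \<pi> \<rightarrow>\<^sub>E ?S" for \<phi>
    proof -
      have d: "forest_degree (fibres \<pi> \<phi> v) \<le> n" if "v \<in> ?S" for v
      proof -
        have "forest_degree (fibres \<pi> \<phi> v) \<le> (\<Sum>v\<in>?S. forest_degree (fibres \<pi> \<phi> v))"
          using that by (intro member_le_sum) auto
        also have "\<dots> = forest_degree \<pi>"
          using \<open>\<phi> \<in> occs \<pi> \<rightarrow>\<^sub>E ?S\<close> by (simp add: sum_fibres flip: degree_sum)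
        finally show ?thesis using \<open>\<pi> \<in> ?F\<close> by simp
      qed
      have z: "fibres \<pi> \<phi> v = {#}" if "v \<notin> ?S" for v
      proof -
        have "{i \<in> occs \<pi>. \<phi> i = v} = {}" using that \<open>\<phi> \<in> occs \<pi> \<rightarrow>\<^sub>E ?S\<close> by auto
        then show ?thesis by (simp only: fibres_def subforest_empty)
      qed
      have "forest_degree (fibres \<pi> \<phi> v) \<le> n" for v
        using d[of v] z[of v] by (cases "v \<in> ?S") auto
      then show ?thesis unfolding slot_fillings_def using z by blast
    qed
    have "{\<phi> \<in> occs \<pi> \<rightarrow>\<^sub>E ?S. graft_all \<rho> (fibres \<pi> \<phi>) = \<mu>} =
        (\<Union>A\<in>{A\<in>?B. graft_all \<rho> A = \<mu>}. {\<phi> \<in> occs \<pi> \<rightarrow>\<^sub>E ?S. fibres \<pi> \<phi> = A})"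
      using inB by auto
    also have "card \<dots> = (\<Sum>A\<in>{A\<in>?B. graft_all \<rho> A = \<mu>}. ?N \<pi> A)"
      using finB by (intro card_UN_disjoint) (auto simp: finite_PiE)
    finally show ?thesis
      using finB by (simp add: lookup_GL_product_forest sum_distrib_left sum.If_cases Int_def)
  qed
  then have "(\<Sum>\<pi>\<in>?F. e \<pi> * Poly_Mapping.lookup (GL_product_forest \<pi> \<rho>) \<mu>) =
      (\<Sum>\<pi>\<in>?F. \<Sum>A\<in>?B. if graft_all \<rho> A = \<mu> then e \<pi> * real (?N \<pi> A) else 0)"
    by (intro sum.cong) auto
  also have "\<dots> = (\<Sum>A\<in>?B. \<Sum>\<pi>\<in>?F. if graft_all \<rho> A = \<mu> then e \<pi> * real (?N \<pi> A) else 0)"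
    by (rule sum.swap)
  also have "\<dots> = grafting_sum e n \<rho> \<mu>"
    unfolding grafting_sum_def
  proof (rule sum.cong[OF refl])
    fix A assume A: "A \<in> ?B"
    show "(\<Sum>\<pi>\<in>?F. if graft_all \<rho> A = \<mu> then e \<pi> * real (?N \<pi> A) else 0) =
        (if graft_all \<rho> A = \<mu> then \<Prod>v\<in>?S. e (A v) else 0)"
    proof (cases "graft_all \<rho> A = \<mu>")
      case True
      have "sum A ?S \<in> ?F" using n True by (auto simp: degree_graft_all degree_sum)
      moreover have "e \<pi> * real (?N \<pi> A) = (if sum A ?S = \<pi> then \<Prod>v\<in>?S. e (A v) else 0)" for \<pi>
        using card_fibres[OF _ e0 e, of ?S \<pi> A] A by (simp add: slot_fillings_def)
      ultimately show ?thesis using True by (simp add: finite_forest_degree_le)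
    qed simp
  qed
  finally show ?thesis .
qed

lemma grafting_sum_empty: "grafting_sum e n {#} \<mu> = (if forest_degree \<mu> \<le> n then e \<mu> else 0)"
  for \<mu> :: "'l::finite forest"
proof -
  have S: "slots {#} = {None}" by (simp add: slots_def)
  let ?B = "slot_fillings {None} n :: ('l vertex option \<Rightarrow> 'l forest) set"
  have "grafting_sum e n {#} \<mu> = (\<Sum>A\<in>?B. if A None = \<mu> then e \<mu> else 0)"
    unfolding grafting_sum_def S by (intro sum.cong) (auto simp: graft_all_def)
  also have "\<dots> = (\<Sum>\<pi> | forest_degree \<pi> \<le> n. if \<pi> = \<mu> then e \<mu> else 0)"
    by (rule sum.reindex_bij_witness[of _ "\<lambda>\<pi>. (\<lambda>_. {#})(None := \<pi>)" "\<lambda>A. A None"])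
      (auto simp: slot_fillings_def fun_eq_iff)
  finally show ?thesis by (simp add: finite_forest_degree_le)
qed

text \<open>
  The trees grafted onto \<open>t\<close> and onto \<open>\<rho>\<close> are chosen independently. In the sum, \<open>u\<close> is the tree of \<open>\<mu>\<close> that
  arises from \<open>t\<close>; it keeps the root of \<open>t\<close>, and its branches arise from those of \<open>t\<close>.
\<close>

lemma grafting_sum_add_mset:
  fixes \<mu> :: "'l::finite forest"
  shows "grafting_sum e n (add_mset t \<rho>) \<mu> = (\<Sum>u\<in>set_mset \<mu>.
    (if root u = root t then grafting_sum e n (children t) (children u) else 0) * grafting_sum e n \<rho> (\<mu> - {#u#}))"
proof -
  define i where "i = (t, count \<rho> t)"
  let ?S0 = "slots \<rho>" and ?S1 = "slots (children t)"
  let ?F = "\<lambda>S. slot_fillings S n :: ('l vertex option \<Rightarrow> 'l forest) set"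
  let ?P = "\<lambda>S A. \<Prod>v\<in>S. e (A v)"
  \<comment> \<open>A filling of the slots of \<open>t \<rho>\<close> is a pair of fillings, of the slots of \<open>\<rho>\<close> and of those in \<open>t\<close>.\<close>
  define join where "join = (\<lambda>(A :: 'l vertex option \<Rightarrow> 'l forest, B :: 'l vertex option \<Rightarrow> 'l forest) w. case w of None \<Rightarrow> A None
    | Some v \<Rightarrow> (case v of [] \<Rightarrow> {#} | k # v' \<Rightarrow> if k = i then B (if v' = [] then None else Some v') else A (Some v)))"
  define split where "split = (\<lambda>A :: 'l vertex option \<Rightarrow> 'l forest. (\<lambda>w. if w \<in> ?S0 then A w else {#}, \<lambda>w. if w \<in> ?S1 then A (slot_below i w) else {#}))"
  have S: "slots (add_mset t \<rho>) = ?S0 \<union> slot_below i ` ?S1" by (simp add: slots_add_mset i_def)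
  have disj: "?S0 \<inter> slot_below i ` ?S1 = {}" by (simp add: i_def slots_disjoint)
  have j0: "join (A, B) w = A w" if "w \<in> ?S0" for A B w
    using that by (auto simp: join_def slots_def i_def Cons_in_vertices split: option.splits list.splits)
  have j1: "join (A, B) (slot_below i w) = B w" if "w \<in> ?S1" for A B w
    using that by (auto simp: join_def slots_def slot_below_def split: option.splits)
  have j2: "join (A, B) w = {#}" if "w \<notin> ?S0" "w \<notin> slot_below i ` ?S1" "A \<in> ?F ?S0" "B \<in> ?F ?S1" for A B w
  proof (cases w)
    case None
    then show ?thesis using that by (simp add: slots_def)
  next
    case (Some v)
    show ?thesis
    proof (cases v)
      case Nil
      then show ?thesis by (simp add: join_def Some)
    next
      case (Cons k v')
      have "B (if v' = [] then None else Some v') = {#}" if "k = i"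
      proof -
        have "w = slot_below i (if v' = [] then None else Some v')"
          by (simp add: Some Cons slot_below_def that)
        then have "(if v' = [] then None else Some v') \<notin> ?S1" using \<open>w \<notin> slot_below i ` ?S1\<close> by blast
        then show ?thesis using \<open>B \<in> ?F ?S1\<close> by (simp add: slot_fillings_def)
      qed
      moreover have "A w = {#}" using that by (simp add: slot_fillings_def)
      ultimately show ?thesis by (auto simp: join_def Some Cons)
    qed
  qed
  have jdeg: "forest_degree (join (A, B) w) \<le> n" if "A \<in> ?F ?S0" "B \<in> ?F ?S1" for A B w
    using that by (auto simp: join_def slot_fillings_def split: option.splits list.splits)
  have "grafting_sum e n (add_mset t \<rho>) \<mu> = (\<Sum>X\<in>?F ?S0 \<times> ?F ?S1.
      if graft_all (add_mset t \<rho>) (join X) = \<mu> then ?P (slots (add_mset t \<rho>)) (join X) else 0)"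
    unfolding grafting_sum_def
  proof (rule sum.reindex_bij_witness[of _ join split])
    fix A assume A: "A \<in> ?F (slots (add_mset t \<rho>))"
    have sF: "split A \<in> ?F ?S0 \<times> ?F ?S1"
      using A by (auto simp: split_def slot_fillings_def)
    then show "split A \<in> ?F ?S0 \<times> ?F ?S1" .
    have "join (split A) w = A w" for w
    proof -
      consider "w \<in> ?S0" | "w \<in> slot_below i ` ?S1" | "w \<notin> ?S0" "w \<notin> slot_below i ` ?S1" by blast
      then show ?thesis
      proof cases
        case 3
        then have "A w = {#}" using A by (simp add: slot_fillings_def S)
        then show ?thesis using 3 sF j2[of w "fst (split A)" "snd (split A)"] by (auto simp: mem_Times_iff)
      qed (auto simp: split_def j0 j1)
    qed
    then show js: "join (split A) = A" by blast
    show "(if graft_all (add_mset t \<rho>) (join (split A)) = \<mu> then ?P (slots (add_mset t \<rho>)) (join (split A)) else 0) =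
        (if graft_all (add_mset t \<rho>) A = \<mu> then ?P (slots (add_mset t \<rho>)) A else 0)" by (simp only: js)
  next
    fix X assume "X \<in> ?F ?S0 \<times> ?F ?S1"
    then obtain A B where X: "X = (A, B)" and A: "A \<in> ?F ?S0" and B: "B \<in> ?F ?S1" by auto
    show "join X \<in> ?F (slots (add_mset t \<rho>))"
      using j2[OF _ _ A B] jdeg[OF A B] unfolding X S slot_fillings_def by blast
    show "split (join X) = X"
      using A B by (auto simp: X split_def j0 j1 slot_fillings_def fun_eq_iff)
  qed
  also have "\<dots> = (\<Sum>A\<in>?F ?S0. \<Sum>B\<in>?F ?S1.
      if graft_all (add_mset t \<rho>) (join (A, B)) = \<mu> then ?P (slots (add_mset t \<rho>)) (join (A, B)) else 0)"
    unfolding sum.cartesian_product by (rule sum.cong) auto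
  also have "\<dots> = (\<Sum>A\<in>?F ?S0. \<Sum>B\<in>?F ?S1. \<Sum>u\<in>set_mset \<mu>.
      (if root u = root t then if graft_all (children t) B = children u then ?P ?S1 B else 0 else 0) *
      (if graft_all \<rho> A = \<mu> - {#u#} then ?P ?S0 A else 0))"
  proof (intro sum.cong refl)
    fix A B assume A: "A \<in> ?F ?S0" and B: "B \<in> ?F ?S1"
    let ?u = "Node (root t) (graft_all (children t) B)"
    have "graft_all \<rho> (join (A, B)) = graft_all \<rho> A"
      "graft_all (children t) (join (A, B) \<circ> slot_below i) = graft_all (children t) B"
      by (rule graft_all_cong; simp add: j0 j1)+
    then have g: "graft_all (add_mset t \<rho>) (join (A, B)) = add_mset ?u (graft_all \<rho> A)"
      by (simp add: graft_all_add_mset i_def[symmetric])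
    have p: "?P (slots (add_mset t \<rho>)) (join (A, B)) = ?P ?S1 B * ?P ?S0 A"
      by (simp add: S prod.union_disjoint disj prod.reindex[OF inj_on_slot_below] i_def[symmetric] j0 j1)
    have "(\<Sum>u\<in>set_mset \<mu>.
        (if root u = root t then if graft_all (children t) B = children u then ?P ?S1 B else 0 else 0) *
        (if graft_all \<rho> A = \<mu> - {#u#} then ?P ?S0 A else 0)) =
      (\<Sum>u\<in>set_mset \<mu>. if u = ?u then (if graft_all \<rho> A = \<mu> - {#?u#} then ?P ?S1 B * ?P ?S0 A else 0) else 0)"
    proof (rule sum.cong[OF refl])
      fix u show "(if root u = root t then if graft_all (children t) B = children u then ?P ?S1 B else 0 else 0) *
        (if graft_all \<rho> A = \<mu> - {#u#} then ?P ?S0 A else 0) =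
        (if u = ?u then (if graft_all \<rho> A = \<mu> - {#?u#} then ?P ?S1 B * ?P ?S0 A else 0) else 0)"
        by (cases u) auto
    qed
    also have "\<dots> = (if add_mset ?u (graft_all \<rho> A) = \<mu> then ?P ?S1 B * ?P ?S0 A else 0)"
      by (auto dest: multi_member_split)
    finally show "(if graft_all (add_mset t \<rho>) (join (A, B)) = \<mu> then ?P (slots (add_mset t \<rho>)) (join (A, B)) else 0) =
      (\<Sum>u\<in>set_mset \<mu>.
      (if root u = root t then if graft_all (children t) B = children u then ?P ?S1 B else 0 else 0) *
      (if graft_all \<rho> A = \<mu> - {#u#} then ?P ?S0 A else 0))"
      by (simp add: g p)
  qed
  also have "\<dots> = (\<Sum>u\<in>set_mset \<mu>. \<Sum>A\<in>?F ?S0. \<Sum>B\<in>?F ?S1. 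
      (if root u = root t then if graft_all (children t) B = children u then ?P ?S1 B else 0 else 0) *
      (if graft_all \<rho> A = \<mu> - {#u#} then ?P ?S0 A else 0))"
    by (subst sum.swap[of _ _ "?F ?S1"], subst sum.swap[of _ _ "?F ?S0"]) (rule refl)
  also have "\<dots> = (\<Sum>u\<in>set_mset \<mu>.
    (if root u = root t then grafting_sum e n (children t) (children u) else 0) * grafting_sum e n \<rho> (\<mu> - {#u#}))"
  proof (rule sum.cong[OF refl])
    fix u
    show "(\<Sum>A\<in>?F ?S0. \<Sum>B\<in>?F ?S1. 
      (if root u = root t then if graft_all (children t) B = children u then ?P ?S1 B else 0 else 0) *
      (if graft_all \<rho> A = \<mu> - {#u#} then ?P ?S0 A else 0)) =
      (if root u = root t then grafting_sum e n (children t) (children u) else 0) * grafting_sum e n \<rho> (\<mu> - {#u#})"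
      unfolding grafting_sum_def sum_distrib_right[symmetric] sum_distrib_left[symmetric] by simp
  qed
  finally show ?thesis .
qed

section \<open>Duality of the two Hopf algebras\<close>

text \<open>
  The coefficient of \<open>\<rho>\<close> in \<open>(a \<otimes> id) \<Delta> \<mu>\<close>.
\<close>

definition dual_coeff :: "('l forest \<Rightarrow> real) \<Rightarrow> 'l forest \<Rightarrow> 'l forest \<Rightarrow> real" where
  "dual_coeff a \<rho> \<mu> = coproduct_sum (\<lambda>x y. if y = \<rho> then a x else 0) \<mu>"

text \<open>
  The coefficient of \<open>t\<close> in the part of \<open>(a \<otimes> id) \<Delta> u\<close> in which the root of \<open>u\<close> has not been cut off.
\<close>

definition dual_coeff_tree :: "('l forest \<Rightarrow> real) \<Rightarrow> 'l ltree \<Rightarrow> 'l ltree \<Rightarrow> real" where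
  "dual_coeff_tree a t u = (if root u = root t then dual_coeff a (children t) (children u) else 0)"

lemma dual_coeff_empty: "character a \<Longrightarrow> dual_coeff a \<rho> {#} = (if \<rho> = {#} then 1 else 0)"
  by (auto simp: dual_coeff_def character_empty)

lemma dual_coeff_empty_left: "dual_coeff a {#} \<mu> = a \<mu>"
  unfolding dual_coeff_def by (subst coproduct_sum_left) auto

text \<open>
  Either \<open>u\<close> is cut off as a whole, or its root survives as the root of some tree \<open>t\<close> of \<open>\<rho>\<close>.
\<close>

lemma dual_coeff_add_mset:
  assumes a: "character a"
  shows "dual_coeff a \<rho> (add_mset u \<mu>) = a {#u#} * dual_coeff a \<rho> \<mu> +
    (\<Sum>t\<in>set_mset \<rho>. dual_coeff_tree a t u * dual_coeff a (\<rho> - {#t#}) \<mu>)"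
proof -
  obtain r \<pi> where u: "u = Node r \<pi>" by (cases u)
  have "coproduct_sum (\<lambda>x y. if y = \<rho> then a (add_mset u x) else 0) \<mu> =
      coproduct_sum (\<lambda>x y. a {#u#} * (if y = \<rho> then a x else 0)) \<mu>"
  proof (rule coproduct_sum_cong)
    fix x y show "(if y = \<rho> then a (add_mset u x) else 0) = a {#u#} * (if y = \<rho> then a x else 0)"
      using character_add_mset[OF a, of u x] by simp
  qed
  then have 1: "coproduct_sum (\<lambda>x y. if y = \<rho> then a (add_mset u x) else 0) \<mu> = a {#u#} * dual_coeff a \<rho> \<mu>"
    by (simp only: coproduct_sum_scale dual_coeff_def)
  have *: "(if add_mset (Node r y) y' = \<rho> then a (x + x') else 0) =
      (\<Sum>t\<in>set_mset \<rho>. (if Node r y = t then a x else 0) * (if y' = \<rho> - {#t#} then a x' else 0))" for x y x' y'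
  proof -
    have "(\<Sum>t\<in>set_mset \<rho>. (if Node r y = t then a x else 0) * (if y' = \<rho> - {#t#} then a x' else 0)) =
        (\<Sum>t\<in>set_mset \<rho>. if Node r y = t then (if y' = \<rho> - {#Node r y#} then a x * a x' else 0) else 0)"
      by (rule sum.cong) auto
    also have "\<dots> = (if add_mset (Node r y) y' = \<rho> then a (x + x') else 0)"
      by (auto simp: character_plus[OF a] dest: multi_member_split)
    finally show ?thesis by simp
  qed
  have "coproduct_sum (\<lambda>x y. coproduct_sum (\<lambda>x' y'. if add_mset (Node r y) y' = \<rho> then a (x + x') else 0) \<mu>) \<pi> =
      (\<Sum>t\<in>set_mset \<rho>. coproduct_sum (\<lambda>x y. if Node r y = t then a x else 0) \<pi> * dual_coeff a (\<rho> - {#t#}) \<mu>)"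
    unfolding * coproduct_sum_sum coproduct_sum_scale dual_coeff_def[symmetric] coproduct_sum_scale_right ..
  moreover have "coproduct_sum (\<lambda>x y. if Node r y = t then a x else 0) \<pi> = dual_coeff_tree a t u" for t
  proof (cases t)
    case (Node r' \<pi>')
    show ?thesis
      by (cases "r = r'") (simp_all add: Node u dual_coeff_tree_def dual_coeff_def)
  qed
  ultimately have 2: "coproduct_sum (\<lambda>x y. coproduct_sum (\<lambda>x' y'. if add_mset (Node r y) y' = \<rho> then a (x + x') else 0) \<mu>) \<pi> =
      (\<Sum>t\<in>set_mset \<rho>. dual_coeff_tree a t u * dual_coeff a (\<rho> - {#t#}) \<mu>)"
    by simp
  have "dual_coeff a \<rho> (add_mset u \<mu>) = coproduct_sum (\<lambda>x y. if y = \<rho> then a (add_mset u x) else 0) \<mu> +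
      coproduct_sum (\<lambda>x y. coproduct_sum (\<lambda>x' y'. if add_mset (Node r y) y' = \<rho> then a (x + x') else 0) \<mu>) \<pi>"
    unfolding dual_coeff_def u by (rule coproduct_sum_add_mset)
  then show ?thesis unfolding 1 2 .
qed

lemma sum_mset_eq_sum: "(\<Sum>u\<in>#\<mu>. f u) = (\<Sum>u\<in>set_mset \<mu>. real (count \<mu> u) * f u)"
proof (induction \<mu>)
  case (add v \<mu>)
  have "(\<Sum>u\<in>set_mset (add_mset v \<mu>). real (count (add_mset v \<mu>) u) * f u) =
      (\<Sum>u\<in>insert v (set_mset \<mu>). real (count \<mu> u) * f u + (if u = v then f v else 0))"
    by (rule sum.cong) (auto simp: algebra_simps)
  also have "\<dots> = (\<Sum>u\<in>insert v (set_mset \<mu>). real (count \<mu> u) * f u) + f v"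
    by (simp add: sum.distrib)
  also have "(\<Sum>u\<in>insert v (set_mset \<mu>). real (count \<mu> u) * f u) = (\<Sum>u\<in>set_mset \<mu>. real (count \<mu> u) * f u)"
    by (rule sum.mono_neutral_right) (auto simp: not_in_iff)
  finally show ?case using add by simp
qed simp

lemma sum_mset_sum_swap: "(\<Sum>u\<in>#\<mu>. \<Sum>s\<in>S. f u s) = (\<Sum>s\<in>S. \<Sum>u\<in>#\<mu>. (f u s :: real))"
  by (induction \<mu>) (simp_all add: sum.distrib)

lemma add_mset_remove_swap: "u \<in># \<mu> \<Longrightarrow> add_mset v \<mu> - {#u#} = add_mset v (\<mu> - {#u#})"
  by (cases "u = v") (auto dest: multi_member_split)

text \<open>
  The map \<open>\<mu> \<mapsto> (a \<otimes> id) \<Delta> \<mu>\<close> is a homomorphism of polynomial algebras in the trees as variables. The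
  identity is the chain rule for the partial derivative with respect to the variable \<open>t\<close> of its values.
\<close>

lemma dual_coeff_derivative:
  assumes a: "character a"
  shows "real (Suc (count \<rho> t)) * dual_coeff a (add_mset t \<rho>) \<mu> =
    (\<Sum>u\<in>#\<mu>. dual_coeff_tree a t u * dual_coeff a \<rho> (\<mu> - {#u#}))"
proof (induction \<mu> arbitrary: \<rho>)
  case empty
  then show ?case by (simp add: dual_coeff_empty[OF a])
next
  case (add v \<mu>)
  let ?h = "dual_coeff a" and ?k = "dual_coeff_tree a"
  let ?S = "set_mset \<rho> - {t}"
  have "(\<Sum>u\<in>#add_mset v \<mu>. ?k t u * ?h \<rho> (add_mset v \<mu> - {#u#})) =
      ?k t v * ?h \<rho> \<mu> + (\<Sum>u\<in>#\<mu>. ?k t u * ?h \<rho> (add_mset v (\<mu> - {#u#})))"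
    by (auto intro!: arg_cong[of _ _ sum_mset] image_mset_cong simp: add_mset_remove_swap)
  also have "(\<Sum>u\<in>#\<mu>. ?k t u * ?h \<rho> (add_mset v (\<mu> - {#u#}))) =
      a {#v#} * (\<Sum>u\<in>#\<mu>. ?k t u * ?h \<rho> (\<mu> - {#u#})) +
      (\<Sum>s\<in>set_mset \<rho>. ?k s v * (\<Sum>u\<in>#\<mu>. ?k t u * ?h (\<rho> - {#s#}) (\<mu> - {#u#})))"
  proof -
    have "?k t u * ?h \<rho> (add_mset v (\<mu> - {#u#})) = a {#v#} * (?k t u * ?h \<rho> (\<mu> - {#u#})) +
        (\<Sum>s\<in>set_mset \<rho>. ?k s v * (?k t u * ?h (\<rho> - {#s#}) (\<mu> - {#u#})))" for u
      unfolding dual_coeff_add_mset[OF a] by (simp add: distrib_left sum_distrib_left mult_ac)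
    then show ?thesis
      by (simp only: sum_mset.distrib sum_mset_distrib_left[symmetric] sum_mset_sum_swap)
  qed
  also have "\<dots> = a {#v#} * (real (Suc (count \<rho> t)) * ?h (add_mset t \<rho>) \<mu>) +
      (\<Sum>s\<in>set_mset \<rho>. ?k s v * (real (Suc (count (\<rho> - {#s#}) t)) * ?h (add_mset t (\<rho> - {#s#})) \<mu>))"
    unfolding add.IH ..
  also have "(\<Sum>s\<in>set_mset \<rho>. ?k s v * (real (Suc (count (\<rho> - {#s#}) t)) * ?h (add_mset t (\<rho> - {#s#})) \<mu>)) =
      ?k t v * (real (count \<rho> t) * ?h \<rho> \<mu>) +
      (\<Sum>s\<in>?S. ?k s v * (real (Suc (count \<rho> t)) * ?h (add_mset t (\<rho> - {#s#})) \<mu>))"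
  proof (cases "t \<in># \<rho>")
    case True
    then have "add_mset t (\<rho> - {#t#}) = \<rho>" "Suc (count (\<rho> - {#t#}) t) = count \<rho> t"
      by (auto dest: multi_member_split)
    then show ?thesis
      using True by (subst sum.remove[of _ t]) (auto intro!: sum.cong simp del: of_nat_Suc)
  next
    case False
    then have "?S = set_mset \<rho>" by auto
    then show ?thesis using False by (auto simp: not_in_iff intro!: sum.cong)
  qed
  also have "?k t v * ?h \<rho> \<mu> + (a {#v#} * (real (Suc (count \<rho> t)) * ?h (add_mset t \<rho>) \<mu>) +
      (?k t v * (real (count \<rho> t) * ?h \<rho> \<mu>) +
      (\<Sum>s\<in>?S. ?k s v * (real (Suc (count \<rho> t)) * ?h (add_mset t (\<rho> - {#s#})) \<mu>)))) =
      real (Suc (count \<rho> t)) * (a {#v#} * ?h (add_mset t \<rho>) \<mu> +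
        (?k t v * ?h \<rho> \<mu> + (\<Sum>s\<in>?S. ?k s v * ?h (add_mset t (\<rho> - {#s#})) \<mu>)))"
    by (simp add: algebra_simps sum_distrib_left)
  also have "?k t v * ?h \<rho> \<mu> + (\<Sum>s\<in>?S. ?k s v * ?h (add_mset t (\<rho> - {#s#})) \<mu>) =
      (\<Sum>s\<in>set_mset (add_mset t \<rho>). ?k s v * ?h (add_mset t \<rho> - {#s#}) \<mu>)"
    by (subst sum.remove[of "set_mset (add_mset t \<rho>)" t])
      (auto intro!: sum.cong arg_cong[of _ _ "\<lambda>x. ?h x \<mu>"] simp: add_mset_remove_swap)
  also have "a {#v#} * ?h (add_mset t \<rho>) \<mu> + \<dots> = ?h (add_mset t \<rho>) (add_mset v \<mu>)"
    by (rule dual_coeff_add_mset[OF a, symmetric])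
  finally show ?case by simp
qed

text \<open>
  The isomorphism between the two groups.
\<close>

definition by_symmetry :: "('l forest \<Rightarrow> real) \<Rightarrow> 'l forest \<Rightarrow> real" where
  "by_symmetry a = (\<lambda>\<rho>. a \<rho> / real (forest_symmetry \<rho>))"

lemma by_symmetry_divided_powers:
  assumes "character a"
  shows "real (Suc (count \<pi> x)) * by_symmetry a (add_mset x \<pi>) =
    a {#x#} / real (tree_symmetry x) * by_symmetry a \<pi>"
proof -
  have "real (Suc (count \<pi> x)) \<noteq> 0" by (simp del: of_nat_Suc)
  then show ?thesis
    by (simp add: by_symmetry_def forest_symmetry_add_mset character_add_mset[OF assms, of x \<pi>] del: of_nat_Suc mult_Suc)
qed

text \<open>
  The duality between product and coproduct. Both sides satisfy the same recursion in \<open>\<rho>\<close>: with respect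
  to the pairing in which forests are orthogonal with square norms \<open>\<sigma>\<close>, the adjoint of multiplication
  by \<open>t\<close> is \<open>\<sigma>(t)\<close> times the derivative with respect to \<open>t\<close>. Factors of \<open>\<rho>\<close> are thus taken off by
  \<open>grafting_sum_add_mset\<close> on one side and by \<open>dual_coeff_derivative\<close> on the other.
\<close>

lemma grafting_sum_dual:
  fixes a :: "'l::finite forest \<Rightarrow> real"
  assumes a: "character a" and "forest_degree \<mu> \<le> n"
  shows "grafting_sum (by_symmetry a) n \<rho> \<mu> * real (forest_symmetry \<mu>) =
    real (forest_symmetry \<rho>) * dual_coeff a \<rho> \<mu>"
  using assms(2)
proof (induction \<rho> arbitrary: \<mu> rule: forest_induct)
  case empty
  then show ?case by (simp add: grafting_sum_empty dual_coeff_empty_left by_symmetry_def)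
next
  case (add r \<pi> \<rho>)
  let ?t = "Node r \<pi>" and ?G = "grafting_sum (by_symmetry a) n"
  let ?\<sigma> = "\<lambda>\<rho>. real (forest_symmetry \<rho>)"
  have "?G (add_mset ?t \<rho>) \<mu> * ?\<sigma> \<mu> =
      (\<Sum>u\<in>set_mset \<mu>. (if root u = r then ?G \<pi> (children u) else 0) * ?G \<rho> (\<mu> - {#u#}) * ?\<sigma> \<mu>)"
    unfolding grafting_sum_add_mset sum_distrib_right ltree.sel ..
  also have "\<dots> = (\<Sum>u\<in>set_mset \<mu>. ?\<sigma> \<pi> * ?\<sigma> \<rho> * (real (count \<mu> u) * (dual_coeff_tree a ?t u * dual_coeff a \<rho> (\<mu> - {#u#}))))"
  proof (rule sum.cong[OF HOL.refl])
    fix u assume "u \<in> set_mset \<mu>"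
    then obtain \<mu>' where \<mu>': "\<mu> = add_mset u \<mu>'" by (blast dest: multi_member_split)
    obtain s \<eta> where u: "u = Node s \<eta>" by (cases u)
    have IH: "?G \<pi> \<eta> * ?\<sigma> \<eta> = ?\<sigma> \<pi> * dual_coeff a \<pi> \<eta>"
      "?G \<rho> \<mu>' * ?\<sigma> \<mu>' = ?\<sigma> \<rho> * dual_coeff a \<rho> \<mu>'"
      by (rule add.IH; use add.prems in \<open>simp add: \<mu>' u\<close>)+
    have "?\<sigma> \<mu> = real (count \<mu> u) * ?\<sigma> \<eta> * ?\<sigma> \<mu>'"
      by (simp add: \<mu>' forest_symmetry_add_mset u algebra_simps)
    then have "?G \<pi> \<eta> * ?G \<rho> \<mu>' * ?\<sigma> \<mu> = real (count \<mu> u) * ((?G \<pi> \<eta> * ?\<sigma> \<eta>) * (?G \<rho> \<mu>' * ?\<sigma> \<mu>'))"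
      by (simp only: mult_ac)
    also have "\<dots> = ?\<sigma> \<pi> * ?\<sigma> \<rho> * (real (count \<mu> u) * (dual_coeff a \<pi> \<eta> * dual_coeff a \<rho> \<mu>'))"
      unfolding IH by (simp only: mult_ac)
    finally have "?G \<pi> \<eta> * ?G \<rho> \<mu>' * ?\<sigma> \<mu> =
       ?\<sigma> \<pi> * ?\<sigma> \<rho> * (real (count \<mu> u) * (dual_coeff a \<pi> \<eta> * dual_coeff a \<rho> \<mu>'))" .
    moreover have "\<mu> - {#u#} = \<mu>'" by (simp add: \<mu>')
    ultimately show "(if root u = r then ?G \<pi> (children u) else 0) * ?G \<rho> (\<mu> - {#u#}) * ?\<sigma> \<mu> =
       ?\<sigma> \<pi> * ?\<sigma> \<rho> * (real (count \<mu> u) * (dual_coeff_tree a ?t u * dual_coeff a \<rho> (\<mu> - {#u#})))"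
      by (auto simp: u dual_coeff_tree_def)
  qed
  also have "\<dots> = ?\<sigma> \<pi> * ?\<sigma> \<rho> * (\<Sum>u\<in>#\<mu>. dual_coeff_tree a ?t u * dual_coeff a \<rho> (\<mu> - {#u#}))"
    by (simp add: sum_mset_eq_sum sum_distrib_left)
  also have "\<dots> = ?\<sigma> (add_mset ?t \<rho>) * dual_coeff a (add_mset ?t \<rho>) \<mu>"
    unfolding dual_coeff_derivative[OF a, symmetric] by (simp add: forest_symmetry_add_mset algebra_simps)
  finally show ?case .
qed

lemma GL_product_sum:
  fixes a b :: "'l::finite forest \<Rightarrow> real"
  shows "GL_product a b \<mu> = (\<Sum>\<rho> | forest_degree \<rho> \<le> forest_degree \<mu>. b \<rho> *
    (\<Sum>\<pi> | forest_degree \<pi> \<le> forest_degree \<mu>. a \<pi> * Poly_Mapping.lookup (GL_product_forest \<pi> \<rho>) \<mu>))"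
proof -
  let ?F = "{\<rho> :: 'l forest. forest_degree \<rho> \<le> forest_degree \<mu>}"
  have F: "finite ?F" by (rule finite_forest_degree_le)
  have "{(\<pi>, \<rho>). \<mu> \<in> Poly_Mapping.keys (GL_product_forest \<pi> \<rho>)} \<subseteq> ?F \<times> ?F"
    by (auto dest: degree_GL_product_forest)
  then have "GL_product a b \<mu> = (\<Sum>(\<pi>, \<rho>)\<in>?F \<times> ?F. a \<pi> * b \<rho> * Poly_Mapping.lookup (GL_product_forest \<pi> \<rho>) \<mu>)"
    unfolding GL_product_def using F by (intro sum.mono_neutral_left) (auto simp: in_keys_iff)
  also have "\<dots> = (\<Sum>\<pi>\<in>?F. \<Sum>\<rho>\<in>?F. a \<pi> * b \<rho> * Poly_Mapping.lookup (GL_product_forest \<pi> \<rho>) \<mu>)"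
    by (rule sum.cartesian_product[symmetric])
  also have "\<dots> = (\<Sum>\<rho>\<in>?F. \<Sum>\<pi>\<in>?F. a \<pi> * b \<rho> * Poly_Mapping.lookup (GL_product_forest \<pi> \<rho>) \<mu>)"
    by (rule sum.swap)
  finally show ?thesis by (simp add: sum_distrib_left mult_ac)
qed

text \<open>
  The duality, summed over the right factor of the product.
\<close>

lemma GL_product_by_symmetry:
  fixes a b :: "'l::finite forest \<Rightarrow> real"
  assumes a: "character a"
  shows "GL_product (by_symmetry a) (by_symmetry b) = by_symmetry (CK_product a b)"
proof
  fix \<mu> :: "'l forest"
  let ?n = "forest_degree \<mu>" and ?\<sigma> = "\<lambda>\<rho>. real (forest_symmetry \<rho>)"
  let ?F = "{\<rho> :: 'l forest. forest_degree \<rho> \<le> ?n}"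
  have "GL_product (by_symmetry a) (by_symmetry b) \<mu> =
      (\<Sum>\<rho>\<in>?F. by_symmetry b \<rho> * grafting_sum (by_symmetry a) ?n \<rho> \<mu>)"
    unfolding GL_product_sum
    by (subst sum_GL_product_forest[OF _ by_symmetry_divided_powers[OF a]])
      (simp_all add: by_symmetry_def character_empty[OF a])
  also have "\<dots> = (\<Sum>\<rho>\<in>?F. b \<rho> * dual_coeff a \<rho> \<mu> / ?\<sigma> \<mu>)"
  proof (rule sum.cong[OF HOL.refl])
    fix \<rho> :: "'l forest"
    have "grafting_sum (by_symmetry a) ?n \<rho> \<mu> = ?\<sigma> \<rho> * dual_coeff a \<rho> \<mu> / ?\<sigma> \<mu>"
      using grafting_sum_dual[OF a order_refl, of \<mu> \<rho>] by (simp add: eq_divide_eq)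
    then show "by_symmetry b \<rho> * grafting_sum (by_symmetry a) ?n \<rho> \<mu> = b \<rho> * dual_coeff a \<rho> \<mu> / ?\<sigma> \<mu>"
      by (simp add: by_symmetry_def)
  qed
  also have "\<dots> = (\<Sum>\<rho>\<in>?F. b \<rho> * dual_coeff a \<rho> \<mu>) / ?\<sigma> \<mu>"
    by (rule sum_divide_distrib[symmetric])
  also have "(\<Sum>\<rho>\<in>?F. b \<rho> * dual_coeff a \<rho> \<mu>) =
      coproduct_sum (\<lambda>x y. \<Sum>\<rho>\<in>?F. b \<rho> * (if y = \<rho> then a x else 0)) \<mu>"
    by (simp only: coproduct_sum_sum coproduct_sum_scale dual_coeff_def)
  also have "\<dots> = CK_product a b \<mu>"
    unfolding CK_product_eq
  proof (rule coproduct_sum_cong)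
    fix x y :: "'l forest" assume "forest_degree x + forest_degree y = ?n"
    then have y: "y \<in> ?F" by simp
    have "(\<Sum>\<rho>\<in>?F. b \<rho> * (if y = \<rho> then a x else 0)) = (\<Sum>\<rho>\<in>?F. if y = \<rho> then a x * b y else 0)"
      by (rule sum.cong) auto
    then show "(\<Sum>\<rho>\<in>?F. b \<rho> * (if y = \<rho> then a x else 0)) = a x * b y"
      using y by (simp add: finite_forest_degree_le)
  qed
  finally show "GL_product (by_symmetry a) (by_symmetry b) \<mu> = by_symmetry (CK_product a b) \<mu>"
    by (simp add: by_symmetry_def)
qed

text \<open>
  A subset of the factors is a distribution of the factors over two slots.
\<close>

lemma lookup_GL_coproduct_forest:
  "Poly_Mapping.lookup (GL_coproduct_forest \<rho>) (x, y) = (if x + y = \<rho> then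
     real (forest_symmetry \<rho>) / (real (forest_symmetry x) * real (forest_symmetry y)) else 0)"
proof -
  let ?A = "\<lambda>b. if b then x else y"
  have "character (\<lambda>_ :: 'a forest. 1)" by (simp add: character_def)
  note e = by_symmetry_divided_powers[OF this]
  have "Poly_Mapping.lookup (GL_coproduct_forest \<rho>) (x, y) =
      (\<Sum>I\<in>Pow (occs \<rho>). if subforest I = x \<and> subforest (occs \<rho> - I) = y then 1 else 0)"
    by (simp add: GL_coproduct_forest_def tensor_def lookup_sum lookup_single when_def)
  also have "\<dots> = real (card {I \<in> Pow (occs \<rho>). subforest I = x \<and> subforest (occs \<rho> - I) = y})"
    by (simp add: sum.If_cases Int_def)
  also have "card {I \<in> Pow (occs \<rho>). subforest I = x \<and> subforest (occs \<rho> - I) = y} =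
      card {\<phi> \<in> occs \<rho> \<rightarrow>\<^sub>E UNIV. fibres \<rho> \<phi> = ?A}"
  proof (rule bij_betw_same_card)
    have "{i \<in> occs \<rho>. i \<in> I} = I" "{i \<in> occs \<rho>. i \<notin> I} = occs \<rho> - I" if "I \<subseteq> occs \<rho>" for I
      using that by auto
    then have fib: "fibres \<rho> (restrict (\<lambda>i. i \<in> I) (occs \<rho>)) = ?A \<longleftrightarrow> subforest I = x \<and> subforest (occs \<rho> - I) = y"
      if "I \<subseteq> occs \<rho>" for I
      using that fibres_cong[of \<rho> "restrict (\<lambda>i. i \<in> I) (occs \<rho>)" "\<lambda>i. i \<in> I"]
      by (simp add: fibres_def fun_eq_iff all_bool_eq conj_commute)
    have res: "restrict (\<lambda>i. i \<in> {i \<in> occs \<rho>. \<phi> i}) (occs \<rho>) = \<phi>" if "\<phi> \<in> occs \<rho> \<rightarrow>\<^sub>E UNIV" for \<phi>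
      using that by (auto simp: fun_eq_iff PiE_def extensional_def restrict_def)
    let ?R = "\<lambda>I. restrict (\<lambda>i. i \<in> I) (occs \<rho>)" and ?S = "\<lambda>\<phi>. {i \<in> occs \<rho>. \<phi> i}"
    let ?I = "{I \<in> Pow (occs \<rho>). subforest I = x \<and> subforest (occs \<rho> - I) = y}"
    let ?\<Phi> = "{\<phi> \<in> occs \<rho> \<rightarrow>\<^sub>E UNIV. fibres \<rho> \<phi> = ?A}"
    show "bij_betw ?R ?I ?\<Phi>"
    proof (rule bij_betw_byWitness[where f' = ?S])
      show "\<forall>I\<in>?I. ?S (?R I) = I" by auto
      show "\<forall>\<phi>\<in>?\<Phi>. ?R (?S \<phi>) = \<phi>" using res by blast
      show "?R ` ?I \<subseteq> ?\<Phi>" using fib by auto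
      show "?S ` ?\<Phi> \<subseteq> ?I"
      proof
        fix I assume "I \<in> ?S ` ?\<Phi>"
        then obtain \<phi> where \<phi>: "\<phi> \<in> ?\<Phi>" "I = ?S \<phi>" by blast
        then have "?R I = \<phi>" using res by blast
        then show "I \<in> ?I" using \<phi> fib[of I] by auto
      qed
    qed
  qed
  finally have l: "Poly_Mapping.lookup (GL_coproduct_forest \<rho>) (x, y) = real (card {\<phi> \<in> occs \<rho> \<rightarrow>\<^sub>E UNIV. fibres \<rho> \<phi> = ?A})" .
  have "by_symmetry (\<lambda>_. 1) \<rho> * real (card {\<phi> \<in> occs \<rho> \<rightarrow>\<^sub>E UNIV. fibres \<rho> \<phi> = ?A}) =
      (if x + y = \<rho> then by_symmetry (\<lambda>_. 1) x * by_symmetry (\<lambda>_. 1) y else 0)"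
    using card_fibres[OF _ _ e, of "UNIV :: bool set" \<rho> ?A]
    by (simp add: by_symmetry_def UNIV_bool add.commute)
  then show ?thesis unfolding l by (simp add: by_symmetry_def field_simps split: if_splits)
qed

text \<open>
  The multiplicities in the coproduct are exactly the quotients of symmetry factors by which
  \<open>by_symmetry a\<close> fails to be multiplicative.
\<close>

lemma grouplike_by_symmetry: "grouplike (by_symmetry a) \<longleftrightarrow> character a"
proof -
  let ?\<sigma> = "\<lambda>\<rho>. real (forest_symmetry \<rho>)"
  have "GL_coproduct (by_symmetry a) (x, y) = a (x + y) / (?\<sigma> x * ?\<sigma> y)" for x y
  proof -
    have "{\<rho>. (x, y) \<in> Poly_Mapping.keys (GL_coproduct_forest \<rho>)} = {x + y}"
      by (auto simp: in_keys_iff lookup_GL_coproduct_forest)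
    then show ?thesis
      unfolding GL_coproduct_def by (simp add: lookup_GL_coproduct_forest by_symmetry_def)
  qed
  then have "grouplike (by_symmetry a) \<longleftrightarrow> a {#} = 1 \<and>
      (\<forall>x y. a (x + y) / (?\<sigma> x * ?\<sigma> y) = a x / ?\<sigma> x * (a y / ?\<sigma> y))"
    unfolding grouplike_def fun_eq_iff by (simp add: by_symmetry_def)
  also have "\<dots> \<longleftrightarrow> character a"
    unfolding character_def by (simp add: divide_eq_eq)
  finally show ?thesis .
qed

section \<open>The truncated groups and their isomorphism\<close>

lemma truncate_simp [simp]: "forest_degree \<rho> \<le> N \<Longrightarrow> truncate N a \<rho> = a \<rho>"
  by (simp add: truncate_def)

lemma truncate_truncate: "m \<le> n \<Longrightarrow> truncate m (truncate n a) = truncate m a"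
  by (auto simp: truncate_def)

lemma truncate_eq_iff: "truncate N a = truncate N b \<longleftrightarrow> (\<forall>\<rho>. forest_degree \<rho> \<le> N \<longrightarrow> a \<rho> = b \<rho>)"
  by (auto simp: truncate_def fun_eq_iff)

text \<open>
  A truncated character is the truncation of the character with the same values on trees. This reduces
  the algebra of the truncated groups to that of characters, whose product is defined without truncation.
\<close>

definition character_of :: "('l forest \<Rightarrow> real) \<Rightarrow> 'l forest \<Rightarrow> real" where
  "character_of a \<rho> = (\<Prod>t\<in>#\<rho>. a {#t#})"

lemma character_character_of: "character (character_of a)"
  by (simp add: character_def character_of_def)

lemma character_of_single [simp]: "character_of a {#t#} = a {#t#}"
  by (simp add: character_of_def)

lemma CK_carrierD:
  assumes "a \<in> carrier (CK_group N)"
  shows "a {#} = 1" "\<And>\<rho>. N < forest_degree \<rho> \<Longrightarrow> a \<rho> = 0"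
    "\<And>x y. forest_degree x + forest_degree y \<le> N \<Longrightarrow> a (x + y) = a x * a y"
  using assms by (auto simp: CK_group_def)

lemma truncate_character_of:
  assumes "a \<in> carrier (CK_group N)"
  shows "truncate N (character_of a) = a"
proof
  fix \<rho>
  have "forest_degree \<rho> \<le> N \<Longrightarrow> character_of a \<rho> = a \<rho>"
  proof (induction \<rho>)
    case empty
    then show ?case using CK_carrierD(1)[OF assms] by (simp add: character_of_def)
  next
    case (add t \<rho>)
    then have "a ({#t#} + \<rho>) = a {#t#} * a \<rho>" by (intro CK_carrierD(3)[OF assms]) simp
    then show ?case using add by (simp add: character_of_def)
  qed
  then show "truncate N (character_of a) \<rho> = a \<rho>"
    using CK_carrierD(2)[OF assms, of \<rho>] by (auto simp: truncate_def)
qed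

lemma truncate_in_CK_carrier: "character a \<Longrightarrow> truncate N a \<in> carrier (CK_group N)"
  by (auto simp: CK_group_def truncate_def character_def)

lemma CK_carrier_eq: "carrier (CK_group N) = truncate N ` {a. character a}"
proof (intro equalityI subsetI)
  fix a assume "a \<in> carrier (CK_group N :: ('a forest \<Rightarrow> real) monoid)"
  then show "a \<in> truncate N ` {a. character a}"
    using truncate_character_of character_character_of by (metis image_eqI mem_Collect_eq)
qed (auto intro: truncate_in_CK_carrier)

lemma truncate_CK_product: "truncate N (CK_product (truncate N a) (truncate N b)) = truncate N (CK_product a b)"
  unfolding truncate_eq_iff CK_product_eq by (auto intro!: coproduct_sum_cong)

lemma CK_mult: "a \<otimes>\<^bsub>CK_group N\<^esub> b = truncate N (CK_product a b)"
  and CK_one: "\<one>\<^bsub>CK_group N\<^esub> = unit_series"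
  by (simp_all add: CK_group_def)

lemma CK_mult_truncate:
  "truncate N a \<otimes>\<^bsub>CK_group N\<^esub> truncate N b = truncate N (CK_product a b)"
  by (simp add: CK_mult truncate_CK_product)

lemma CK_mult_truncate_lower:
  assumes "m \<le> N"
  shows "truncate m (a \<otimes>\<^bsub>CK_group N\<^esub> b) = truncate m a \<otimes>\<^bsub>CK_group m\<^esub> truncate m b"
  using assms by (simp add: CK_mult truncate_CK_product truncate_truncate)

lemma truncate_carrier:
  "m \<le> N \<Longrightarrow> a \<in> carrier (CK_group N) \<Longrightarrow> truncate m a \<in> carrier (CK_group m)"
  by (auto simp: CK_carrier_eq truncate_truncate)

lemma truncate_unit [simp]: "truncate N unit_series = unit_series"
  by (auto simp: truncate_def unit_series_def)

lemma unit_in_CK_carrier: "unit_series \<in> carrier (CK_group N)"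
proof -
  have "character (unit_series :: 'a forest \<Rightarrow> real)" by (auto simp: character_def unit_series_def)
  then show ?thesis using truncate_in_CK_carrier by fastforce
qed

lemma truncate_carrier_id: "a \<in> carrier (CK_group N) \<Longrightarrow> truncate N a = a"
  by (auto simp: CK_carrier_eq truncate_truncate)

lemma CK_mult_expand:
  assumes "a \<in> carrier (CK_group N)" "b \<in> carrier (CK_group N)" "\<rho> \<noteq> {#}" "forest_degree \<rho> \<le> N"
  shows "(a \<otimes>\<^bsub>CK_group N\<^esub> b) \<rho> = a \<rho> + b \<rho> + reduced_sum (\<lambda>x y. a x * b y) \<rho>"
  using assms by (simp add: CK_mult CK_product_eq coproduct_sum_primitive CK_carrierD(1))

lemma CK_product_unit_left: "CK_product unit_series b = b"
  unfolding CK_product_eq[abs_def] by (rule ext, subst coproduct_sum_right) (auto simp: unit_series_def)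

lemma CK_product_unit_right: "CK_product a unit_series = a"
  unfolding CK_product_eq[abs_def] by (rule ext, subst coproduct_sum_left) (auto simp: unit_series_def)

lemma monoid_CK_group: "monoid (CK_group N)"
proof (rule monoidI)
  fix a b c :: "'a forest \<Rightarrow> real"
  assume "a \<in> carrier (CK_group N)" "b \<in> carrier (CK_group N)" "c \<in> carrier (CK_group N)"
  then obtain a' b' c' where "character a'" "character b'" "character c'"
    "a = truncate N a'" "b = truncate N b'" "c = truncate N c'"
    by (auto simp: CK_carrier_eq)
  then show "a \<otimes>\<^bsub>CK_group N\<^esub> b \<otimes>\<^bsub>CK_group N\<^esub> c = a \<otimes>\<^bsub>CK_group N\<^esub> (b \<otimes>\<^bsub>CK_group N\<^esub> c)"
    by (simp add: CK_mult_truncate CK_product_assoc)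
next
  fix a b :: "'a forest \<Rightarrow> real"
  assume "a \<in> carrier (CK_group N)" "b \<in> carrier (CK_group N)"
  then show "a \<otimes>\<^bsub>CK_group N\<^esub> b \<in> carrier (CK_group N)"
    by (auto simp: CK_carrier_eq CK_mult_truncate intro: character_CK_product)
next
  show "\<one>\<^bsub>CK_group N\<^esub> \<in> carrier (CK_group N)" by (simp add: CK_one unit_in_CK_carrier)
next
  fix a :: "'a forest \<Rightarrow> real" assume a: "a \<in> carrier (CK_group N)"
  show "\<one>\<^bsub>CK_group N\<^esub> \<otimes>\<^bsub>CK_group N\<^esub> a = a" "a \<otimes>\<^bsub>CK_group N\<^esub> \<one>\<^bsub>CK_group N\<^esub> = a"
    using a by (simp_all add: CK_one CK_mult CK_product_unit_left CK_product_unit_right truncate_carrier_id)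
qed

text \<open>
  The kernel of the truncation from degree \<open>N\<close> to degree \<open>N - 1\<close>. Its elements are central, and the group
  product adds their values on trees of degree \<open>N\<close>.
\<close>

definition top_series :: "nat \<Rightarrow> ('l ltree \<Rightarrow> real) \<Rightarrow> 'l forest \<Rightarrow> real" where
  "top_series N f \<rho> = (if \<rho> = {#} then 1 else if \<exists>t. \<rho> = {#t#} \<and> tree_degree t = N then f (THE t. \<rho> = {#t#}) else 0)"

lemma top_series_empty [simp]: "top_series N f {#} = 1"
  by (simp add: top_series_def)

lemma top_series_tree: "top_series N f {#t#} = (if tree_degree t = N then f t else 0)"
  by (simp add: top_series_def)

lemma top_series_eq_0: "\<rho> \<noteq> {#} \<Longrightarrow> forest_degree \<rho> \<noteq> N \<or> size \<rho> \<noteq> 1 \<Longrightarrow> top_series N f \<rho> = 0"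
  by (auto simp: top_series_def)

lemma top_series_carrier: "top_series N f \<in> carrier (CK_group N)"
proof -
  have "top_series N f x * top_series N f y = top_series N f (x + y)"
    if "forest_degree x + forest_degree y \<le> N" for x y
  proof (cases "x = {#} \<or> y = {#}")
    case False
    then have "forest_degree x \<noteq> 0" "forest_degree y \<noteq> 0" by (auto simp only: forest_degree_eq_0)
    then have "forest_degree x \<noteq> N" using that by auto
    moreover have "size x \<noteq> 0" "size y \<noteq> 0" using False by auto
    then have "size (x + y) \<noteq> 1" by (auto simp del: size_eq_0_iff_empty)
    ultimately show ?thesis using False by (simp add: top_series_eq_0)
  qed auto
  moreover have "top_series N f \<rho> = 0" if "N < forest_degree \<rho>" for \<rho>
    using that by (intro top_series_eq_0) auto
  ultimately show ?thesis by (simp add: CK_group_def)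
qed

lemma CK_mult_top_series:
  assumes "a \<in> carrier (CK_group N)" "forest_degree \<rho> \<le> N" "\<rho> \<noteq> {#}"
  shows "(a \<otimes>\<^bsub>CK_group N\<^esub> top_series N f) \<rho> = a \<rho> + top_series N f \<rho>"
    and "(top_series N f \<otimes>\<^bsub>CK_group N\<^esub> a) \<rho> = top_series N f \<rho> + a \<rho>"
proof -
  have z: "top_series N f x = 0" if "x \<noteq> {#}" "y \<noteq> {#}" "forest_degree x + forest_degree y = forest_degree \<rho>" for x y
  proof -
    have "forest_degree y \<noteq> 0" using that by (auto simp only: forest_degree_eq_0)
    then have "forest_degree x < N" using that assms(2) by linarith
    then show ?thesis using that by (intro top_series_eq_0) auto
  qed
  have "reduced_sum (\<lambda>x y. a x * top_series N f y) \<rho> = reduced_sum (\<lambda>x y. 0) \<rho>"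
  proof (rule reduced_sum_cong)
    fix x y :: "'a forest" assume "x \<noteq> {#}" "y \<noteq> {#}" "forest_degree x + forest_degree y = forest_degree \<rho>"
    then show "a x * top_series N f y = 0" using z[of y x] by simp
  qed
  moreover have "reduced_sum (\<lambda>x y. top_series N f x * a y) \<rho> = reduced_sum (\<lambda>x y. 0) \<rho>"
  proof (rule reduced_sum_cong)
    fix x y :: "'a forest" assume "x \<noteq> {#}" "y \<noteq> {#}" "forest_degree x + forest_degree y = forest_degree \<rho>"
    then show "top_series N f x * a y = 0" using z[of x y] by simp
  qed
  ultimately show "(a \<otimes>\<^bsub>CK_group N\<^esub> top_series N f) \<rho> = a \<rho> + top_series N f \<rho>"
    "(top_series N f \<otimes>\<^bsub>CK_group N\<^esub> a) \<rho> = top_series N f \<rho> + a \<rho>"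
    using CK_mult_expand[OF assms(1) top_series_carrier assms(3,2)]
      CK_mult_expand[OF top_series_carrier assms(1) assms(3,2)] by simp_all
qed

lemma CK_eqI:
  assumes "a \<in> carrier (CK_group N)" "b \<in> carrier (CK_group N)"
    "\<And>t. tree_degree t \<le> N \<Longrightarrow> a {#t#} = b {#t#}"
  shows "a = b"
proof -
  have "a {#t#} = b {#t#}" for t
    using assms(3)[of t] CK_carrierD(2)[OF assms(1), of "{#t#}"] CK_carrierD(2)[OF assms(2), of "{#t#}"] by force
  then have "character_of a = character_of b" by (auto simp: character_of_def)
  then show ?thesis using truncate_character_of assms by metis
qed

lemma top_series_inverse: "top_series N f \<otimes>\<^bsub>CK_group N\<^esub> top_series N (\<lambda>t. - f t) = unit_series"
proof (rule CK_eqI)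
  show "top_series N f \<otimes>\<^bsub>CK_group N\<^esub> top_series N (\<lambda>t. - f t) \<in> carrier (CK_group N)"
    by (intro monoid.m_closed[OF monoid_CK_group] top_series_carrier)
  fix t :: "'a ltree" assume "tree_degree t \<le> N"
  then show "(top_series N f \<otimes>\<^bsub>CK_group N\<^esub> top_series N (\<lambda>t. - f t)) {#t#} = unit_series {#t#}"
    by (simp add: CK_mult_top_series top_series_carrier top_series_tree unit_series_def)
qed (rule unit_in_CK_carrier)

text \<open>
  A right inverse is found degree by degree: a right inverse of the truncation of \<open>a\<close>, extended by zero on
  the trees of top degree, is one of \<open>a\<close> up to an element of the kernel of the truncation.
\<close>

lemma CK_right_inverse:
  "a \<in> carrier (CK_group N) \<Longrightarrow> \<exists>b\<in>carrier (CK_group N). a \<otimes>\<^bsub>CK_group N\<^esub> b = unit_series"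
proof (induction N arbitrary: a)
  case 0
  have "\<not> tree_degree t \<le> 0" for t :: "'a ltree" using tree_degree_pos[of t] by simp
  then have "a = unit_series" by (intro CK_eqI[OF 0 unit_in_CK_carrier]) blast
  then show ?case using unit_in_CK_carrier by (auto simp: CK_mult CK_product_unit_left CK_product_unit_right intro!: bexI[of _ unit_series])
next
  case (Suc N)
  let ?G = "CK_group (Suc N) :: ('a forest \<Rightarrow> real) monoid"
  interpret monoid ?G by (rule monoid_CK_group)
  obtain c where c: "c \<in> carrier (CK_group N)" "truncate N a \<otimes>\<^bsub>CK_group N\<^esub> c = unit_series"
    using Suc.IH[OF truncate_carrier[OF _ Suc.prems, of N]] by auto
  let ?c = "truncate (Suc N) (character_of c)"
  have c': "?c \<in> carrier ?G" "truncate N ?c = c"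
    using c by (simp_all add: truncate_in_CK_carrier character_character_of truncate_truncate truncate_character_of)
  let ?k = "a \<otimes>\<^bsub>?G\<^esub> ?c"
  let ?f = "\<lambda>t. ?k {#t#}"
  have k: "?k \<in> carrier ?G" using Suc.prems c' by simp
  have "truncate N ?k = unit_series" using c c' by (simp add: CK_mult_truncate_lower)
  \<comment> \<open>The product lies in the kernel of the truncation, where inversion is a change of sign.\<close>
  have "?k = top_series (Suc N) ?f"
  proof (rule CK_eqI[OF k top_series_carrier])
    fix t :: "'a ltree" assume "tree_degree t \<le> Suc N"
    show "?k {#t#} = top_series (Suc N) ?f {#t#}"
    proof (cases "tree_degree t = Suc N")
      case False
      then have "?k {#t#} = truncate N ?k {#t#}" using \<open>tree_degree t \<le> Suc N\<close> by simp
      also have "\<dots> = 0" unfolding \<open>truncate N ?k = unit_series\<close> by (simp add: unit_series_def)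
      finally show ?thesis using False by (simp add: top_series_tree)
    qed (simp add: top_series_tree)
  qed
  then have "a \<otimes>\<^bsub>?G\<^esub> ?c \<otimes>\<^bsub>?G\<^esub> top_series (Suc N) (\<lambda>t. - ?f t) = unit_series"
    using top_series_inverse[of "Suc N" ?f] by simp
  then have "a \<otimes>\<^bsub>?G\<^esub> (?c \<otimes>\<^bsub>?G\<^esub> top_series (Suc N) (\<lambda>t. - ?f t)) = unit_series"
    unfolding m_assoc[OF Suc.prems c'(1) top_series_carrier] .
  then show ?case using c' top_series_carrier by blast
qed

lemma group_CK_group: "group (CK_group N)"
proof -
  interpret monoid "CK_group N :: ('a forest \<Rightarrow> real) monoid" by (rule monoid_CK_group)
  show ?thesis
  proof (rule groupI)
    fix a :: "'a forest \<Rightarrow> real" assume a: "a \<in> carrier (CK_group N)"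
    obtain b where b: "b \<in> carrier (CK_group N)" "a \<otimes>\<^bsub>CK_group N\<^esub> b = unit_series"
      using CK_right_inverse[OF a] by blast
    obtain c where c: "c \<in> carrier (CK_group N)" "b \<otimes>\<^bsub>CK_group N\<^esub> c = unit_series"
      using CK_right_inverse[OF b(1)] by blast
    have "a = c"
      using a b c by (metis CK_one m_assoc l_one r_one)
    then show "\<exists>b\<in>carrier (CK_group N). b \<otimes>\<^bsub>CK_group N\<^esub> a = \<one>\<^bsub>CK_group N\<^esub>"
      using b c by (auto simp: CK_one)
  qed (simp_all add: m_assoc)
qed

lemma inj_by_symmetry: "inj by_symmetry"
  by (auto simp: inj_on_def by_symmetry_def fun_eq_iff)

lemma by_symmetry_truncate: "by_symmetry (truncate N a) = truncate N (by_symmetry a)"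
  by (auto simp: by_symmetry_def truncate_def)

lemma GL_carrier_eq:
  "carrier (GL_group N) = by_symmetry ` (carrier (CK_group N) :: ('l forest \<Rightarrow> real) set)"
proof -
  have "{b :: 'l forest \<Rightarrow> real. grouplike b} = by_symmetry ` {a. character a}"
  proof (intro equalityI subsetI)
    fix b :: "'l forest \<Rightarrow> real" assume "b \<in> {b. grouplike b}"
    define a where "a \<rho> = b \<rho> * real (forest_symmetry \<rho>)" for \<rho>
    have b: "b = by_symmetry a" by (simp add: by_symmetry_def a_def)
    then have "character a" using \<open>b \<in> {b. grouplike b}\<close> grouplike_by_symmetry[of a] by simp
    then show "b \<in> by_symmetry ` {a. character a}" using b by blast
  qed (auto simp: grouplike_by_symmetry)
  then show ?thesis
    by (simp add: GL_group_def CK_carrier_eq image_image by_symmetry_truncate)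
qed

lemma truncate_GL_product:
  fixes a b :: "'l forest \<Rightarrow> real"
  shows "truncate N (GL_product (truncate N a) (truncate N b)) = truncate N (GL_product a b)"
  unfolding truncate_eq_iff GL_product_def
proof (intro allI impI sum.cong HOL.refl)
  fix \<rho> :: "'l forest" and z assume \<rho>: "forest_degree \<rho> \<le> N" and "z \<in> {(\<rho>\<^sub>1, \<rho>\<^sub>2). \<rho> \<in> Poly_Mapping.keys (GL_product_forest \<rho>\<^sub>1 \<rho>\<^sub>2)}"
  moreover obtain x y where z: "z = (x, y)" by (cases z)
  ultimately have "forest_degree \<rho> = forest_degree x + forest_degree y"
    using degree_GL_product_forest by blast
  then show "(case z of (\<rho>\<^sub>1, \<rho>\<^sub>2) \<Rightarrow> truncate N a \<rho>\<^sub>1 * truncate N b \<rho>\<^sub>2 * Poly_Mapping.lookup (GL_product_forest \<rho>\<^sub>1 \<rho>\<^sub>2) \<rho>) =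
      (case z of (\<rho>\<^sub>1, \<rho>\<^sub>2) \<Rightarrow> a \<rho>\<^sub>1 * b \<rho>\<^sub>2 * Poly_Mapping.lookup (GL_product_forest \<rho>\<^sub>1 \<rho>\<^sub>2) \<rho>)"
    using \<rho> by (simp add: z)
qed

lemma by_symmetry_mult:
  fixes a b :: "'l::finite forest \<Rightarrow> real"
  assumes "a \<in> carrier (CK_group N)" "b \<in> carrier (CK_group N)"
  shows "by_symmetry (a \<otimes>\<^bsub>CK_group N\<^esub> b) = by_symmetry a \<otimes>\<^bsub>GL_group N\<^esub> by_symmetry b"
proof -
  obtain a' b' where "character a'" "character b'" "a = truncate N a'" "b = truncate N b'"
    using assms by (auto simp: CK_carrier_eq)
  then show ?thesis
    by (simp add: CK_mult_truncate by_symmetry_truncate GL_group_def truncate_GL_product GL_product_by_symmetry)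
qed

lemma by_symmetry_unit: "by_symmetry unit_series = unit_series"
  by (auto simp: by_symmetry_def unit_series_def)

lemma by_symmetry_inv:
  fixes a :: "'l::finite forest \<Rightarrow> real"
  assumes a: "a \<in> carrier (CK_group N)"
  shows "by_symmetry (inv\<^bsub>CK_group N\<^esub> a) = inv\<^bsub>GL_group N\<^esub> (by_symmetry a)"
proof -
  let ?G = "CK_group N :: ('l forest \<Rightarrow> real) monoid" and ?H = "GL_group N :: ('l forest \<Rightarrow> real) monoid"
  interpret group ?G by (rule group_CK_group)
  have one: "\<one>\<^bsub>?H\<^esub> = by_symmetry \<one>\<^bsub>?G\<^esub>" by (simp add: GL_group_def CK_one by_symmetry_unit)
  have *: "by_symmetry x \<otimes>\<^bsub>?H\<^esub> by_symmetry y = \<one>\<^bsub>?H\<^esub> \<longleftrightarrow> x \<otimes>\<^bsub>?G\<^esub> y = \<one>\<^bsub>?G\<^esub>"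
    if "x \<in> carrier ?G" "y \<in> carrier ?G" for x y
    using that by (simp add: one inj_eq[OF inj_by_symmetry] flip: by_symmetry_mult)
  show ?thesis
    unfolding m_inv_def[of ?H]
  proof (rule the_equality[symmetric])
    show "by_symmetry (inv\<^bsub>?G\<^esub> a) \<in> carrier ?H \<and> by_symmetry a \<otimes>\<^bsub>?H\<^esub> by_symmetry (inv\<^bsub>?G\<^esub> a) = \<one>\<^bsub>?H\<^esub> \<and>
        by_symmetry (inv\<^bsub>?G\<^esub> a) \<otimes>\<^bsub>?H\<^esub> by_symmetry a = \<one>\<^bsub>?H\<^esub>"
      using a by (simp add: * GL_carrier_eq)
    fix y assume y: "y \<in> carrier ?H \<and> by_symmetry a \<otimes>\<^bsub>?H\<^esub> y = \<one>\<^bsub>?H\<^esub> \<and> y \<otimes>\<^bsub>?H\<^esub> by_symmetry a = \<one>\<^bsub>?H\<^esub>"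
    then obtain x where x: "x \<in> carrier ?G" "y = by_symmetry x" by (auto simp: GL_carrier_eq)
    then have "x \<otimes>\<^bsub>?G\<^esub> a = \<one>\<^bsub>?G\<^esub>" using y a * by simp
    then show "y = by_symmetry (inv\<^bsub>?G\<^esub> a)" using x a inv_equality by simp
  qed
qed

lemma rescale_eq: "rescale X t = by_symmetry (X t)"
  by (simp add: rescale_def by_symmetry_def)

lemma increment_rescale:
  fixes X :: "real \<Rightarrow> 'l::finite forest \<Rightarrow> real"
  assumes "X s \<in> carrier (CK_group N)" "X t \<in> carrier (CK_group N)"
  shows "increment (GL_group N) (rescale X) s t = by_symmetry (increment (CK_group N) X s t)"
proof -
  interpret group "CK_group N :: ('l forest \<Rightarrow> real) monoid" by (rule group_CK_group)
  show ?thesis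
    using assms by (simp add: increment_def rescale_eq by_symmetry_mult by_symmetry_inv)
qed

section \<open>Controls\<close>

text \<open>
  A superadditive function of intervals that is small on short intervals ending or starting at a given
  point. Smallness on both sides of \<open>x\<close> separately is enough for the local arguments below, since an
  interval around \<open>x\<close> can be split at \<open>x\<close>.
\<close>

definition control :: "real \<Rightarrow> (real \<Rightarrow> real \<Rightarrow> real) \<Rightarrow> bool" where
  "control T \<omega> \<longleftrightarrow>
     (\<forall>s t. 0 \<le> s \<longrightarrow> s \<le> t \<longrightarrow> t \<le> T \<longrightarrow> 0 \<le> \<omega> s t) \<and>
     (\<forall>s u t. 0 \<le> s \<longrightarrow> s \<le> u \<longrightarrow> u \<le> t \<longrightarrow> t \<le> T \<longrightarrow> \<omega> s u + \<omega> u t \<le> \<omega> s t) \<and>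
     (\<forall>x\<in>{0..T}. \<forall>\<epsilon>>0. \<exists>\<delta>>0. (\<forall>t. x \<le> t \<longrightarrow> t \<le> T \<longrightarrow> t < x + \<delta> \<longrightarrow> \<omega> x t < \<epsilon>) \<and>
        (\<forall>s. 0 \<le> s \<longrightarrow> s \<le> x \<longrightarrow> x - \<delta> < s \<longrightarrow> \<omega> s x < \<epsilon>))"

lemma control_nonneg: "control T \<omega> \<Longrightarrow> 0 \<le> s \<Longrightarrow> s \<le> t \<Longrightarrow> t \<le> T \<Longrightarrow> 0 \<le> \<omega> s t"
  and control_super: "control T \<omega> \<Longrightarrow> 0 \<le> s \<Longrightarrow> s \<le> u \<Longrightarrow> u \<le> t \<Longrightarrow> t \<le> T \<Longrightarrow> \<omega> s u + \<omega> u t \<le> \<omega> s t"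
  by (simp_all add: control_def)

lemma control_small:
  assumes "control T \<omega>" "0 \<le> x" "x \<le> T" "0 < \<epsilon>"
  obtains \<delta> where "0 < \<delta>" "\<And>t. x \<le> t \<Longrightarrow> t \<le> T \<Longrightarrow> t < x + \<delta> \<Longrightarrow> \<omega> x t < \<epsilon>"
    "\<And>s. 0 \<le> s \<Longrightarrow> s \<le> x \<Longrightarrow> x - \<delta> < s \<Longrightarrow> \<omega> s x < \<epsilon>"
  using assms unfolding control_def by (metis atLeastAtMost_iff)

lemma control_zero: "control T \<omega> \<Longrightarrow> 0 \<le> x \<Longrightarrow> x \<le> T \<Longrightarrow> \<omega> x x = 0"
  using control_super[of T \<omega> x x x] control_nonneg[of T \<omega> x x] by simp

lemma control_mono:
  assumes "control T \<omega>" "0 \<le> s'" "s' \<le> s" "s \<le> t" "t \<le> t'" "t' \<le> T"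
  shows "\<omega> s t \<le> \<omega> s' t'"
proof -
  have "\<omega> s' s + \<omega> s t \<le> \<omega> s' t" "\<omega> s' t + \<omega> t t' \<le> \<omega> s' t'"
    "0 \<le> \<omega> s' s" "0 \<le> \<omega> t t'"
    using assms by (auto intro!: control_super[OF assms(1)] control_nonneg[OF assms(1)])
  then show ?thesis by linarith
qed

lemma control_add:
  assumes "control T \<omega>" "control T \<eta>"
  shows "control T (\<lambda>s t. \<omega> s t + \<eta> s t)"
  unfolding control_def
proof (intro conjI allI impI ballI)
  fix s t assume "0 \<le> s" "s \<le> t" "t \<le> T"
  then show "0 \<le> \<omega> s t + \<eta> s t" using assms by (simp add: control_nonneg)
next
  fix s u t assume "0 \<le> s" "s \<le> u" "u \<le> t" "t \<le> T"
  then have "\<omega> s u + \<omega> u t \<le> \<omega> s t" "\<eta> s u + \<eta> u t \<le> \<eta> s t" using assms by (simp_all add: control_super)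
  then show "\<omega> s u + \<eta> s u + (\<omega> u t + \<eta> u t) \<le> \<omega> s t + \<eta> s t" by simp
next
  fix x \<epsilon> :: real assume x: "x \<in> {0..T}" and "0 < \<epsilon>"
  then have e: "0 < \<epsilon> / 2" by simp
  obtain d where d: "0 < d" "\<And>t. x \<le> t \<Longrightarrow> t \<le> T \<Longrightarrow> t < x + d \<Longrightarrow> \<omega> x t < \<epsilon> / 2"
    "\<And>s. 0 \<le> s \<Longrightarrow> s \<le> x \<Longrightarrow> x - d < s \<Longrightarrow> \<omega> s x < \<epsilon> / 2"
    using control_small[OF assms(1) _ _ e] x by auto
  obtain d' where d': "0 < d'" "\<And>t. x \<le> t \<Longrightarrow> t \<le> T \<Longrightarrow> t < x + d' \<Longrightarrow> \<eta> x t < \<epsilon> / 2"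
    "\<And>s. 0 \<le> s \<Longrightarrow> s \<le> x \<Longrightarrow> x - d' < s \<Longrightarrow> \<eta> s x < \<epsilon> / 2"
    using control_small[OF assms(2) _ _ e] x by auto
  have "\<omega> x t + \<eta> x t < \<epsilon>" if "x \<le> t" "t \<le> T" "t < x + min d d'" for t
    using d(2)[of t] d'(2)[of t] that min.cobounded1[of d d'] min.cobounded2[of d d'] by linarith
  moreover have "\<omega> s x + \<eta> s x < \<epsilon>" if "0 \<le> s" "s \<le> x" "x - min d d' < s" for s
    using d(3)[of s] d'(3)[of s] that min.cobounded1[of d d'] min.cobounded2[of d d'] by linarith
  ultimately show "\<exists>\<delta>>0. (\<forall>t. x \<le> t \<longrightarrow> t \<le> T \<longrightarrow> t < x + \<delta> \<longrightarrow> \<omega> x t + \<eta> x t < \<epsilon>) \<and>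
        (\<forall>s. 0 \<le> s \<longrightarrow> s \<le> x \<longrightarrow> x - \<delta> < s \<longrightarrow> \<omega> s x + \<eta> s x < \<epsilon>)"
    using d(1) d'(1) by (intro exI[of _ "min d d'"]) auto
qed

text \<open>
  The sums of \<open>f\<close> over the partitions of an interval, generated by appending intervals so that
  concatenation and decomposition are proved by induction.
\<close>

inductive partition_sum :: "(real \<Rightarrow> real \<Rightarrow> real) \<Rightarrow> real \<Rightarrow> real \<Rightarrow> real \<Rightarrow> bool" for f :: "real \<Rightarrow> real \<Rightarrow> real" where
  refl: "partition_sum f s s 0"
| step: "partition_sum f s u x \<Longrightarrow> u < t \<Longrightarrow> partition_sum f s t (x + f u t)"

lemma partition_sum_le: "partition_sum f s t x \<Longrightarrow> s \<le> t"
  by (induction rule: partition_sum.induct) auto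

lemma partition_sum_trans:
  assumes "partition_sum f s u x" "partition_sum f u t y"
  shows "partition_sum f s t (x + y)"
  using assms(2,1)
proof (induction arbitrary: x rule: partition_sum.induct)
  case (refl s)
  then show ?case by simp
next
  case (step s u y t)
  then show ?case using partition_sum.step[of f _ u "x + y" t] by (simp add: add.assoc)
qed

lemma partition_sum_single: "s < t \<Longrightarrow> partition_sum f s t (f s t)"
  using partition_sum.step[OF partition_sum.refl, of s t f] by simp

lemma partition_sum_first:
  assumes "partition_sum f s t x"
  shows "(s = t \<and> x = 0) \<or> (\<exists>u y. s < u \<and> partition_sum f u t y \<and> x = f s u + y)"
  using assms
proof (induction rule: partition_sum.induct)
  case (refl s)
  then show ?case by simp
next
  case (step s u x t)
  then consider "s = u" "x = 0" | v y where "s < v" "partition_sum f v u y" "x = f s v + y" by blast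
  then show ?case
  proof cases
    case 1
    then show ?thesis using step partition_sum.refl[of f t] by force
  next
    case 2
    then have "partition_sum f v t (y + f u t)" using step partition_sum.step by blast
    then show ?thesis using 2 by (metis add.assoc)
  qed
qed

lemma increasing_steps_mono:
  fixes \<tau> :: "nat \<Rightarrow> real"
  assumes "\<forall>i<n. \<tau> i < \<tau> (Suc i)" "i \<le> j" "j \<le> n"
  shows "\<tau> i \<le> \<tau> j"
  using assms(2,3)
proof (induction j)
  case (Suc j)
  have "\<tau> j < \<tau> (Suc j)" using assms(1) Suc.prems by simp
  then show ?case using Suc by (cases "i = Suc j") auto
qed simp

lemma partition_sum_indexed:
  assumes "partition_sum f s t x" "s < t"
  shows "\<exists>n \<tau>. 1 \<le> n \<and> \<tau> 0 = s \<and> \<tau> n = t \<and> (\<forall>i<n. \<tau> i < \<tau> (Suc i)) \<and> x = (\<Sum>i<n. f (\<tau> i) (\<tau> (Suc i)))"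
  using assms
proof (induction rule: partition_sum.induct)
  case (refl s)
  then show ?case by simp
next
  case (step s u x t)
  show ?case
  proof (cases "s = u")
    case True
    with step have "x = 0" by (metis partition_sum.cases partition_sum_le not_le)
    then show ?thesis using step True
      by (intro exI[of _ 1] exI[of _ "\<lambda>i. if i = 0 then s else t"]) auto
  next
    case False
    then have "s < u" using step partition_sum_le by fastforce
    then obtain n \<tau> where n: "1 \<le> n" "\<tau> 0 = s" "\<tau> n = u" "\<forall>i<n. \<tau> i < \<tau> (Suc i)"
      "x = (\<Sum>i<n. f (\<tau> i) (\<tau> (Suc i)))" using step by blast
    have "(\<Sum>i<n. f ((\<tau>(Suc n := t)) i) ((\<tau>(Suc n := t)) (Suc i))) = x" unfolding n(5) by (rule sum.cong) auto
    then show ?thesis using n step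
      by (intro exI[of _ "Suc n"] exI[of _ "\<tau>(Suc n := t)"]) (auto simp: less_Suc_eq)
  qed
qed

text \<open>
  The supremum of the partition sums is superadditive. It is small to the right of a point \<open>s\<close>: a nearly
  optimal partition of \<open>[s, T]\<close> can be started at \<open>u > s\<close> close to \<open>s\<close> instead with little loss, by
  continuity of the value on its first interval; by superadditivity little is left for \<open>[s, u]\<close>. The left
  side is treated in the same way.
\<close>

lemma control_exists:
  fixes f :: "real \<Rightarrow> real \<Rightarrow> real"
  assumes T: "0 < T"
    and nonneg: "\<And>s t. 0 \<le> s \<Longrightarrow> s \<le> t \<Longrightarrow> t \<le> T \<Longrightarrow> 0 \<le> f s t"
    and diag: "\<And>s. 0 \<le> s \<Longrightarrow> s \<le> T \<Longrightarrow> f s s = 0"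
    and right: "\<And>s b. 0 \<le> s \<Longrightarrow> s < b \<Longrightarrow> b \<le> T \<Longrightarrow> ((\<lambda>u. f u b) \<longlongrightarrow> f s b) (at_right s)"
    and left: "\<And>a t. 0 \<le> a \<Longrightarrow> a < t \<Longrightarrow> t \<le> T \<Longrightarrow> ((\<lambda>u. f a u) \<longlongrightarrow> f a t) (at_left t)"
    and bdd: "bdd_above {(\<Sum>i<n. f (\<tau> i) (\<tau> (Suc i))) | n \<tau>.
       1 \<le> n \<and> \<tau> 0 = 0 \<and> \<tau> n = T \<and> (\<forall>i<n. \<tau> i < \<tau> (Suc i))}"
  obtains \<omega> where "control T \<omega>" "\<And>s t. 0 \<le> s \<Longrightarrow> s \<le> t \<Longrightarrow> t \<le> T \<Longrightarrow> f s t \<le> \<omega> s t"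
proof -
  define \<omega> where "\<omega> s t = Sup {x. partition_sum f s t x}" for s t
  have nonneg': "0 \<le> x" if "partition_sum f s t x" "0 \<le> s" "t \<le> T" for s t x
    using that
  proof (induction rule: partition_sum.induct)
    case (step s u x t)
    then show ?case using partition_sum_le[OF step(1)] nonneg[of u t] by fastforce
  qed simp
  obtain B where "\<And>n \<tau>. 1 \<le> n \<Longrightarrow> \<tau> 0 = 0 \<Longrightarrow> \<tau> n = T \<Longrightarrow> (\<forall>i<n. \<tau> i < \<tau> (Suc i)) \<Longrightarrow>
      (\<Sum>i<n. f (\<tau> i) (\<tau> (Suc i))) \<le> B"
    using bdd unfolding bdd_above_def by blast
  then have BT: "x \<le> B" if "partition_sum f 0 T x" for x
    using partition_sum_indexed[OF that T] by blast
  have ex: "\<exists>x. partition_sum f s t x" if "s \<le> t" for s t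
    using that partition_sum.refl[of f s] partition_sum_single[of s t f] by (cases "s = t") auto
  have B: "x \<le> B" if st: "partition_sum f s t x" "0 \<le> s" "t \<le> T" for s t x
  proof -
    obtain y z where y: "partition_sum f 0 s y" and z: "partition_sum f t T z"
      using ex[of 0 s] ex[of t T] st by auto
    then have "partition_sum f 0 T (y + x + z)" using st(1) partition_sum_trans by blast
    moreover have "s \<le> t" using st(1) by (rule partition_sum_le)
    ultimately show ?thesis using BT[of "y + x + z"] nonneg'[OF y] nonneg'[OF z] st by linarith
  qed
  have up: "x \<le> \<omega> s t" if "partition_sum f s t x" "0 \<le> s" "t \<le> T" for s t x
    unfolding \<omega>_def using that B by (intro cSup_upper) (auto simp: bdd_above_def)
  have near: "\<exists>x. partition_sum f s t x \<and> \<omega> s t - \<epsilon> < x" if "0 \<le> s" "s \<le> t" "t \<le> T" "0 < \<epsilon>" for s t \<epsilon>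
  proof -
    have "\<exists>x\<in>{x. partition_sum f s t x}. \<omega> s t - \<epsilon> < x"
      using ex[OF \<open>s \<le> t\<close>] that unfolding \<omega>_def by (intro less_cSupD) auto
    then show ?thesis by auto
  qed
  have super: "\<omega> s u + \<omega> u t \<le> \<omega> s t" if st: "0 \<le> s" "s \<le> u" "u \<le> t" "t \<le> T" for s u t
  proof (rule field_le_epsilon)
    fix e :: real assume "0 < e"
    then have e: "0 < e / 2" by simp
    obtain x where x: "partition_sum f s u x" "\<omega> s u - e / 2 < x"
      using near[of s u, OF _ _ _ e] st by auto
    obtain y where y: "partition_sum f u t y" "\<omega> u t - e / 2 < y"
      using near[of u t, OF _ _ _ e] st by auto
    have "x + y \<le> \<omega> s t" using up[OF partition_sum_trans[OF x(1) y(1)]] st by simp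
    with x y show "\<omega> s u + \<omega> u t \<le> \<omega> s t + e" by linarith
  qed
  have om0: "0 \<le> \<omega> s t" if "0 \<le> s" "s \<le> t" "t \<le> T" for s t
  proof -
    obtain x where "partition_sum f s t x" using ex[OF \<open>s \<le> t\<close>] by blast
    then show ?thesis using up[of s t x] nonneg'[of s t x] that by linarith
  qed
  have r: "\<exists>\<delta>>0. \<forall>t. x \<le> t \<longrightarrow> t \<le> T \<longrightarrow> t < x + \<delta> \<longrightarrow> \<omega> x t < \<epsilon>" if x: "0 \<le> x" "x \<le> T" and "0 < \<epsilon>" for x \<epsilon>
  proof -
    have e: "0 < \<epsilon> / 2" using that by simp
    obtain y where y: "partition_sum f x T y" "\<omega> x T - \<epsilon> / 2 < y" using near[OF x(1) x(2) _ e] by auto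
    from partition_sum_first[OF y(1)] consider "x = T" "y = 0"
      | b z where "x < b" "partition_sum f b T z" "y = f x b + z" by blast
    then show ?thesis
    proof cases
      case 1
      then have "\<omega> x t < \<epsilon>" if "x \<le> t" "t \<le> T" for t using y that \<open>0 < \<epsilon>\<close> by (auto simp: 1)
      then show ?thesis by (intro exI[of _ 1]) auto
    next
      case 2
      have bT: "b \<le> T" using 2 partition_sum_le by blast
      have "\<forall>\<^sub>F u in at_right x. f x b - \<epsilon> / 2 < f u b"
        by (rule order_tendstoD(1)[OF right]) (use x 2 bT e in auto)
      then obtain c where c: "x < c" "\<And>u. x < u \<Longrightarrow> u < c \<Longrightarrow> f x b - \<epsilon> / 2 < f u b"
        unfolding eventually_at_right_field by blast
      have "\<omega> x t < \<epsilon>" if t: "x \<le> t" "t \<le> T" "t < x + (min b c - x)" for t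
      proof (cases "t = x")
        case True
        then show ?thesis using super[of x x x] x \<open>0 < \<epsilon>\<close> om0[of x x] by simp
      next
        case False
        then have "f x b - \<epsilon> / 2 < f t b" using c t by auto
        moreover have "partition_sum f t T (f t b + z)"
          using partition_sum_trans[OF partition_sum_single 2(2)] t by simp
        then have "f t b + z \<le> \<omega> t T" using up x t by auto
        moreover have "\<omega> x t + \<omega> t T \<le> \<omega> x T" using super x t by auto
        ultimately show ?thesis using y 2 by linarith
      qed
      then show ?thesis using 2 c by (intro exI[of _ "min b c - x"]) auto
    qed
  qed
  have l: "\<exists>\<delta>>0. \<forall>s. 0 \<le> s \<longrightarrow> s \<le> x \<longrightarrow> x - \<delta> < s \<longrightarrow> \<omega> s x < \<epsilon>" if x: "0 \<le> x" "x \<le> T" and "0 < \<epsilon>" for x \<epsilon>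
  proof -
    have e: "0 < \<epsilon> / 2" using that by simp
    obtain y where y: "partition_sum f 0 x y" "\<omega> 0 x - \<epsilon> / 2 < y" using near[OF _ x(1) x(2) e] by auto
    from y(1) consider "x = 0" "y = 0"
      | a z where "a < x" "partition_sum f 0 a z" "y = z + f a x"
      by cases auto
    then show ?thesis
    proof cases
      case 1
      then have "\<omega> s x < \<epsilon>" if "0 \<le> s" "s \<le> x" for s using y that \<open>0 < \<epsilon>\<close> by (auto simp: 1)
      then show ?thesis by (intro exI[of _ 1]) auto
    next
      case 2
      have a0: "0 \<le> a" using 2 partition_sum_le by blast
      have "\<forall>\<^sub>F u in at_left x. f a x - \<epsilon> / 2 < f a u"
        by (rule order_tendstoD(1)[OF left]) (use x 2 a0 e in auto)
      then obtain c where c: "c < x" "\<And>u. c < u \<Longrightarrow> u < x \<Longrightarrow> f a x - \<epsilon> / 2 < f a u"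
        unfolding eventually_at_left_field by blast
      have "\<omega> s x < \<epsilon>" if s: "0 \<le> s" "s \<le> x" "x - (x - max a c) < s" for s
      proof (cases "s = x")
        case True
        then show ?thesis using super[of x x x] x \<open>0 < \<epsilon>\<close> om0[of x x] by simp
      next
        case False
        then have "f a x - \<epsilon> / 2 < f a s" using c s by auto
        moreover have "partition_sum f 0 s (z + f a s)"
          using partition_sum_trans[OF 2(2) partition_sum_single] s by simp
        then have "z + f a s \<le> \<omega> 0 s" using up x s by auto
        moreover have "\<omega> 0 s + \<omega> s x \<le> \<omega> 0 x" using super x s by auto
        ultimately show ?thesis using y 2 by linarith
      qed
      then show ?thesis using 2 c by (intro exI[of _ "x - max a c"]) auto
    qed
  qed
  have "control T \<omega>"
    unfolding control_def
  proof (intro conjI allI impI ballI)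
    fix x \<epsilon> :: real assume "x \<in> {0..T}" "0 < \<epsilon>"
    then have x: "0 \<le> x" "x \<le> T" by auto
    obtain d d' where "0 < d" "\<forall>t. x \<le> t \<longrightarrow> t \<le> T \<longrightarrow> t < x + d \<longrightarrow> \<omega> x t < \<epsilon>"
      "0 < d'" "\<forall>s. 0 \<le> s \<longrightarrow> s \<le> x \<longrightarrow> x - d' < s \<longrightarrow> \<omega> s x < \<epsilon>"
      using r[OF x \<open>0 < \<epsilon>\<close>] l[OF x \<open>0 < \<epsilon>\<close>] by blast
    then show "\<exists>\<delta>>0. (\<forall>t. x \<le> t \<longrightarrow> t \<le> T \<longrightarrow> t < x + \<delta> \<longrightarrow> \<omega> x t < \<epsilon>) \<and>
        (\<forall>s. 0 \<le> s \<longrightarrow> s \<le> x \<longrightarrow> x - \<delta> < s \<longrightarrow> \<omega> s x < \<epsilon>)"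
      by (intro exI[of _ "min d d'"]) auto
  qed (use super om0 in auto)
  moreover have "f s t \<le> \<omega> s t" if "0 \<le> s" "s \<le> t" "t \<le> T" for s t
  proof (cases "s = t")
    case True
    then show ?thesis using diag[of s] om0[of s s] that by simp
  next
    case False
    then show ?thesis using up[OF partition_sum_single] that by simp
  qed
  ultimately show ?thesis using that by blast
qed

section \<open>The sewing lemma\<close>

text \<open>
  For every \<open>\<epsilon> > 0\<close>, \<open>|D|\<close> is at most \<open>\<epsilon> \<omega>\<close> on short intervals because \<open>\<omega>\<^sup>\<theta> = \<omega>\<^sup>\<theta>\<^sup>-\<^sup>1 \<omega>\<close>. By superadditivity
  this bound is inherited by unions of adjacent intervals, hence holds on all intervals.
\<close>

lemma additive_eq_0:
  fixes D :: "real \<Rightarrow> real \<Rightarrow> real"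
  assumes \<omega>: "control T \<omega>" and \<theta>: "1 < \<theta>" and C: "0 \<le> C"
    and D: "\<And>s u t. 0 \<le> s \<Longrightarrow> s \<le> u \<Longrightarrow> u \<le> t \<Longrightarrow> t \<le> T \<Longrightarrow> D s t = D s u + D u t"
    and bound: "\<And>s t. 0 \<le> s \<Longrightarrow> s \<le> t \<Longrightarrow> t \<le> T \<Longrightarrow> \<bar>D s t\<bar> \<le> C * \<omega> s t powr \<theta>"
    and st: "0 \<le> s" "s \<le> t" "t \<le> T"
  shows "D s t = 0"
proof -
  have le: "\<bar>D s t\<bar> \<le> \<epsilon> * \<omega> s t" if "0 < \<epsilon>" for \<epsilon>
  proof -
    let ?P = "\<lambda>a b. s \<le> a \<longrightarrow> b \<le> t \<longrightarrow> \<bar>D a b\<bar> \<le> \<epsilon> * \<omega> a b"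
    have "?P s t"
    proof (rule Bolzano[of s t ?P, OF \<open>s \<le> t\<close>])
      fix a b c assume P: "?P a b" "?P b c" and abc: "a \<le> b" "b \<le> c"
      show "?P a c"
      proof (intro impI)
        assume "s \<le> a" "c \<le> t"
        then have "D a c = D a b + D b c" "\<bar>D a b\<bar> \<le> \<epsilon> * \<omega> a b" "\<bar>D b c\<bar> \<le> \<epsilon> * \<omega> b c"
          "\<epsilon> * (\<omega> a b + \<omega> b c) \<le> \<epsilon> * \<omega> a c"
          using abc P st \<open>0 < \<epsilon>\<close> by (auto intro!: D mult_left_mono control_super[OF \<omega>])
        then show "\<bar>D a c\<bar> \<le> \<epsilon> * \<omega> a c" by (simp add: distrib_left)
      qed
    next
      fix x assume x: "s \<le> x" "x \<le> t"
      \<comment> \<open>The value of the control below which \<open>C \<omega>\<^sup>\<theta> \<le> \<epsilon> \<omega>\<close>.\<close>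
      define \<kappa> where "\<kappa> = (\<epsilon> / (C + 1)) powr (1 / (\<theta> - 1))"
      have \<kappa>: "0 < \<kappa>" using \<open>0 < \<epsilon>\<close> C by (simp add: \<kappa>_def)
      have small: "C * w powr \<theta> \<le> \<epsilon> * w" if w: "0 \<le> w" "w < \<kappa>" for w
      proof -
        have "w powr (\<theta> - 1) \<le> \<kappa> powr (\<theta> - 1)" using w \<theta> by (intro powr_mono2) auto
        also have "\<dots> = \<epsilon> / (C + 1)" using \<theta> C \<open>0 < \<epsilon>\<close> by (simp add: \<kappa>_def powr_powr)
        finally have "C * w powr (\<theta> - 1) \<le> C * (\<epsilon> / (C + 1))" using C by (rule mult_left_mono)
        also have "\<dots> \<le> \<epsilon>" using C \<open>0 < \<epsilon>\<close> by (simp add: field_simps)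
        finally have "C * w powr (\<theta> - 1) * w \<le> \<epsilon> * w" using w by (intro mult_right_mono)
        moreover have "w powr \<theta> = w powr (\<theta> - 1) * w"
          using w by (cases "w = 0") (auto simp: powr_diff)
        ultimately show ?thesis by (simp add: mult.assoc)
      qed
      obtain d where d: "0 < d" "\<And>t. x \<le> t \<Longrightarrow> t \<le> T \<Longrightarrow> t < x + d \<Longrightarrow> \<omega> x t < \<kappa>"
        "\<And>s. 0 \<le> s \<Longrightarrow> s \<le> x \<Longrightarrow> x - d < s \<Longrightarrow> \<omega> s x < \<kappa>"
        using control_small[OF \<omega> _ _ \<kappa>, of x] x st by auto
      have "?P a b" if ab: "a \<le> x" "x \<le> b" "b - a < d" for a b
      proof (intro impI)
        assume sa: "s \<le> a" "b \<le> t"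
        have "\<bar>D a x\<bar> \<le> \<epsilon> * \<omega> a x"
          using bound[of a x] small[of "\<omega> a x"] d(3)[of a] control_nonneg[OF \<omega>, of a x] sa ab st by simp
        moreover have "\<bar>D x b\<bar> \<le> \<epsilon> * \<omega> x b"
          using bound[of x b] small[of "\<omega> x b"] d(2)[of b] control_nonneg[OF \<omega>, of x b] sa ab st by simp
        moreover have "D a b = D a x + D x b" using D[of a x b] sa ab st by simp
        moreover have "\<epsilon> * (\<omega> a x + \<omega> x b) \<le> \<epsilon> * \<omega> a b"
          using \<open>0 < \<epsilon>\<close> control_super[OF \<omega>, of a x b] sa ab st by (intro mult_left_mono) auto
        ultimately show "\<bar>D a b\<bar> \<le> \<epsilon> * \<omega> a b" by (simp add: distrib_left)
      qed
      then show "\<exists>d>0. \<forall>a b. a \<le> x \<and> x \<le> b \<and> b - a < d \<longrightarrow> ?P a b" using d(1) by blast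
    qed
    then show ?thesis by simp
  qed
  have "\<bar>D s t\<bar> \<le> 0 + e" if "0 < e" for e
  proof -
    have w: "0 \<le> \<omega> s t" using control_nonneg[OF \<omega> st] .
    have "\<bar>D s t\<bar> \<le> e / (\<omega> s t + 1) * \<omega> s t" using le[of "e / (\<omega> s t + 1)"] that w by simp
    also have "\<dots> \<le> e" using that w by (simp add: field_simps)
    finally show ?thesis by simp
  qed
  then have "\<bar>D s t\<bar> \<le> 0" by (rule field_le_epsilon)
  then show ?thesis by simp
qed

text \<open>
  The Riemann sum along a partition differs from \<open>\<Xi>\<close> on the whole interval by the error of cutting at the
  subinterval that contains the midpoint with respect to \<open>\<omega>\<close>, and by the errors of the two remaining
  parts. These carry at most half of \<open>\<omega>\<close> each, so the constant \<open>K\<close> has to satisfy \<open>2 K / 2\<^sup>\<theta> + 2 C = K\<close>.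
\<close>

lemma sewing_estimate:
  fixes \<Xi> :: "real \<Rightarrow> real \<Rightarrow> real"
  assumes \<omega>: "control T \<omega>" and \<theta>: "1 < \<theta>" and C: "0 \<le> C"
    and \<Xi>: "\<And>s u t. 0 \<le> s \<Longrightarrow> s \<le> u \<Longrightarrow> u \<le> t \<Longrightarrow> t \<le> T \<Longrightarrow>
       \<bar>\<Xi> s t - \<Xi> s u - \<Xi> u t\<bar> \<le> C * \<omega> s t powr \<theta>"
    and \<tau>: "mono_on {..n} \<tau>" "\<tau> ` {..n} \<subseteq> {0..T}" and ij: "i \<le> j" "j \<le> n"
  shows "\<bar>(\<Sum>k=i..<j. \<Xi> (\<tau> k) (\<tau> (Suc k))) - \<Xi> (\<tau> i) (\<tau> j)\<bar> \<le>
    (2 * C / (1 - 2 powr (1 - \<theta>))) * \<omega> (\<tau> i) (\<tau> j) powr \<theta>"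
  using ij
proof (induction "j - i" arbitrary: i j rule: less_induct)
  case less
  define K where "K = 2 * C / (1 - 2 powr (1 - \<theta>))"
  have lt1: "2 powr (1 - \<theta>) < 1" using \<theta> powr_less_mono[of "1 - \<theta>" 0 2] by simp
  then have K: "0 \<le> K" using C by (simp add: K_def)
  have KC: "2 powr (1 - \<theta>) * K + 2 * C = K"
  proof -
    have "K * (1 - 2 powr (1 - \<theta>)) = 2 * C" using lt1 \<theta> by (simp add: K_def)
    then show ?thesis by (simp add: algebra_simps)
  qed
  have in0T: "0 \<le> \<tau> k" "\<tau> k \<le> T" if "k \<le> n" for k using \<tau>(2) that by (auto simp: image_subset_iff)
  have mono: "\<tau> k \<le> \<tau> l" if "k \<le> l" "l \<le> n" for k l using \<tau>(1) that by (auto simp: mono_on_def)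
  let ?w = "\<omega> (\<tau> i) (\<tau> j)"
  have w: "0 \<le> ?w" using less.prems by (intro control_nonneg[OF \<omega>]) (auto simp: in0T mono)
  show ?case
  proof (cases "i = j")
    case True
    have "\<omega> (\<tau> j) (\<tau> j) = 0" using control_zero[OF \<omega>] in0T less.prems by simp
    moreover from this have "\<bar>\<Xi> (\<tau> j) (\<tau> j)\<bar> \<le> 0"
      using \<Xi>[of "\<tau> j" "\<tau> j" "\<tau> j"] in0T less.prems by simp
    ultimately show ?thesis using True by simp
  next
    case False
    then have "i < j" using less.prems by simp
    \<comment> \<open>The last point of the partition up to which at most half of the control is used.\<close>
    define m where "m = Max {m \<in> {i..<j}. \<omega> (\<tau> i) (\<tau> m) \<le> ?w / 2}"
    have fin: "finite {m \<in> {i..<j}. \<omega> (\<tau> i) (\<tau> m) \<le> ?w / 2}" by simp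
    have "\<omega> (\<tau> i) (\<tau> i) = 0" using control_zero[OF \<omega>] in0T less.prems by simp
    then have "i \<in> {m \<in> {i..<j}. \<omega> (\<tau> i) (\<tau> m) \<le> ?w / 2}" using w \<open>i < j\<close> by simp
    then have "m \<in> {m \<in> {i..<j}. \<omega> (\<tau> i) (\<tau> m) \<le> ?w / 2}" unfolding m_def using fin by (intro Max_in) auto
    then have m: "i \<le> m" "m < j" "\<omega> (\<tau> i) (\<tau> m) \<le> ?w / 2" by auto
    have w2: "\<omega> (\<tau> (Suc m)) (\<tau> j) \<le> ?w / 2"
    proof (cases "Suc m = j")
      case True
      then show ?thesis using control_zero[OF \<omega>, of "\<tau> j"] in0T[of j] less.prems w by simp
    next
      case False
      have "\<not> \<omega> (\<tau> i) (\<tau> (Suc m)) \<le> ?w / 2"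
      proof
        assume "\<omega> (\<tau> i) (\<tau> (Suc m)) \<le> ?w / 2"
        then have "Suc m \<in> {m \<in> {i..<j}. \<omega> (\<tau> i) (\<tau> m) \<le> ?w / 2}" using m False by auto
        then have "Suc m \<le> Max {m \<in> {i..<j}. \<omega> (\<tau> i) (\<tau> m) \<le> ?w / 2}" using fin by (intro Max_ge)
        then show False unfolding m_def[symmetric] by simp
      qed
      moreover have "\<omega> (\<tau> i) (\<tau> (Suc m)) + \<omega> (\<tau> (Suc m)) (\<tau> j) \<le> ?w"
        using m less.prems by (intro control_super[OF \<omega>]) (auto simp: in0T mono)
      ultimately show ?thesis by linarith
    qed
    have half: "K * w' powr \<theta> \<le> 2 powr (1 - \<theta>) * K * ?w powr \<theta> / 2" if "0 \<le> w'" "w' \<le> ?w / 2" for w'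
    proof -
      have "w' powr \<theta> \<le> (?w / 2) powr \<theta>" using that \<theta> by (intro powr_mono2) auto
      also have "\<dots> = 2 powr (1 - \<theta>) * ?w powr \<theta> / 2" using w by (simp add: powr_divide powr_diff)
      finally show ?thesis using K by (metis mult_left_mono mult.assoc mult.commute times_divide_eq_right)
    qed
    let ?S = "\<lambda>i j. \<Sum>k=i..<j. \<Xi> (\<tau> k) (\<tau> (Suc k))"
    have "?S i j = ?S i m + ?S m j" using m by (simp add: sum.atLeastLessThan_concat)
    also have "?S m j = \<Xi> (\<tau> m) (\<tau> (Suc m)) + ?S (Suc m) j" using m by (simp add: sum.atLeast_Suc_lessThan)
    finally have S: "?S i j = ?S i m + \<Xi> (\<tau> m) (\<tau> (Suc m)) + ?S (Suc m) j" by simp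
    have "\<bar>?S i m - \<Xi> (\<tau> i) (\<tau> m)\<bar> \<le> K * \<omega> (\<tau> i) (\<tau> m) powr \<theta>"
      unfolding K_def using m less.prems by (intro less.hyps) auto
    also have "\<dots> \<le> 2 powr (1 - \<theta>) * K * ?w powr \<theta> / 2"
      using m less.prems by (intro half control_nonneg[OF \<omega>]) (auto simp: in0T mono)
    finally have a1: "\<bar>?S i m - \<Xi> (\<tau> i) (\<tau> m)\<bar> \<le> 2 powr (1 - \<theta>) * K * ?w powr \<theta> / 2" .
    have "\<bar>?S (Suc m) j - \<Xi> (\<tau> (Suc m)) (\<tau> j)\<bar> \<le> K * \<omega> (\<tau> (Suc m)) (\<tau> j) powr \<theta>"
      unfolding K_def using m less.prems by (intro less.hyps) auto
    also have "\<dots> \<le> 2 powr (1 - \<theta>) * K * ?w powr \<theta> / 2"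
      using m w2 less.prems by (intro half control_nonneg[OF \<omega>]) (auto simp: in0T mono)
    finally have a2: "\<bar>?S (Suc m) j - \<Xi> (\<tau> (Suc m)) (\<tau> j)\<bar> \<le> 2 powr (1 - \<theta>) * K * ?w powr \<theta> / 2" .
    have a3: "\<bar>\<Xi> (\<tau> i) (\<tau> j) - \<Xi> (\<tau> i) (\<tau> m) - \<Xi> (\<tau> m) (\<tau> j)\<bar> \<le> C * ?w powr \<theta>"
      using m less.prems by (intro \<Xi>) (auto simp: in0T mono)
    have "\<bar>\<Xi> (\<tau> m) (\<tau> j) - \<Xi> (\<tau> m) (\<tau> (Suc m)) - \<Xi> (\<tau> (Suc m)) (\<tau> j)\<bar> \<le> C * \<omega> (\<tau> m) (\<tau> j) powr \<theta>"
      using m less.prems by (intro \<Xi>) (auto simp: in0T mono)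
    also have "\<dots> \<le> C * ?w powr \<theta>"
      using m less.prems C \<theta> by (intro mult_left_mono powr_mono2 control_nonneg[OF \<omega>] control_mono[OF \<omega>]) (auto simp: in0T mono)
    finally have a4: "\<bar>\<Xi> (\<tau> m) (\<tau> j) - \<Xi> (\<tau> m) (\<tau> (Suc m)) - \<Xi> (\<tau> (Suc m)) (\<tau> j)\<bar> \<le> C * ?w powr \<theta>" .
    have "K * ?w powr \<theta> = 2 powr (1 - \<theta>) * K * ?w powr \<theta> + 2 * (C * ?w powr \<theta>)"
      by (subst KC[symmetric]) (simp add: algebra_simps)
    then have "\<bar>?S i j - \<Xi> (\<tau> i) (\<tau> j)\<bar> \<le> K * ?w powr \<theta>"
      using a1 a2 a3 a4 unfolding S by linarith
    then show ?thesis by (simp add: K_def)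
  qed
qed

lemma mono_enumeration:
  fixes F :: "real set"
  assumes "finite F" "F \<noteq> {}"
  obtains n and \<tau> :: "nat \<Rightarrow> real" where "mono_on {..n} \<tau>" "\<tau> ` {..n} = F"
proof -
  let ?xs = "sorted_list_of_set F"
  have len: "length ?xs = card F" "0 < card F" using assms by (auto simp: card_gt_0_iff)
  have "mono_on {..card F - 1} ((!) ?xs)"
    using len by (intro mono_onI sorted_nth_mono) auto
  moreover have "(!) ?xs ` {..card F - 1} = F"
  proof -
    have "F = set ?xs" using assms by simp
    also have "\<dots> = (!) ?xs ` {..<length ?xs}" by (auto simp: in_set_conv_nth)
    also have "{..<length ?xs} = {..card F - 1}" using len by auto
    finally show ?thesis by simp
  qed
  ultimately show ?thesis using that by blast
qed

text \<open>
  On a finite set of times the Riemann sums along that set satisfy the required bounds, with a constant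
  that does not depend on the set. The bounds are closed conditions on a function with values in compact
  intervals, so by Tychonoff's theorem there is a function that satisfies all of them.
\<close>

lemma sewing:
  fixes \<Xi> :: "real \<Rightarrow> real \<Rightarrow> real"
  assumes \<omega>: "control T \<omega>" and \<theta>: "1 < \<theta>" and C: "0 \<le> C" and T: "0 < T"
    and \<Xi>: "\<And>s u t. 0 \<le> s \<Longrightarrow> s \<le> u \<Longrightarrow> u \<le> t \<Longrightarrow> t \<le> T \<Longrightarrow>
       \<bar>\<Xi> s t - \<Xi> s u - \<Xi> u t\<bar> \<le> C * \<omega> s t powr \<theta>"
  obtains k K where "\<And>s t. 0 \<le> s \<Longrightarrow> s \<le> t \<Longrightarrow> t \<le> T \<Longrightarrow> \<bar>k t - k s - \<Xi> s t\<bar> \<le> K * \<omega> s t powr \<theta>"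
proof -
  define K where "K = 2 * C / (1 - 2 powr (1 - \<theta>))"
  define R where "R t = \<bar>\<Xi> 0 t\<bar> + K * \<omega> 0 t powr \<theta>" for t
  define Q where "Q = (\<lambda>(s, t). {k :: real \<Rightarrow> real. \<bar>k t - k s - \<Xi> s t\<bar> \<le> K * \<omega> s t powr \<theta>})"
  define I where "I = {(s, t). 0 \<le> s \<and> s \<le> t \<and> t \<le> T}"
  define B where "B = PiE UNIV (\<lambda>t. if t \<in> {0..T} then {- R t..R t} else {0::real})"
  have "compactin (product_topology (\<lambda>_. euclidean) UNIV) B"
    unfolding B_def by (subst compactin_PiE) auto
  then have cB: "compact B" by (simp add: euclidean_product_topology)
  have cQ: "closed (Q x)" for x
    unfolding Q_def by (cases x) (auto intro!: closed_Collect_le continuous_intros continuous_on_product_coordinates)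
  have fip: "B \<inter> \<Inter> (Q ` J) \<noteq> {}" if J: "finite J" "J \<subseteq> I" for J
  proof -
    define F where "F = insert 0 (fst ` J \<union> snd ` J)"
    have F: "finite F" "F \<noteq> {}" "0 \<in> F" "F \<subseteq> {0..T}" using J T by (auto simp: F_def I_def)
    obtain n and \<tau> :: "nat \<Rightarrow> real" where \<tau>: "mono_on {..n} \<tau>" "\<tau> ` {..n} = F"
      by (rule mono_enumeration[OF F(1,2)])
    define idx where "idx t = (SOME i. i \<le> n \<and> \<tau> i = t)" for t
    have idx: "idx t \<le> n" "\<tau> (idx t) = t" if "t \<in> F" for t
      using someI_ex[of "\<lambda>i. i \<le> n \<and> \<tau> i = t"] that \<tau>(2) unfolding idx_def by auto
    define S where "S i j = (\<Sum>k=i..<j. \<Xi> (\<tau> k) (\<tau> (Suc k)))" for i j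
    have S: "\<bar>S i j - \<Xi> (\<tau> i) (\<tau> j)\<bar> \<le> K * \<omega> (\<tau> i) (\<tau> j) powr \<theta>" if "i \<le> j" "j \<le> n" for i j
      unfolding S_def K_def by (rule sewing_estimate[OF \<omega> \<theta> C \<Xi> \<tau>(1)]) (use \<tau> F that in auto)
    define k where "k t = (if t \<in> F then S 0 (idx t) - S 0 (idx 0) else 0)" for t
    have kk: "\<bar>k t - k s - \<Xi> s t\<bar> \<le> K * \<omega> s t powr \<theta>" if st: "s \<in> F" "t \<in> F" "s \<le> t" for s t
    proof (cases "s = t")
      case True
      have "\<omega> t t = 0" using control_zero[OF \<omega>] F st by auto
      moreover from this have "\<bar>\<Xi> t t\<bar> \<le> 0" using \<Xi>[of t t t] F st by auto
      ultimately show ?thesis using True by simp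
    next
      case False
      have "idx s \<le> idx t"
      proof (rule ccontr)
        assume "\<not> idx s \<le> idx t"
        then have "\<tau> (idx t) \<le> \<tau> (idx s)"
          using mono_onD[OF \<tau>(1), of "idx t" "idx s"] idx(1)[OF st(1)] idx(1)[OF st(2)] by simp
        then show False using idx(2)[OF st(1)] idx(2)[OF st(2)] st(3) False by simp
      qed
      then have "S 0 (idx t) = S 0 (idx s) + S (idx s) (idx t)"
        unfolding S_def by (simp add: sum.atLeastLessThan_concat)
      then show ?thesis using S[of "idx s" "idx t"] \<open>idx s \<le> idx t\<close> idx st by (simp add: k_def)
    qed
    have k0: "k 0 = 0" by (simp add: k_def)
    have K0: "0 \<le> K" using C \<theta> powr_less_mono[of "1 - \<theta>" 0 2] by (simp add: K_def)
    have "k \<in> B"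
      unfolding B_def
    proof (rule PiE_I)
      fix t :: real
      show "k t \<in> (if t \<in> {0..T} then {- R t..R t} else {0})"
      proof (cases "t \<in> F")
        case True
        then have "\<bar>k t\<bar> \<le> R t" using kk[of 0 t] F k0 by (auto simp: R_def)
        then show ?thesis using True F by auto
      next
        case False
        have "0 \<le> R t" using K0 by (simp add: R_def)
        then show ?thesis using False by (simp add: k_def)
      qed
    qed simp
    moreover have "k \<in> \<Inter> (Q ` J)"
    proof (rule INT_I)
      fix x assume x: "x \<in> J"
      obtain s t where st: "x = (s, t)" by (cases x)
      have "s \<in> F" "t \<in> F" using x st by (force simp: F_def)+
      moreover have "s \<le> t" using J(2) x st by (auto simp: I_def)
      ultimately show "k \<in> Q x" using kk[of s t] by (simp add: Q_def st)
    qed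
    ultimately show ?thesis by blast
  qed
  have "B \<inter> \<Inter> (Q ` I) \<noteq> {}" by (rule compact_imp_fip_image[OF cB cQ fip])
  then obtain k where "k \<in> \<Inter> (Q ` I)" by blast
  then have "\<bar>k t - k s - \<Xi> s t\<bar> \<le> K * \<omega> s t powr \<theta>" if "0 \<le> s" "s \<le> t" "t \<le> T" for s t
  proof -
    have "(s, t) \<in> I" using that by (simp add: I_def)
    then have "k \<in> Q (s, t)" using \<open>k \<in> \<Inter> (Q ` I)\<close> by blast
    then show ?thesis by (simp add: Q_def)
  qed
  then show ?thesis using that by blast
qed

section \<open>Homogeneous bounds\<close>

lemma powr_inverse_power:
  fixes x :: real
  assumes "0 \<le> x" "0 < d"
  shows "(x powr (1 / real d)) ^ d = x"
proof (cases "x = 0")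
  case False
  then have "(x powr (1 / real d)) ^ d = (x powr (1 / real d)) powr real d"
    using assms by (simp add: powr_realpow)
  then show ?thesis using assms False by (simp add: powr_powr)
qed (use assms in simp)

lemma powr_inverse_le_iff:
  fixes x r :: real
  assumes "0 \<le> x" "0 \<le> r" "0 < d"
  shows "x powr (1 / real d) \<le> r \<longleftrightarrow> x \<le> r ^ d"
proof -
  have "x powr (1 / real d) \<le> r \<longleftrightarrow> (x powr (1 / real d)) ^ d \<le> r ^ d"
    using assms by (simp add: power_mono_iff)
  then show ?thesis using assms by (simp add: powr_inverse_power)
qed

lemma power_powr_inverse:
  fixes w C :: real
  assumes "0 \<le> w" "0 < p" "0 < d"
  shows "(C * w powr (1 / p)) ^ d = C ^ d * w powr (real d / p)"
proof (cases "w = 0")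
  case False
  then have "(w powr (1 / p)) ^ d = (w powr (1 / p)) powr real d"
    using assms by (simp add: powr_realpow)
  then show ?thesis using assms False by (simp add: powr_powr power_mult_distrib)
qed (use assms in simp)

lemma forests_nonempty: "1 \<le> N \<Longrightarrow> forests N \<noteq> {}"
proof -
  assume "1 \<le> N"
  then have "{#Node undefined {#}#} \<in> forests N" by (simp add: forests_def)
  then show ?thesis by blast
qed

lemma in_forests: "\<rho> \<in> forests N \<longleftrightarrow> \<rho> \<noteq> {#} \<and> forest_degree \<rho> \<le> N"
  by (auto simp: forests_def Suc_le_eq simp flip: forest_degree_eq_0)

lemma forest_degree_pos: "\<rho> \<in> forests N \<Longrightarrow> 0 < forest_degree \<rho>"
  by (simp add: forests_def)

lemma CK_norm_ge:
  fixes a :: "'l::finite forest \<Rightarrow> real"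
  assumes "\<rho> \<in> forests N"
  shows "\<bar>a \<rho>\<bar> powr (1 / real (forest_degree \<rho>)) \<le> CK_norm N a"
  unfolding CK_norm_def using assms finite_forests by (intro Max_ge) auto

lemma CK_norm_nonneg:
  fixes a :: "'l::finite forest \<Rightarrow> real"
  assumes "1 \<le> N"
  shows "0 \<le> CK_norm N a"
proof -
  obtain \<rho> :: "'l forest" where "\<rho> \<in> forests N" using forests_nonempty[OF assms] by blast
  then show ?thesis using CK_norm_ge[of \<rho> N a] by (meson order_trans powr_ge_zero)
qed

lemma abs_le_CK_norm:
  fixes a :: "'l::finite forest \<Rightarrow> real"
  assumes "\<rho> \<in> forests N"
  shows "\<bar>a \<rho>\<bar> \<le> CK_norm N a ^ forest_degree \<rho>"
proof -
  have "1 \<le> N" using assms by (auto simp: forests_def)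
  then show ?thesis
    using CK_norm_ge[OF assms, of a] powr_inverse_le_iff[of "\<bar>a \<rho>\<bar>" "CK_norm N a" "forest_degree \<rho>"]
      CK_norm_nonneg[of N a] forest_degree_pos[OF assms] by simp
qed

lemma CK_norm_le:
  fixes a :: "'l::finite forest \<Rightarrow> real"
  assumes "1 \<le> N" "0 \<le> r" "\<And>\<rho>. \<rho> \<in> forests N \<Longrightarrow> \<bar>a \<rho>\<bar> \<le> r ^ forest_degree \<rho>"
  shows "CK_norm N a \<le> r"
  unfolding CK_norm_def using assms finite_forests[of N] forests_nonempty[of N]
  by (subst Max_le_iff) (auto simp: powr_inverse_le_iff forest_degree_pos)

lemma CK_norm_attained:
  fixes a :: "'l::finite forest \<Rightarrow> real"
  assumes "1 \<le> N"
  shows "\<exists>\<rho>\<in>forests N. CK_norm N a = \<bar>a \<rho>\<bar> powr (1 / real (forest_degree \<rho>))"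
proof -
  have "CK_norm N a \<in> (\<lambda>\<rho>. \<bar>a \<rho>\<bar> powr (1 / real (forest_degree \<rho>))) ` forests N"
    unfolding CK_norm_def using finite_forests forests_nonempty[OF assms] by (intro Max_in) auto
  then show ?thesis by auto
qed

lemma CK_forest_bound:
  assumes a: "a \<in> carrier (CK_group N)" and r: "0 \<le> r"
    and t: "\<And>t. tree_degree t \<le> N \<Longrightarrow> \<bar>a {#t#}\<bar> \<le> r ^ tree_degree t"
    and "forest_degree \<rho> \<le> N"
  shows "\<bar>a \<rho>\<bar> \<le> r ^ forest_degree \<rho>"
  using assms(4)
proof (induction \<rho>)
  case empty
  then show ?case using CK_carrierD(1)[OF a] by simp
next
  case (add s \<rho>)
  have "a ({#s#} + \<rho>) = a {#s#} * a \<rho>" using add.prems by (intro CK_carrierD(3)[OF a]) simp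
  moreover have "\<bar>a {#s#}\<bar> * \<bar>a \<rho>\<bar> \<le> r ^ tree_degree s * r ^ forest_degree \<rho>"
    using add r t[of s] by (intro mult_mono) auto
  ultimately show ?case by (simp add: abs_mult power_add)
qed

definition coproduct_size :: "'l forest \<Rightarrow> real" where
  "coproduct_size \<rho> = (\<Sum>z\<in>Poly_Mapping.keys (CK_coproduct \<rho>). \<bar>Poly_Mapping.lookup (CK_coproduct \<rho>) z\<bar>)"

lemma coproduct_size_nonneg: "0 \<le> coproduct_size \<rho>"
  by (simp add: coproduct_size_def sum_nonneg)

lemma reduced_sum_bound:
  assumes B: "0 \<le> B"
    and g: "\<And>x y. x \<noteq> {#} \<Longrightarrow> y \<noteq> {#} \<Longrightarrow> forest_degree x + forest_degree y = forest_degree \<rho> \<Longrightarrow> \<bar>g x y\<bar> \<le> B"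
  shows "\<bar>reduced_sum g \<rho>\<bar> \<le> coproduct_size \<rho> * B"
proof -
  \<comment> \<open>Setting the immaterial values to zero makes the bound valid for all arguments.\<close>
  define h where "h x y = (if x = {#} \<or> y = {#} \<or> forest_degree x + forest_degree y \<noteq> forest_degree \<rho> then 0 else g x y)" for x y
  have hB: "\<bar>h x y\<bar> \<le> B" for x y using B g by (auto simp: h_def)
  have "reduced_sum g \<rho> = coproduct_sum h \<rho>"
    unfolding reduced_sum_def by (rule coproduct_sum_cong) (simp add: h_def)
  also have "\<bar>\<dots>\<bar> \<le> (\<Sum>z\<in>Poly_Mapping.keys (CK_coproduct \<rho>).
      \<bar>Poly_Mapping.lookup (CK_coproduct \<rho>) z * (case z of (x, y) \<Rightarrow> h x y)\<bar>)"
    unfolding coproduct_sum_def lin_eval_def by (rule sum_abs)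
  also have "\<dots> \<le> (\<Sum>z\<in>Poly_Mapping.keys (CK_coproduct \<rho>). \<bar>Poly_Mapping.lookup (CK_coproduct \<rho>) z\<bar> * B)"
    by (rule sum_mono) (auto simp: abs_mult intro!: mult_left_mono hB)
  finally show ?thesis by (simp add: coproduct_size_def sum_distrib_right)
qed

lemma tendsto_reduced_sum:
  assumes "\<And>x y. x \<noteq> {#} \<Longrightarrow> y \<noteq> {#} \<Longrightarrow> forest_degree x + forest_degree y = forest_degree \<rho> \<Longrightarrow>
    ((\<lambda>t. g t x y) \<longlongrightarrow> l x y) F"
  shows "((\<lambda>t. reduced_sum (g t) \<rho>) \<longlongrightarrow> reduced_sum l \<rho>) F"
proof -
  define c where "c h x y = (if x = {#} \<or> y = {#} \<or> forest_degree x + forest_degree y \<noteq> forest_degree \<rho> then 0 else h x y)"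
    for h :: "'a forest \<Rightarrow> 'a forest \<Rightarrow> real" and x y
  have r: "reduced_sum h \<rho> = coproduct_sum (c h) \<rho>" for h
    unfolding reduced_sum_def by (rule coproduct_sum_cong) (simp add: c_def)
  have "((\<lambda>t. c (g t) x y) \<longlongrightarrow> c l x y) F" for x y
    using assms[of x y] by (cases "x = {#} \<or> y = {#} \<or> forest_degree x + forest_degree y \<noteq> forest_degree \<rho>")
      (simp_all add: c_def)
  then show ?thesis
    unfolding r coproduct_sum_def lin_eval_def by (intro tendsto_intros) (auto simp: case_prod_beta)
qed

section \<open>Paths in the group of characters\<close>

lemma CK_product_continuous:
  fixes A B :: "'b::topological_space \<Rightarrow> 'l forest \<Rightarrow> real"
  assumes cA: "\<And>\<rho>. continuous_on S (\<lambda>t. A t \<rho>)" and cB: "\<And>\<rho>. continuous_on S (\<lambda>t. B t \<rho>)"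
  shows "continuous_on S (\<lambda>t. (A t \<otimes>\<^bsub>CK_group N\<^esub> B t) \<rho>)"
proof (cases "forest_degree \<rho> \<le> N")
  case True
  have "(A t \<otimes>\<^bsub>CK_group N\<^esub> B t) \<rho> = (\<Sum>z\<in>Poly_Mapping.keys (CK_coproduct \<rho>).
      Poly_Mapping.lookup (CK_coproduct \<rho>) z * (A t (fst z) * B t (snd z)))" for t
    using True by (simp add: CK_mult CK_product_def case_prod_beta)
  then show ?thesis
    by (auto intro!: continuous_on_sum continuous_on_mult continuous_on_const cA cB)
next
  case False
  then show ?thesis by (simp add: CK_mult truncate_def)
qed

text \<open>
  By induction on the degree, since \<open>a a\<^sup>-\<^sup>1 = 1\<close> expresses each coefficient of \<open>a\<^sup>-\<^sup>1\<close> by those of \<open>a\<close> and by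
  coefficients of \<open>a\<^sup>-\<^sup>1\<close> of smaller degree.
\<close>

lemma CK_inverse_continuous:
  fixes A :: "'b::topological_space \<Rightarrow> 'l forest \<Rightarrow> real"
  assumes A: "\<And>t. t \<in> S \<Longrightarrow> A t \<in> carrier (CK_group N)" and cA: "\<And>\<rho>. continuous_on S (\<lambda>t. A t \<rho>)"
  shows "continuous_on S (\<lambda>t. (inv\<^bsub>CK_group N\<^esub> A t) \<rho>)"
proof (induction \<rho> rule: measure_induct_rule[of forest_degree])
  case (less \<rho>)
  let ?G = "CK_group N :: ('l forest \<Rightarrow> real) monoid"
  interpret group ?G by (rule group_CK_group)
  have inv: "inv\<^bsub>?G\<^esub> A t \<in> carrier ?G" if "t \<in> S" for t using A that by simp
  show ?case
  proof (cases "\<rho> = {#} \<or> N < forest_degree \<rho>")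
    case True
    then have "(inv\<^bsub>?G\<^esub> A t) \<rho> = (if \<rho> = {#} then 1 else 0)" if "t \<in> S" for t
      using CK_carrierD[OF inv[OF that]] by auto
    then show ?thesis by (simp cong: continuous_on_cong)
  next
    case False
    then have \<rho>: "\<rho> \<noteq> {#}" "forest_degree \<rho> \<le> N" by auto
    have eq: "(inv\<^bsub>?G\<^esub> A t) \<rho> = - A t \<rho> - reduced_sum (\<lambda>x y. A t x * (inv\<^bsub>?G\<^esub> A t) y) \<rho>" if "t \<in> S" for t
      using CK_mult_expand[OF A[OF that] inv[OF that] \<rho>] r_inv[OF A[OF that]] \<rho>
      by (simp add: CK_one unit_series_def)
    have "continuous_on S (\<lambda>t. - A t \<rho> - reduced_sum (\<lambda>x y. A t x * (inv\<^bsub>?G\<^esub> A t) y) \<rho>)"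
      unfolding continuous_on_def
    proof
      fix s assume "s \<in> S"
      have "((\<lambda>t. reduced_sum (\<lambda>x y. A t x * (inv\<^bsub>?G\<^esub> A t) y) \<rho>) \<longlongrightarrow>
          reduced_sum (\<lambda>x y. A s x * (inv\<^bsub>?G\<^esub> A s) y) \<rho>) (at s within S)"
      proof (rule tendsto_reduced_sum)
        fix x y :: "'l forest" assume "x \<noteq> {#}" and d: "forest_degree x + forest_degree y = forest_degree \<rho>"
        then have "forest_degree x \<noteq> 0" by (auto simp only: forest_degree_eq_0)
        then have "forest_degree y < forest_degree \<rho>" using d by linarith
        then show "((\<lambda>t. A t x * (inv\<^bsub>?G\<^esub> A t) y) \<longlongrightarrow> A s x * (inv\<^bsub>?G\<^esub> A s) y) (at s within S)"
          using less[of y] cA \<open>s \<in> S\<close> unfolding continuous_on_def by (intro tendsto_mult) auto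
      qed
      then show "((\<lambda>t. - A t \<rho> - reduced_sum (\<lambda>x y. A t x * (inv\<^bsub>?G\<^esub> A t) y) \<rho>) \<longlongrightarrow>
          - A s \<rho> - reduced_sum (\<lambda>x y. A s x * (inv\<^bsub>?G\<^esub> A s) y) \<rho>) (at s within S)"
        using cA \<open>s \<in> S\<close> unfolding continuous_on_def by (intro tendsto_intros) auto
    qed
    then show ?thesis by (simp add: eq cong: continuous_on_cong)
  qed
qed

lemma continuous_on_coordinates:
  fixes X :: "'b::topological_space \<Rightarrow> 'c \<Rightarrow> real"
  shows "continuous_on S X \<longleftrightarrow> (\<forall>i. continuous_on S (\<lambda>t. X t i))"
  by (auto intro: continuous_on_coordinatewise_then_product continuous_on_product_then_coordinatewise)

lemma increment_carrier:
  assumes "X s \<in> carrier (CK_group N)" "X t \<in> carrier (CK_group N)"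
  shows "increment (CK_group N) X s t \<in> carrier (CK_group N)"
proof -
  interpret group "CK_group N :: ('a forest \<Rightarrow> real) monoid" by (rule group_CK_group)
  show ?thesis using assms by (simp add: increment_def)
qed

lemma increment_trans:
  assumes "X s \<in> carrier (CK_group N)" "X u \<in> carrier (CK_group N)" "X t \<in> carrier (CK_group N)"
  shows "increment (CK_group N) X s t = increment (CK_group N) X s u \<otimes>\<^bsub>CK_group N\<^esub> increment (CK_group N) X u t"
proof -
  interpret group "CK_group N :: ('a forest \<Rightarrow> real) monoid" by (rule group_CK_group)
  have "X u \<otimes>\<^bsub>CK_group N\<^esub> (inv\<^bsub>CK_group N\<^esub> X u \<otimes>\<^bsub>CK_group N\<^esub> X t) = X t"
    using assms by (simp add: m_assoc[symmetric])
  then show ?thesis using assms by (simp add: increment_def m_assoc)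
qed

lemma increment_append:
  assumes "X s \<in> carrier (CK_group N)" "X t \<in> carrier (CK_group N)"
  shows "X t = X s \<otimes>\<^bsub>CK_group N\<^esub> increment (CK_group N) X s t"
proof -
  interpret group "CK_group N :: ('a forest \<Rightarrow> real) monoid" by (rule group_CK_group)
  show ?thesis using assms by (simp add: increment_def m_assoc[symmetric])
qed

lemma increment_refl:
  assumes "X s \<in> carrier (CK_group N)"
  shows "increment (CK_group N) X s s = unit_series"
proof -
  interpret group "CK_group N :: ('a forest \<Rightarrow> real) monoid" by (rule group_CK_group)
  show ?thesis using assms by (simp add: increment_def CK_one)
qed

lemma increment_left_mult:
  assumes "g \<in> carrier (CK_group N)" "X s \<in> carrier (CK_group N)" "X t \<in> carrier (CK_group N)"
  shows "increment (CK_group N) (\<lambda>t. g \<otimes>\<^bsub>CK_group N\<^esub> X t) s t = increment (CK_group N) X s t"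
proof -
  interpret group "CK_group N :: ('a forest \<Rightarrow> real) monoid" by (rule group_CK_group)
  have "inv\<^bsub>CK_group N\<^esub> g \<otimes>\<^bsub>CK_group N\<^esub> (g \<otimes>\<^bsub>CK_group N\<^esub> X t) = X t"
    using assms by (simp add: m_assoc[symmetric])
  then show ?thesis using assms by (simp add: increment_def inv_mult_group m_assoc)
qed

lemma truncate_inv:
  assumes "m \<le> N" "a \<in> carrier (CK_group N)"
  shows "truncate m (inv\<^bsub>CK_group N\<^esub> a) = inv\<^bsub>CK_group m\<^esub> (truncate m a)"
proof -
  have "truncate m \<in> hom (CK_group N) (CK_group m :: ('a forest \<Rightarrow> real) monoid)"
    using assms(1) by (intro homI) (auto simp: truncate_carrier CK_mult_truncate_lower)
  then have "group_hom (CK_group N) (CK_group m :: ('a forest \<Rightarrow> real) monoid) (truncate m)"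
    by (intro group_hom.intro group_hom_axioms.intro group_CK_group)
  then show ?thesis using assms(2) by (simp add: group_hom.hom_inv)
qed

lemma truncate_increment:
  assumes "m \<le> N" "X s \<in> carrier (CK_group N)" "X t \<in> carrier (CK_group N)"
  shows "truncate m (increment (CK_group N) X s t) = increment (CK_group m) (\<lambda>t. truncate m (X t)) s t"
  using assms by (simp add: increment_def CK_mult_truncate_lower truncate_inv)

text \<open>
  By multiplicativity a bound of this form on trees holds with the same constant for forests, and hence
  for the homogeneous norm; this is why \<open>C\<close> is inside the power.
\<close>

definition homogeneously_bounded ::
    "nat \<Rightarrow> real \<Rightarrow> real \<Rightarrow> (real \<Rightarrow> real \<Rightarrow> real) \<Rightarrow> real \<Rightarrow> (real \<Rightarrow> 'l forest \<Rightarrow> real) \<Rightarrow> bool" where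
  "homogeneously_bounded N p T \<omega> C X \<longleftrightarrow>
     (\<forall>t. 0 \<le> t \<longrightarrow> t \<le> T \<longrightarrow> X t \<in> carrier (CK_group N)) \<and>
     (\<forall>s t \<tau>. 0 \<le> s \<longrightarrow> s \<le> t \<longrightarrow> t \<le> T \<longrightarrow> tree_degree \<tau> \<le> N \<longrightarrow>
        \<bar>increment (CK_group N) X s t {#\<tau>#}\<bar> \<le> (C * \<omega> s t powr (1 / p)) ^ tree_degree \<tau>)"

lemma homogeneously_bounded_forest:
  assumes X: "homogeneously_bounded N p T \<omega> C X" and C: "0 \<le> C"
    and st: "0 \<le> s" "s \<le> t" "t \<le> T" and \<rho>: "forest_degree \<rho> \<le> N"
  shows "\<bar>increment (CK_group N) X s t \<rho>\<bar> \<le> (C * \<omega> s t powr (1 / p)) ^ forest_degree \<rho>"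
  using X st C by (intro CK_forest_bound[OF _ _ _ \<rho>] increment_carrier) (auto simp: homogeneously_bounded_def)

text \<open>
  The \<open>p\<close>-th power of the norm is comparable to the sum of \<open>|(X\<^sub>s\<^sub>,\<^sub>t, \<rho>)|\<close> to the power \<open>p / |\<rho>|\<close> over all \<open>\<rho>\<close>,
  which depends continuously on both times.
\<close>

lemma p_variation_path_control:
  fixes X :: "real \<Rightarrow> 'l::finite forest \<Rightarrow> real"
  assumes X: "p_variation_path (CK_group N) (CK_norm N) p T X"
    and N: "1 \<le> N" and p: "0 < p" and T: "0 < T"
  obtains \<omega> where "control T \<omega>" "homogeneously_bounded N p T \<omega> 1 X"
proof -
  let ?I = "increment (CK_group N) X"
  have Xc: "X t \<in> carrier (CK_group N)" if "0 \<le> t" "t \<le> T" for t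
    using X that by (auto simp: p_variation_path_def)
  have cX: "continuous_on {0..T} (\<lambda>t. X t \<rho>)" for \<rho>
    using X by (simp add: p_variation_path_def continuous_on_coordinates)
  define f where "f s t = (\<Sum>\<rho>\<in>forests N. \<bar>?I s t \<rho>\<bar> powr (p / real (forest_degree \<rho>)))" for s t
  have rpow: "\<bar>a\<bar> powr (p / real d) = (\<bar>a\<bar> powr (1 / real d)) powr p" for a d
    by (simp add: powr_powr)
  have pos: "0 < p / real (forest_degree \<rho>)" if "\<rho> \<in> forests N" for \<rho> :: "'l forest"
    using p forest_degree_pos[OF that] by simp
  interpret group "CK_group N :: ('l forest \<Rightarrow> real) monoid" by (rule group_CK_group)
  have c1: "continuous_on {0..T} (\<lambda>u. ?I u b \<rho>)" if "0 \<le> b" "b \<le> T" for b \<rho>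
    unfolding increment_def using that Xc cX
    by (intro CK_product_continuous CK_inverse_continuous) auto
  have c2: "continuous_on {0..T} (\<lambda>u. ?I a u \<rho>)" if "0 \<le> a" "a \<le> T" for a \<rho>
    unfolding increment_def using that Xc cX
    by (intro CK_product_continuous) auto
  have f1: "continuous_on {0..T} (\<lambda>u. f u b)" if "0 \<le> b" "b \<le> T" for b
    unfolding f_def using pos
    by (intro continuous_on_sum continuous_on_powr' continuous_intros c1[OF that]) (auto simp: forests_def)
  have f2: "continuous_on {0..T} (\<lambda>u. f a u)" if "0 \<le> a" "a \<le> T" for a
    unfolding f_def using pos
    by (intro continuous_on_sum continuous_on_powr' continuous_intros c2[OF that]) (auto simp: forests_def)
  obtain \<omega> where \<omega>: "control T \<omega>" and le: "\<And>s t. 0 \<le> s \<Longrightarrow> s \<le> t \<Longrightarrow> t \<le> T \<Longrightarrow> f s t \<le> \<omega> s t"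
  proof (rule control_exists[OF T, where f = f])
    fix s t show "0 \<le> f s t" by (simp add: f_def sum_nonneg)
  next
    fix s assume "0 \<le> s" "s \<le> T"
    then have "?I s s \<rho> = 0" if "\<rho> \<in> forests N" for \<rho>
      using that Xc by (simp add: increment_refl unit_series_def in_forests)
    then show "f s s = 0" by (simp add: f_def)
  next
    fix s b assume s: "0 \<le> s" "s < b" "b \<le> T"
    then have "continuous_on {s..T} (\<lambda>u. f u b)" using f1[of b] by (auto intro: continuous_on_subset)
    then have "((\<lambda>u. f u b) \<longlongrightarrow> f s b) (at s within {s..T})"
      using s unfolding continuous_on_def by simp
    then show "((\<lambda>u. f u b) \<longlongrightarrow> f s b) (at_right s)"
      using s at_within_Icc_at_right[of s T] by simp
  next
    fix a t assume s: "0 \<le> a" "a < t" "t \<le> T"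
    then have "continuous_on {0..t} (\<lambda>u. f a u)" using f2[of a] by (auto intro: continuous_on_subset)
    then have "((\<lambda>u. f a u) \<longlongrightarrow> f a t) (at t within {0..t})"
      using s unfolding continuous_on_def by simp
    then show "((\<lambda>u. f a u) \<longlongrightarrow> f a t) (at_left t)"
      using s at_within_Icc_at_left[of 0 t] by simp
  next
    have fle: "f s t \<le> real (card (forests N :: 'l forest set)) * CK_norm N (?I s t) powr p" for s t
    proof -
      have "f s t \<le> (\<Sum>\<rho>\<in>(forests N :: 'l forest set). CK_norm N (?I s t) powr p)"
        unfolding f_def rpow using p by (intro sum_mono powr_mono2) (auto intro: CK_norm_ge)
      then show ?thesis by simp
    qed
    obtain B where B: "\<And>n \<tau>. 1 \<le> n \<Longrightarrow> \<tau> 0 = 0 \<Longrightarrow> \<tau> n = T \<Longrightarrow> (\<forall>i<n. \<tau> i < \<tau> (Suc i)) \<Longrightarrow>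
        (\<Sum>i<n. CK_norm N (?I (\<tau> i) (\<tau> (Suc i))) powr p) \<le> B"
      using X unfolding p_variation_path_def finite_p_variation_def bdd_above_def by blast
    show "bdd_above {(\<Sum>i<n. f (\<tau> i) (\<tau> (Suc i))) | n \<tau>.
       1 \<le> n \<and> \<tau> 0 = 0 \<and> \<tau> n = T \<and> (\<forall>i<n. \<tau> i < \<tau> (Suc i))}"
    proof (rule bdd_aboveI)
      fix x assume "x \<in> {(\<Sum>i<n. f (\<tau> i) (\<tau> (Suc i))) | n \<tau>.
       1 \<le> n \<and> \<tau> 0 = 0 \<and> \<tau> n = T \<and> (\<forall>i<n. \<tau> i < \<tau> (Suc i))}"
      then obtain n \<tau> where x: "x = (\<Sum>i<n. f (\<tau> i) (\<tau> (Suc i)))"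
        and n: "1 \<le> n" "\<tau> 0 = 0" "\<tau> n = T" "\<forall>i<n. \<tau> i < \<tau> (Suc i)" by blast
      have "x \<le> (\<Sum>i<n. real (card (forests N :: 'l forest set)) * CK_norm N (?I (\<tau> i) (\<tau> (Suc i))) powr p)"
        unfolding x by (intro sum_mono fle)
      also have "\<dots> = real (card (forests N :: 'l forest set)) * (\<Sum>i<n. CK_norm N (?I (\<tau> i) (\<tau> (Suc i))) powr p)"
        by (simp add: sum_distrib_left)
      also have "\<dots> \<le> real (card (forests N :: 'l forest set)) * B"
        using B[OF n] by (intro mult_left_mono) auto
      finally show "x \<le> real (card (forests N :: 'l forest set)) * B" .
    qed
  qed (rule that)
  have "\<bar>?I s t {#\<tau>#}\<bar> \<le> (1 * \<omega> s t powr (1 / p)) ^ tree_degree \<tau>"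
    if st: "0 \<le> s" "s \<le> t" "t \<le> T" and \<tau>: "tree_degree \<tau> \<le> N" for s t \<tau>
  proof -
    have d: "0 < tree_degree \<tau>" by (rule tree_degree_pos)
    have "{#\<tau>#} \<in> forests N" using \<tau> by (simp add: in_forests)
    then have "\<bar>?I s t {#\<tau>#}\<bar> powr (p / real (forest_degree {#\<tau>#})) \<le> f s t"
      unfolding f_def by (intro member_le_sum) (auto simp: finite_forests)
    then have "\<bar>?I s t {#\<tau>#}\<bar> powr (p / real (tree_degree \<tau>)) \<le> \<omega> s t" using le[OF st] by simp
    then have "(\<bar>?I s t {#\<tau>#}\<bar> powr (p / real (tree_degree \<tau>))) powr (real (tree_degree \<tau>) / p) \<le>
        \<omega> s t powr (real (tree_degree \<tau>) / p)"
      using p by (intro powr_mono2) auto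
    then have "\<bar>?I s t {#\<tau>#}\<bar> \<le> \<omega> s t powr (real (tree_degree \<tau>) / p)"
      using p d by (simp add: powr_powr)
    then show ?thesis
      using power_powr_inverse[of "\<omega> s t" p "tree_degree \<tau>" 1] control_nonneg[OF \<omega> st] p d by simp
  qed
  then have "homogeneously_bounded N p T \<omega> 1 X" using Xc by (auto simp: homogeneously_bounded_def)
  then show ?thesis using that \<omega> by blast
qed

lemma control_tendsto:
  assumes \<omega>: "control T \<omega>" and x: "0 \<le> x" "x \<le> T"
  shows "((\<lambda>t. \<omega> x t) \<longlongrightarrow> 0) (at x within {x..T})" "((\<lambda>t. \<omega> t x) \<longlongrightarrow> 0) (at x within {0..x})"
proof -
  show "((\<lambda>t. \<omega> x t) \<longlongrightarrow> 0) (at x within {x..T})"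
  proof (rule tendstoI)
    fix e :: real assume "0 < e"
    obtain d where d: "0 < d" "\<And>t. x \<le> t \<Longrightarrow> t \<le> T \<Longrightarrow> t < x + d \<Longrightarrow> \<omega> x t < e"
      using control_small[OF \<omega> x \<open>0 < e\<close>] by metis
    have "dist (\<omega> x t) 0 < e" if "t \<in> {x..T}" "dist t x < d" for t
      using d(2)[of t] that control_nonneg[OF \<omega>, of x t] x by (auto simp: dist_real_def)
    then show "\<forall>\<^sub>F t in at x within {x..T}. dist (\<omega> x t) 0 < e"
      unfolding eventually_at using d(1) by blast
  qed
  show "((\<lambda>t. \<omega> t x) \<longlongrightarrow> 0) (at x within {0..x})"
  proof (rule tendstoI)
    fix e :: real assume "0 < e"
    obtain d where d: "0 < d" "\<And>s. 0 \<le> s \<Longrightarrow> s \<le> x \<Longrightarrow> x - d < s \<Longrightarrow> \<omega> s x < e"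
      using control_small[OF \<omega> x \<open>0 < e\<close>] by metis
    have "dist (\<omega> t x) 0 < e" if "t \<in> {0..x}" "dist t x < d" for t
      using d(2)[of t] that control_nonneg[OF \<omega>, of t x] x by (auto simp: dist_real_def)
    then show "\<forall>\<^sub>F t in at x within {0..x}. dist (\<omega> t x) 0 < e"
      unfolding eventually_at using d(1) by blast
  qed
qed

text \<open>
  By induction on the degree: in \<open>X\<^sub>t = X\<^sub>x X\<^sub>x\<^sub>,\<^sub>t\<close> for \<open>t \<ge> x\<close> and in \<open>X\<^sub>x = X\<^sub>t X\<^sub>t\<^sub>,\<^sub>x\<close> for \<open>t \<le> x\<close> the increments tend
  to the unit, and the other factors of the mixed terms have smaller degree.
\<close>

lemma homogeneously_bounded_continuous:
  assumes X: "homogeneously_bounded N p T \<omega> C X" and C: "0 \<le> C" and \<omega>: "control T \<omega>" and p: "0 < p"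
  shows "continuous_on {0..T} (\<lambda>t. X t \<rho>)"
proof (induction \<rho> rule: measure_induct_rule[of forest_degree])
  case (less \<rho>)
  let ?I = "increment (CK_group N) X"
  have Xc: "X t \<in> carrier (CK_group N)" if "t \<in> {0..T}" for t using X that by (simp add: homogeneously_bounded_def)
  show ?case
  proof (cases "\<rho> = {#} \<or> N < forest_degree \<rho>")
    case True
    then have "(if \<rho> = {#} then 1 else 0) = X t \<rho>" if "t \<in> {0..T}" for t
      using CK_carrierD[OF Xc[OF that]] by auto
    then show ?thesis by (rule continuous_on_eq[OF continuous_on_const])
  next
    case False
    then have \<rho>: "\<rho> \<noteq> {#}" "forest_degree \<rho> \<le> N" by auto
    have chen: "X b \<rho> = X a \<rho> + ?I a b \<rho> + reduced_sum (\<lambda>u v. X a u * ?I a b v) \<rho>"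
      if ab: "a \<in> {0..T}" "b \<in> {0..T}" for a b
    proof -
      have "X b = X a \<otimes>\<^bsub>CK_group N\<^esub> ?I a b" by (rule increment_append[of X a N b]) (simp_all add: Xc ab del: atLeastAtMost_iff)
      then have "X b \<rho> = (X a \<otimes>\<^bsub>CK_group N\<^esub> ?I a b) \<rho>" by simp
      also have "\<dots> = X a \<rho> + ?I a b \<rho> + reduced_sum (\<lambda>u v. X a u * ?I a b v) \<rho>"
        by (rule CK_mult_expand[OF _ _ \<rho>]) (simp_all add: Xc ab increment_carrier del: atLeastAtMost_iff)
      finally show ?thesis .
    qed
    have lim: "((\<lambda>t. I t) \<longlongrightarrow> 0) F"
      if "((\<lambda>t. w t) \<longlongrightarrow> 0) F" "\<forall>\<^sub>F t in F. \<bar>I t\<bar> \<le> (C * w t powr (1 / p)) ^ forest_degree y \<and> 0 \<le> w t" "y \<noteq> {#}"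
      for I w :: "real \<Rightarrow> real" and F and y :: "'a forest"
    proof -
      have ev: "\<forall>\<^sub>F t in F. 0 \<le> w t" using that(2) by (auto elim: eventually_mono)
      have "((\<lambda>t. w t powr (1 / p)) \<longlongrightarrow> 0 powr (1 / p)) F"
        using p ev that(1) by (intro tendsto_powr' tendsto_const) auto
      then have "((\<lambda>t. (C * w t powr (1 / p)) ^ forest_degree y) \<longlongrightarrow> (C * 0 powr (1 / p)) ^ forest_degree y) F"
        by (intro tendsto_power tendsto_mult_left)
      moreover have "forest_degree y \<noteq> 0" using that(3) by (auto simp only: forest_degree_eq_0)
      ultimately have "((\<lambda>t. (C * w t powr (1 / p)) ^ forest_degree y) \<longlongrightarrow> 0) F"
        by (simp add: power_0_left)
      then show ?thesis
        by (rule Lim_null_comparison[rotated]) (use that(2) in \<open>auto elim: eventually_mono\<close>)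
    qed
    show ?thesis
      unfolding continuous_on_def
    proof
      fix x assume x: "x \<in> {0..T}"
      have x': "0 \<le> x" "x \<le> T" using x by auto
      have I1: "((\<lambda>t. ?I x t y) \<longlongrightarrow> 0) (at x within {x..T})" if "y \<noteq> {#}" "forest_degree y \<le> N" for y
        by (rule lim[OF control_tendsto(1)[OF \<omega> x']])
          (use that x' homogeneously_bounded_forest[OF X C, of x] control_nonneg[OF \<omega>, of x] in \<open>auto simp: eventually_at_filter\<close>)
      have I2: "((\<lambda>t. ?I t x y) \<longlongrightarrow> 0) (at x within {0..x})" if "y \<noteq> {#}" "forest_degree y \<le> N" for y
        by (rule lim[OF control_tendsto(2)[OF \<omega> x']])
          (use that x' homogeneously_bounded_forest[OF X C, of _ x] control_nonneg[OF \<omega>, of _ x] in \<open>auto simp: eventually_at_filter\<close>)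
      have IH: "((\<lambda>t. X t u) \<longlongrightarrow> X x u) (at x within {0..x})" if "forest_degree u < forest_degree \<rho>" for u
      proof -
        have "((\<lambda>t. X t u) \<longlongrightarrow> X x u) (at x within {0..T})"
          using less[OF that] x unfolding continuous_on_def by blast
        then show ?thesis by (rule tendsto_within_subset) (use x in auto)
      qed
      have deg: "forest_degree u < forest_degree \<rho>" "forest_degree v \<le> N"
        if "v \<noteq> {#}" "forest_degree u + forest_degree v = forest_degree \<rho>" for u v :: "'a forest"
      proof -
        have "forest_degree v \<noteq> 0" using that by (auto simp only: forest_degree_eq_0)
        then show "forest_degree u < forest_degree \<rho>" "forest_degree v \<le> N" using that \<rho> by linarith+
      qed
      have "((\<lambda>t. X x \<rho> + ?I x t \<rho> + reduced_sum (\<lambda>u v. X x u * ?I x t v) \<rho>) \<longlongrightarrow>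
          X x \<rho> + 0 + reduced_sum (\<lambda>u v. X x u * 0) \<rho>) (at x within {x..T})"
        using I1 \<rho> deg by (intro tendsto_add tendsto_const tendsto_reduced_sum tendsto_mult) auto
      then have "((\<lambda>t. X x \<rho> + ?I x t \<rho> + reduced_sum (\<lambda>u v. X x u * ?I x t v) \<rho>) \<longlongrightarrow> X x \<rho>) (at x within {x..T})"
        by simp
      moreover have "\<forall>\<^sub>F t in at x within {x..T}. X x \<rho> + ?I x t \<rho> + reduced_sum (\<lambda>u v. X x u * ?I x t v) \<rho> = X t \<rho>"
        unfolding eventually_at_filter
      proof (intro always_eventually allI impI)
        fix t assume "t \<in> {x..T}"
        then have "t \<in> {0..T}" using x by auto
        then show "X x \<rho> + ?I x t \<rho> + reduced_sum (\<lambda>u v. X x u * ?I x t v) \<rho> = X t \<rho>"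
          using chen[of x t] x by simp
      qed
      ultimately have R: "((\<lambda>t. X t \<rho>) \<longlongrightarrow> X x \<rho>) (at x within {x..T})"
        by (rule Lim_transform_eventually)
      have "((\<lambda>t. X x \<rho> - ?I t x \<rho> - reduced_sum (\<lambda>u v. X t u * ?I t x v) \<rho>) \<longlongrightarrow>
          X x \<rho> - 0 - reduced_sum (\<lambda>u v. X x u * 0) \<rho>) (at x within {0..x})"
        using I2 IH \<rho> deg by (intro tendsto_diff tendsto_const tendsto_reduced_sum tendsto_mult) auto
      then have "((\<lambda>t. X x \<rho> - ?I t x \<rho> - reduced_sum (\<lambda>u v. X t u * ?I t x v) \<rho>) \<longlongrightarrow> X x \<rho>) (at x within {0..x})"
        by simp
      moreover have "\<forall>\<^sub>F t in at x within {0..x}. X x \<rho> - ?I t x \<rho> - reduced_sum (\<lambda>u v. X t u * ?I t x v) \<rho> = X t \<rho>"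
        unfolding eventually_at_filter
      proof (intro always_eventually allI impI)
        fix t assume "t \<in> {0..x}"
        then have t: "t \<in> {0..T}" using x by auto
        have "X x \<rho> = X t \<rho> + ?I t x \<rho> + reduced_sum (\<lambda>u v. X t u * ?I t x v) \<rho>"
          using chen[of t x] t x by simp
        then show "X x \<rho> - ?I t x \<rho> - reduced_sum (\<lambda>u v. X t u * ?I t x v) \<rho> = X t \<rho>" by simp
      qed
      ultimately have L: "((\<lambda>t. X t \<rho>) \<longlongrightarrow> X x \<rho>) (at x within {0..x})"
        by (rule Lim_transform_eventually)
      have "{0..T} = {0..x} \<union> {x..T}" using x by auto
      then show "((\<lambda>t. X t \<rho>) \<longlongrightarrow> X x \<rho>) (at x within {0..T})"
        using L R by (simp add: Lim_within_Un)
    qed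
  qed
qed

lemma homogeneously_bounded_p_variation_path:
  fixes X :: "real \<Rightarrow> 'l::finite forest \<Rightarrow> real"
  assumes X: "homogeneously_bounded N p T \<omega> C X" and C: "0 \<le> C" and \<omega>: "control T \<omega>"
    and p: "0 < p" and N: "1 \<le> N"
  shows "p_variation_path (CK_group N) (CK_norm N) p T X"
  unfolding p_variation_path_def
proof (intro conjI)
  let ?I = "increment (CK_group N) X"
  show "X \<in> {0..T} \<rightarrow> carrier (CK_group N)" using X by (auto simp: homogeneously_bounded_def)
  show "continuous_on {0..T} X"
    unfolding continuous_on_coordinates using homogeneously_bounded_continuous[OF X C \<omega> p] by blast
  have le: "CK_norm N (?I s t) powr p \<le> C powr p * \<omega> s t" if st: "0 \<le> s" "s \<le> t" "t \<le> T" for s t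
  proof -
    have w: "0 \<le> \<omega> s t" by (rule control_nonneg[OF \<omega> st])
    have "CK_norm N (?I s t) \<le> C * \<omega> s t powr (1 / p)"
      using N C homogeneously_bounded_forest[OF X C st] by (intro CK_norm_le) (auto simp: forests_def)
    then have "CK_norm N (?I s t) powr p \<le> (C * \<omega> s t powr (1 / p)) powr p"
      using p N by (intro powr_mono2 CK_norm_nonneg) auto
    also have "\<dots> = C powr p * \<omega> s t" using p C w by (simp add: powr_mult powr_powr)
    finally show ?thesis .
  qed
  show "finite_p_variation (CK_group N) (CK_norm N) p T X"
    unfolding finite_p_variation_def
  proof (rule bdd_aboveI)
    fix x assume "x \<in> {(\<Sum>i<n. CK_norm N (?I (\<tau> i) (\<tau> (Suc i))) powr p) | n \<tau>.
       1 \<le> n \<and> \<tau> 0 = 0 \<and> \<tau> n = T \<and> (\<forall>i<n. \<tau> i < \<tau> (Suc i))}"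
    then obtain n \<tau> where x: "x = (\<Sum>i<n. CK_norm N (?I (\<tau> i) (\<tau> (Suc i))) powr p)"
      and n: "\<tau> 0 = 0" "\<tau> n = T" "\<forall>i<n. \<tau> i < \<tau> (Suc i)" by blast
    have mono: "\<tau> i \<le> \<tau> j" if "i \<le> j" "j \<le> n" for i j
      using increasing_steps_mono[of n \<tau>] n(3) that by blast
    have r: "0 \<le> \<tau> i" "\<tau> i \<le> T" if "i \<le> n" for i using mono[of 0 i] mono[of i n] that n by auto
    have "(\<Sum>i<m. \<omega> (\<tau> i) (\<tau> (Suc i))) \<le> \<omega> 0 (\<tau> m)" if "m \<le> n" for m
      using that
    proof (induction m)
      case 0
      then show ?case using n(1) control_nonneg[OF \<omega>, of 0 0] r[of 0] r[of n] by simp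
    next
      case (Suc m)
      then have "\<omega> 0 (\<tau> m) + \<omega> (\<tau> m) (\<tau> (Suc m)) \<le> \<omega> 0 (\<tau> (Suc m))"
        using r[of m] r[of "Suc m"] mono[of m "Suc m"] by (intro control_super[OF \<omega>]) auto
      then show ?case using Suc by simp
    qed
    from this[of n] have S: "(\<Sum>i<n. \<omega> (\<tau> i) (\<tau> (Suc i))) \<le> \<omega> 0 T" using n by simp
    have "x \<le> (\<Sum>i<n. C powr p * \<omega> (\<tau> i) (\<tau> (Suc i)))"
      unfolding x using r mono by (intro sum_mono le) auto
    also have "\<dots> = C powr p * (\<Sum>i<n. \<omega> (\<tau> i) (\<tau> (Suc i)))" by (simp add: sum_distrib_left)
    also have "\<dots> \<le> C powr p * \<omega> 0 T" using S by (intro mult_left_mono) auto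
    finally show "x \<le> C powr p * \<omega> 0 T" .
  qed
qed

section \<open>The extension theorem\<close>

lemma truncate_top_series: "m < N \<Longrightarrow> truncate m (top_series N f) = unit_series"
  by (auto simp: truncate_def unit_series_def fun_eq_iff intro!: top_series_eq_0)

text \<open>
  Let \<open>Z\<close> be the lift of \<open>X\<close> that vanishes on the trees \<open>\<tau>\<close> of degree \<open>n + 1\<close>. Its increments fail to be
  additive on such \<open>\<tau>\<close> only by terms of lower degree, which are of order \<open>\<omega>\<^sup>\<theta>\<close> with \<open>\<theta> = (n + 1) / p > 1\<close>.
  The sewing lemma hence yields \<open>k\<^sub>\<tau>\<close> such that \<open>(Z\<^sub>s\<^sub>,\<^sub>t, \<tau>) + k\<^sub>\<tau>(t) - k\<^sub>\<tau>(s)\<close> is of that order. These are the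
  increments of \<open>Z\<close> multiplied by the central elements with values \<open>k\<^sub>\<tau>(t)\<close>.
\<close>

lemma extend_one_degree:
  fixes X :: "real \<Rightarrow> 'l::finite forest \<Rightarrow> real"
  assumes X: "homogeneously_bounded n p T \<omega> C X" and C: "0 \<le> C" and \<omega>: "control T \<omega>"
    and p: "1 \<le> p" and n: "p < real (Suc n)" and T: "0 < T"
  obtains Y D where "0 \<le> D" "homogeneously_bounded (Suc n) p T \<omega> D Y"
    "\<forall>t. 0 \<le> t \<longrightarrow> t \<le> T \<longrightarrow> truncate n (Y t) = X t"
proof -
  let ?N = "Suc n"
  let ?G = "CK_group ?N :: ('l forest \<Rightarrow> real) monoid"
  interpret group ?G by (rule group_CK_group)
  define \<theta> where "\<theta> = real ?N / p"
  have \<theta>: "1 < \<theta>" using p n by (simp add: \<theta>_def)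
  have Xc: "X t \<in> carrier (CK_group n)" if "0 \<le> t" "t \<le> T" for t using X that by (simp add: homogeneously_bounded_def)
  define Z where "Z t = truncate ?N (character_of (X t))" for t
  have Zc: "Z t \<in> carrier ?G" for t by (simp add: Z_def truncate_in_CK_carrier character_character_of)
  have ZX: "truncate n (Z t) = X t" if "0 \<le> t" "t \<le> T" for t
    using Xc[OF that] by (simp add: Z_def truncate_truncate truncate_character_of)
  let ?I = "increment ?G Z" and ?J = "increment (CK_group n) X"
  have IJ: "?I s t \<rho> = ?J s t \<rho>" if "0 \<le> s" "s \<le> t" "t \<le> T" "forest_degree \<rho> \<le> n" for s t \<rho>
  proof -
    have "?I s t \<rho> = truncate n (?I s t) \<rho>" using that by simp
    also have "truncate n (?I s t) = increment (CK_group n) (\<lambda>t. truncate n (Z t)) s t"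
      by (rule truncate_increment) (simp_all add: Zc)
    also have "\<dots> = ?J s t" using that by (simp add: increment_def ZX)
    finally show ?thesis .
  qed
  have "\<exists>k K. \<forall>s t. 0 \<le> s \<longrightarrow> s \<le> t \<longrightarrow> t \<le> T \<longrightarrow> \<bar>k t - k s + ?I s t {#\<tau>#}\<bar> \<le> K * \<omega> s t powr \<theta>"
    if \<tau>: "tree_degree \<tau> = ?N" for \<tau>
  proof -
    define \<Xi> where "\<Xi> s t = - ?I s t {#\<tau>#}" for s t
    let ?M = "coproduct_size {#\<tau>#} * C ^ ?N"
    have M: "0 \<le> ?M" using C by (simp add: coproduct_size_nonneg)
    have "\<bar>\<Xi> s t - \<Xi> s u - \<Xi> u t\<bar> \<le> ?M * \<omega> s t powr \<theta>" if sut: "0 \<le> s" "s \<le> u" "u \<le> t" "t \<le> T" for s u t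
    proof -
      let ?r = "C * \<omega> s t powr (1 / p)"
      have "?I s t {#\<tau>#} = ?I s u {#\<tau>#} + ?I u t {#\<tau>#} + reduced_sum (\<lambda>x y. ?I s u x * ?I u t y) {#\<tau>#}"
        using \<tau> by (simp add: increment_trans[of Z s ?N u t] CK_mult_expand increment_carrier Zc)
      then have "\<bar>\<Xi> s t - \<Xi> s u - \<Xi> u t\<bar> = \<bar>reduced_sum (\<lambda>x y. ?I s u x * ?I u t y) {#\<tau>#}\<bar>"
        by (simp add: \<Xi>_def)
      also have "\<dots> \<le> coproduct_size {#\<tau>#} * ?r ^ ?N"
      proof (rule reduced_sum_bound)
        show "0 \<le> ?r ^ ?N" using C by simp
        fix x y :: "'l forest" assume "x \<noteq> {#}" "y \<noteq> {#}" and d: "forest_degree x + forest_degree y = forest_degree {#\<tau>#}"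
        then have "forest_degree x \<noteq> 0" "forest_degree y \<noteq> 0" by (auto simp only: forest_degree_eq_0)
        moreover have "forest_degree x + forest_degree y = Suc n" using d \<tau> by simp
        ultimately have dn: "forest_degree x \<le> n" "forest_degree y \<le> n" by linarith+
        have w: "\<omega> s u \<le> \<omega> s t" "\<omega> u t \<le> \<omega> s t" "0 \<le> \<omega> s u" "0 \<le> \<omega> u t"
          using sut by (auto intro!: control_mono[OF \<omega>] control_nonneg[OF \<omega>])
        have "\<bar>?I s u x\<bar> \<le> (C * \<omega> s u powr (1 / p)) ^ forest_degree x"
          using IJ[of s u x] homogeneously_bounded_forest[OF X C, of s u x] sut dn by simp
        also have "\<dots> \<le> ?r ^ forest_degree x"
          using w C p by (intro power_mono mult_left_mono powr_mono2) auto
        finally have x: "\<bar>?I s u x\<bar> \<le> ?r ^ forest_degree x" .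
        have "\<bar>?I u t y\<bar> \<le> (C * \<omega> u t powr (1 / p)) ^ forest_degree y"
          using IJ[of u t y] homogeneously_bounded_forest[OF X C, of u t y] sut dn by simp
        also have "\<dots> \<le> ?r ^ forest_degree y"
          using w C p by (intro power_mono mult_left_mono powr_mono2) auto
        finally have y: "\<bar>?I u t y\<bar> \<le> ?r ^ forest_degree y" .
        have "\<bar>?I s u x * ?I u t y\<bar> \<le> ?r ^ forest_degree x * ?r ^ forest_degree y"
          unfolding abs_mult using x y C by (intro mult_mono) auto
        also have "\<dots> = ?r ^ ?N" using d \<tau> by (simp flip: power_add)
        finally show "\<bar>?I s u x * ?I u t y\<bar> \<le> ?r ^ ?N" .
      qed
      also have "?r ^ ?N = C ^ ?N * \<omega> s t powr \<theta>"
        unfolding \<theta>_def using sut p by (intro power_powr_inverse control_nonneg[OF \<omega>]) auto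
      finally show ?thesis by (simp add: mult.assoc)
    qed
    then obtain k K where "\<And>s t. 0 \<le> s \<Longrightarrow> s \<le> t \<Longrightarrow> t \<le> T \<Longrightarrow> \<bar>k t - k s - \<Xi> s t\<bar> \<le> K * \<omega> s t powr \<theta>"
      using sewing[OF \<omega> \<theta> M T, of \<Xi>] by blast
    then show ?thesis unfolding \<Xi>_def by (intro exI[of _ k] exI[of _ K]) simp
  qed
  then obtain k K where k: "\<And>\<tau> s t. tree_degree \<tau> = ?N \<Longrightarrow> 0 \<le> s \<Longrightarrow> s \<le> t \<Longrightarrow> t \<le> T \<Longrightarrow>
      \<bar>k \<tau> t - k \<tau> s + ?I s t {#\<tau>#}\<bar> \<le> K \<tau> * \<omega> s t powr \<theta>"
    by metis
  define S where "S = {\<tau> :: 'l ltree. tree_degree \<tau> = ?N}"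
  have "S \<subseteq> (\<lambda>\<tau>. {#\<tau>#}) -` {\<rho>. forest_degree \<rho> \<le> ?N}" by (auto simp: S_def)
  then have S: "finite S"
    by (rule finite_subset) (intro finite_vimageI finite_forest_degree_le, simp add: inj_on_def)
  \<comment> \<open>Since \<open>D \<ge> 1\<close> dominates \<open>C\<close> and all \<open>K \<tau>\<close>, so do its powers.\<close>
  define D where "D = C + (\<Sum>\<tau>\<in>S. \<bar>K \<tau>\<bar>) + 1"
  have D: "C \<le> D" "1 \<le> D" using C by (simp_all add: D_def sum_nonneg)
  have KD: "K \<tau> \<le> D ^ ?N" if "\<tau> \<in> S" for \<tau>
  proof -
    have "K \<tau> \<le> \<bar>K \<tau>\<bar>" by simp
    also have "\<dots> \<le> (\<Sum>\<tau>\<in>S. \<bar>K \<tau>\<bar>)" using that S by (intro member_le_sum) auto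
    also have "\<dots> \<le> D" using C by (simp add: D_def)
    also have "\<dots> \<le> D ^ ?N" using D by (intro self_le_power) auto
    finally show ?thesis .
  qed
  define A where "A t = top_series ?N (\<lambda>\<tau>. k \<tau> t)" for t
  have Ac: "A t \<in> carrier ?G" for t by (simp add: A_def top_series_carrier)
  define Y where "Y t = Z t \<otimes>\<^bsub>?G\<^esub> A t" for t
  have Yc: "Y t \<in> carrier ?G" for t using Zc Ac by (simp add: Y_def)
  have YX: "truncate n (Y t) = X t" if "0 \<le> t" "t \<le> T" for t
  proof -
    have "truncate n (Y t) = X t \<otimes>\<^bsub>CK_group n\<^esub> unit_series"
      using that by (simp add: Y_def CK_mult_truncate_lower ZX A_def truncate_top_series)
    then show ?thesis using Xc[OF that] monoid.r_one[OF monoid_CK_group, of "X t" n] by (simp add: CK_one)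
  qed
  have YI: "increment ?G Y s t {#\<tau>#} = ?I s t {#\<tau>#} + (if tree_degree \<tau> = ?N then k \<tau> t - k \<tau> s else 0)"
    if "tree_degree \<tau> \<le> ?N" for s t \<tau>
  proof -
    have "inv\<^bsub>?G\<^esub> A s = top_series ?N (\<lambda>\<tau>. - k \<tau> s)"
      by (rule inv_equality) (use top_series_inverse[of ?N "\<lambda>\<tau>. - k \<tau> s"] in \<open>simp_all add: A_def CK_one top_series_carrier\<close>)
    then have "increment ?G Y s t = top_series ?N (\<lambda>\<tau>. - k \<tau> s) \<otimes>\<^bsub>?G\<^esub> (?I s t \<otimes>\<^bsub>?G\<^esub> A t)"
      using Zc Ac by (simp add: increment_def Y_def inv_mult_group m_assoc top_series_carrier)
    moreover have "?I s t \<in> carrier ?G" by (simp add: increment_carrier Zc)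
    ultimately show ?thesis
      using that by (simp add: A_def CK_mult_top_series top_series_carrier top_series_tree)
  qed
  have "\<bar>increment ?G Y s t {#\<tau>#}\<bar> \<le> (D * \<omega> s t powr (1 / p)) ^ tree_degree \<tau>"
    if st: "0 \<le> s" "s \<le> t" "t \<le> T" and \<tau>: "tree_degree \<tau> \<le> ?N" for s t \<tau>
  proof (cases "tree_degree \<tau> = ?N")
    case True
    have "\<bar>increment ?G Y s t {#\<tau>#}\<bar> \<le> K \<tau> * \<omega> s t powr \<theta>"
      using k[OF True st] YI[OF \<tau>, of s t] True by (simp add: algebra_simps)
    also have "\<dots> \<le> D ^ ?N * \<omega> s t powr \<theta>" using KD[of \<tau>] True by (intro mult_right_mono) (auto simp: S_def)
    also have "\<dots> = (D * \<omega> s t powr (1 / p)) ^ ?N"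
      unfolding \<theta>_def using st p by (intro power_powr_inverse[symmetric] control_nonneg[OF \<omega>]) auto
    finally show ?thesis using True by simp
  next
    case False
    then have "tree_degree \<tau> \<le> n" using \<tau> by simp
    then have "increment ?G Y s t {#\<tau>#} = ?J s t {#\<tau>#}" using YI[OF \<tau>] IJ[OF st, of "{#\<tau>#}"] False by simp
    then have "\<bar>increment ?G Y s t {#\<tau>#}\<bar> \<le> (C * \<omega> s t powr (1 / p)) ^ tree_degree \<tau>"
      using X st \<open>tree_degree \<tau> \<le> n\<close> by (simp add: homogeneously_bounded_def)
    also have "\<dots> \<le> (D * \<omega> s t powr (1 / p)) ^ tree_degree \<tau>"
      using C D by (intro power_mono mult_right_mono) auto
    finally show ?thesis .
  qed
  then have "homogeneously_bounded ?N p T \<omega> D Y" using Yc by (simp add: homogeneously_bounded_def)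
  moreover have "0 \<le> D" using D by simp
  ultimately show ?thesis using that YX by blast
qed

lemma extension_exists:
  fixes X :: "real \<Rightarrow> 'l::finite forest \<Rightarrow> real"
  assumes X: "p_variation_path (CK_group m) (CK_norm m) p T X"
    and p: "1 \<le> p" and m: "1 \<le> m" "p < real (Suc m)" and T: "0 < T" and "m \<le> N"
  obtains Y where "p_variation_path (CK_group N) (CK_norm N) p T Y"
    "\<And>t. 0 \<le> t \<Longrightarrow> t \<le> T \<Longrightarrow> truncate m (Y t) = X t"
proof -
  obtain \<omega> where \<omega>: "control T \<omega>" and X1: "homogeneously_bounded m p T \<omega> 1 X"
    using p_variation_path_control[OF X m(1) _ T] p by auto
  have "\<exists>Y C. 0 \<le> C \<and> homogeneously_bounded N p T \<omega> C Y \<and> (\<forall>t. 0 \<le> t \<longrightarrow> t \<le> T \<longrightarrow> truncate m (Y t) = X t)"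
    using \<open>m \<le> N\<close>
  proof (induction N rule: dec_induct)
    case base
    have "truncate m (X t) = X t" if "0 \<le> t" "t \<le> T" for t
      using X1 that by (auto simp: homogeneously_bounded_def intro: truncate_carrier_id)
    then show ?case using X1 by (intro exI[of _ X] exI[of _ 1]) auto
  next
    case (step n)
    then obtain Y C where Y: "0 \<le> C" "homogeneously_bounded n p T \<omega> C Y"
      "\<forall>t. 0 \<le> t \<longrightarrow> t \<le> T \<longrightarrow> truncate m (Y t) = X t" by blast
    have pn: "p < real (Suc n)" using m step by linarith
    obtain Y' D where Y': "0 \<le> D" "homogeneously_bounded (Suc n) p T \<omega> D Y'"
      "\<forall>t. 0 \<le> t \<longrightarrow> t \<le> T \<longrightarrow> truncate n (Y' t) = Y t"
      by (rule extend_one_degree[OF Y(2,1) \<omega> p pn T])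
    have "truncate m (Y' t) = X t" if "0 \<le> t" "t \<le> T" for t
    proof -
      have "truncate m (Y' t) = truncate m (truncate n (Y' t))"
        by (rule truncate_truncate[OF \<open>m \<le> n\<close>, symmetric])
      also have "\<dots> = X t" using Y(3) Y'(3) that by simp
      finally show ?thesis .
    qed
    then show ?case using Y' by blast
  qed
  then obtain Y C where Y: "0 \<le> C" "homogeneously_bounded N p T \<omega> C Y"
    "\<And>t. 0 \<le> t \<Longrightarrow> t \<le> T \<Longrightarrow> truncate m (Y t) = X t" by blast
  have "p_variation_path (CK_group N) (CK_norm N) p T Y"
    using homogeneously_bounded_p_variation_path[OF Y(2,1) \<omega>] p m \<open>m \<le> N\<close> by simp
  then show ?thesis using that Y(3) by blast
qed

text \<open>
  Once the increments of two extensions agree up to a degree \<open>n \<ge> [p]\<close>, their difference at a tree of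
  degree \<open>n + 1\<close> is additive and of order \<open>\<omega>\<close> to the power \<open>(n + 1) / p > 1\<close>, hence zero.
\<close>

lemma extension_unique:
  fixes Y Y' :: "real \<Rightarrow> 'l::finite forest \<Rightarrow> real"
  assumes Y: "p_variation_path (CK_group N) (CK_norm N) p T Y"
    and Y': "p_variation_path (CK_group N) (CK_norm N) p T Y'"
    and eq: "\<And>t. 0 \<le> t \<Longrightarrow> t \<le> T \<Longrightarrow> truncate m (Y t) = truncate m (Y' t)"
    and p: "1 \<le> p" and m: "1 \<le> m" "p < real (Suc m)" and T: "0 < T" and mN: "m \<le> N"
    and st: "0 \<le> s" "s \<le> t" "t \<le> T"
  shows "increment (CK_group N) Y s t = increment (CK_group N) Y' s t"
proof -
  let ?G = "CK_group N :: ('l forest \<Rightarrow> real) monoid"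
  let ?I = "increment ?G Y" and ?I' = "increment ?G Y'"
  have N: "1 \<le> N" and p0: "0 < p" using m mN p by auto
  obtain \<omega> where \<omega>: "control T \<omega>" "homogeneously_bounded N p T \<omega> 1 Y"
    using p_variation_path_control[OF Y N p0 T] by blast
  obtain \<eta> where \<eta>: "control T \<eta>" "homogeneously_bounded N p T \<eta> 1 Y'"
    using p_variation_path_control[OF Y' N p0 T] by blast
  have c: "Y t \<in> carrier ?G" "Y' t \<in> carrier ?G" if "0 \<le> t" "t \<le> T" for t
    using \<omega>(2) \<eta>(2) that by (auto simp: homogeneously_bounded_def)
  have Ic: "?I s t \<in> carrier ?G" "?I' s t \<in> carrier ?G" if "0 \<le> s" "s \<le> t" "t \<le> T" for s t
    using that by (auto intro!: increment_carrier c)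
  have "n \<le> N \<longrightarrow> (\<forall>s t. 0 \<le> s \<longrightarrow> s \<le> t \<longrightarrow> t \<le> T \<longrightarrow> truncate n (?I s t) = truncate n (?I' s t))"
    if "m \<le> n" for n
    using that
  proof (induction n rule: dec_induct)
    case base
    show ?case
    proof (intro impI allI)
      fix s t assume st: "0 \<le> s" "s \<le> t" "t \<le> T"
      have "truncate m (?I s t) = increment (CK_group m) (\<lambda>t. truncate m (Y t)) s t"
        "truncate m (?I' s t) = increment (CK_group m) (\<lambda>t. truncate m (Y' t)) s t"
        using st by (auto intro!: truncate_increment[OF mN] c)
      then show "truncate m (?I s t) = truncate m (?I' s t)"
        using eq st by (simp add: increment_def)
    qed
  next
    case (step n)
    show ?case
    proof (rule impI)
      assume nN: "Suc n \<le> N"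
      have low: "?I s t \<rho> = ?I' s t \<rho>" if "0 \<le> s" "s \<le> t" "t \<le> T" "forest_degree \<rho> \<le> n" for s t \<rho>
        using step.IH that nN by (auto simp: truncate_eq_iff)
      define \<theta> where "\<theta> = real (Suc n) / p"
      have \<theta>: "1 < \<theta>" using p m step by (simp add: \<theta>_def)
      have tree: "?I s t {#\<tau>#} = ?I' s t {#\<tau>#}"
        if st: "0 \<le> s" "s \<le> t" "t \<le> T" and \<tau>: "tree_degree \<tau> = Suc n" for s t \<tau>
      proof -
        define D where "D s t = ?I s t {#\<tau>#} - ?I' s t {#\<tau>#}" for s t
        have "D s t = 0"
        proof (rule additive_eq_0[OF control_add[OF \<omega>(1) \<eta>(1)] \<theta>, of 2 D])
          fix s u t assume sut: "0 \<le> s" "s \<le> u" "u \<le> t" "t \<le> T"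
          have "?I s t {#\<tau>#} = ?I s u {#\<tau>#} + ?I u t {#\<tau>#} + reduced_sum (\<lambda>x y. ?I s u x * ?I u t y) {#\<tau>#}"
            "?I' s t {#\<tau>#} = ?I' s u {#\<tau>#} + ?I' u t {#\<tau>#} + reduced_sum (\<lambda>x y. ?I' s u x * ?I' u t y) {#\<tau>#}"
            using sut \<tau> nN
            by (auto simp: increment_trans[of Y s N u t] increment_trans[of Y' s N u t] c CK_mult_expand increment_carrier)
          moreover have "reduced_sum (\<lambda>x y. ?I s u x * ?I u t y) {#\<tau>#} = reduced_sum (\<lambda>x y. ?I' s u x * ?I' u t y) {#\<tau>#}"
          proof (rule reduced_sum_cong)
            fix x y :: "'l forest" assume "x \<noteq> {#}" "y \<noteq> {#}" and d: "forest_degree x + forest_degree y = forest_degree {#\<tau>#}"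
            then have "forest_degree x \<noteq> 0" "forest_degree y \<noteq> 0" by (auto simp only: forest_degree_eq_0)
            moreover have "forest_degree x + forest_degree y = Suc n" using d \<tau> by simp
            ultimately have "forest_degree x \<le> n" "forest_degree y \<le> n" by linarith+
            then show "?I s u x * ?I u t y = ?I' s u x * ?I' u t y" using low sut by simp
          qed
          ultimately show "D s t = D s u + D u t" by (simp add: D_def)
        next
          fix s t assume st: "0 \<le> s" "s \<le> t" "t \<le> T"
          have w: "0 \<le> \<omega> s t" "0 \<le> \<eta> s t" using control_nonneg \<omega>(1) \<eta>(1) st by auto
          have "\<bar>?I s t {#\<tau>#}\<bar> \<le> (1 * \<omega> s t powr (1 / p)) ^ Suc n"
            "\<bar>?I' s t {#\<tau>#}\<bar> \<le> (1 * \<eta> s t powr (1 / p)) ^ Suc n"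
            using \<omega>(2) \<eta>(2) st \<tau> nN unfolding homogeneously_bounded_def by metis+
          then have "\<bar>?I s t {#\<tau>#}\<bar> \<le> \<omega> s t powr \<theta>" "\<bar>?I' s t {#\<tau>#}\<bar> \<le> \<eta> s t powr \<theta>"
            unfolding \<theta>_def using power_powr_inverse[of _ p "Suc n" 1] w p0 by simp_all
          moreover have "\<omega> s t powr \<theta> \<le> (\<omega> s t + \<eta> s t) powr \<theta>" "\<eta> s t powr \<theta> \<le> (\<omega> s t + \<eta> s t) powr \<theta>"
            using w \<theta> by (auto intro!: powr_mono2)
          ultimately show "\<bar>D s t\<bar> \<le> 2 * (\<omega> s t + \<eta> s t) powr \<theta>" unfolding D_def by linarith
        qed (use st in auto)
        then show ?thesis by (simp add: D_def)
      qed
      show "\<forall>s t. 0 \<le> s \<longrightarrow> s \<le> t \<longrightarrow> t \<le> T \<longrightarrow> truncate (Suc n) (?I s t) = truncate (Suc n) (?I' s t)"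
      proof (intro allI impI)
        fix s t assume st: "0 \<le> s" "s \<le> t" "t \<le> T"
        show "truncate (Suc n) (?I s t) = truncate (Suc n) (?I' s t)"
        proof (rule CK_eqI)
          show "truncate (Suc n) (?I s t) \<in> carrier (CK_group (Suc n))" "truncate (Suc n) (?I' s t) \<in> carrier (CK_group (Suc n))"
            using Ic[OF st] nN by (auto intro: truncate_carrier)
          fix \<tau> :: "'l ltree" assume "tree_degree \<tau> \<le> Suc n"
          then show "truncate (Suc n) (?I s t) {#\<tau>#} = truncate (Suc n) (?I' s t) {#\<tau>#}"
            using tree[OF st, of \<tau>] low[OF st, of "{#\<tau>#}"] by (cases "tree_degree \<tau> = Suc n") auto
        qed
      qed
    qed
  qed
  then have "truncate N (?I s t) = truncate N (?I' s t)" using mN st by blast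
  then show ?thesis by (simp add: truncate_carrier_id Ic st)
qed

section \<open>Homogeneous norms\<close>

lemma continuous_on_eval: "continuous_on S (\<lambda>a :: 'c \<Rightarrow> real. a i)"
  by (rule continuous_on_product_then_coordinatewise[OF continuous_on_id])

lemma closed_CK_carrier: "closed (carrier (CK_group N))"
proof -
  have "carrier (CK_group N) = {a :: 'a forest \<Rightarrow> real. a {#} = 1} \<inter>
      (\<Inter>\<rho>\<in>{\<rho>. N < forest_degree \<rho>}. {a. a \<rho> = 0}) \<inter>
      (\<Inter>(x, y)\<in>{(x, y). forest_degree x + forest_degree y \<le> N}. {a. a x * a y = a (x + y)})"
    by (auto simp: CK_group_def)
  then show ?thesis
    by (auto intro!: closed_Int closed_INT closed_Collect_eq continuous_on_mult continuous_on_eval continuous_on_const)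
qed

definition unit_sphere :: "nat \<Rightarrow> ('l forest \<Rightarrow> real) set" where
  "unit_sphere N = {a \<in> carrier (CK_group N). (\<forall>\<rho>\<in>forests N. \<bar>a \<rho>\<bar> \<le> 1) \<and> (\<exists>\<rho>\<in>forests N. \<bar>a \<rho>\<bar> = 1)}"

lemma compact_unit_sphere: "compact (unit_sphere N :: ('l::finite forest \<Rightarrow> real) set)"
proof -
  define B where "B = PiE UNIV (\<lambda>_ :: 'l forest. {- 1..1 :: real})"
  have "compactin (product_topology (\<lambda>_. euclidean) UNIV) B"
    unfolding B_def by (subst compactin_PiE) auto
  then have B: "compact B" by (simp add: euclidean_product_topology)
  let ?K = "carrier (CK_group N) \<inter> (\<Inter>\<rho>\<in>forests N. {a :: 'l forest \<Rightarrow> real. \<bar>a \<rho>\<bar> \<le> 1}) \<inter> (\<Union>\<rho>\<in>forests N. {a. \<bar>a \<rho>\<bar> = 1})"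
  have "closed ?K"
    using finite_forests
    by (intro closed_Int closed_CK_carrier closed_INT closed_UN ballI closed_Collect_le closed_Collect_eq
        continuous_on_rabs continuous_on_eval continuous_on_const) auto
  moreover have "unit_sphere N = B \<inter> ?K"
  proof -
    have "\<bar>a \<rho>\<bar> \<le> 1" if a: "a \<in> carrier (CK_group N)" "\<forall>\<rho>\<in>forests N. \<bar>a \<rho>\<bar> \<le> 1" for a and \<rho> :: "'l forest"
      using CK_carrierD(1)[OF a(1)] CK_carrierD(2)[OF a(1), of \<rho>] a(2)
      by (cases "\<rho> = {#} \<or> N < forest_degree \<rho>") (auto simp: in_forests)
    then have "a \<in> B" if "a \<in> carrier (CK_group N)" "\<forall>\<rho>\<in>forests N. \<bar>a \<rho>\<bar> \<le> 1" for a
      using that by (simp add: B_def PiE_iff abs_le_iff)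
    then show ?thesis by (auto simp: unit_sphere_def)
  qed
  ultimately show ?thesis using B by (simp add: compact_Int_closed)
qed

lemma dilation_carrier:
  assumes "a \<in> carrier (CK_group N)"
  shows "dilation c a \<in> carrier (CK_group N)"
proof -
  have "dilation c a x * dilation c a y = dilation c a (x + y)" if "forest_degree x + forest_degree y \<le> N" for x y
    using CK_carrierD(3)[OF assms that] by (simp add: dilation_def power_add)
  then show ?thesis using CK_carrierD[OF assms] by (auto simp: CK_group_def dilation_def)
qed

lemma CK_norm_eq_0:
  fixes a :: "'l::finite forest \<Rightarrow> real"
  assumes a: "a \<in> carrier (CK_group N)" and "CK_norm N a = 0"
  shows "a = unit_series"
proof (rule CK_eqI[OF a unit_in_CK_carrier])
  fix t :: "'l ltree" assume "tree_degree t \<le> N"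
  then have "{#t#} \<in> forests N" by (simp add: in_forests)
  then have "\<bar>a {#t#}\<bar> \<le> 0 ^ tree_degree t" using abs_le_CK_norm[of "{#t#}" N a] assms(2) by simp
  then show "a {#t#} = unit_series {#t#}" using tree_degree_pos[of t] by (simp add: unit_series_def power_0_left)
qed

lemma dilation_in_unit_sphere:
  fixes a :: "'l::finite forest \<Rightarrow> real"
  assumes a: "a \<in> carrier (CK_group N)" and N: "1 \<le> N" and r: "0 < CK_norm N a"
  shows "dilation (1 / CK_norm N a) a \<in> unit_sphere N"
proof -
  let ?r = "CK_norm N a"
  have d: "\<bar>dilation (1 / ?r) a \<rho>\<bar> = \<bar>a \<rho>\<bar> / ?r ^ forest_degree \<rho>" for \<rho>
    using r by (simp add: dilation_def abs_mult power_divide)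
  have "\<bar>dilation (1 / ?r) a \<rho>\<bar> \<le> 1" if "\<rho> \<in> forests N" for \<rho>
    using abs_le_CK_norm[OF that, of a] r by (simp add: d)
  moreover obtain \<rho> where \<rho>: "\<rho> \<in> forests N" "?r = \<bar>a \<rho>\<bar> powr (1 / real (forest_degree \<rho>))"
    using CK_norm_attained[OF N] by blast
  then have "?r ^ forest_degree \<rho> = \<bar>a \<rho>\<bar>"
    using powr_inverse_power[of "\<bar>a \<rho>\<bar>" "forest_degree \<rho>"] forest_degree_pos[OF \<rho>(1)] by simp
  then have "\<bar>dilation (1 / ?r) a \<rho>\<bar> = 1" using r unfolding d by (metis divide_self less_irrefl zero_less_power)
  ultimately show ?thesis using \<rho>(1) dilation_carrier[OF a] by (auto simp: unit_sphere_def)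
qed

text \<open>
  By homogeneity it suffices to compare the two norms on the unit sphere, which is compact and does not
  contain the unit.
\<close>

lemma homogeneous_norm_equivalent:
  fixes nrm :: "('l::finite forest \<Rightarrow> real) \<Rightarrow> real"
  assumes nrm: "homogeneous_norm N nrm" and N: "1 \<le> N"
  obtains c C where "0 < c" "0 < C"
    "\<And>a. a \<in> carrier (CK_group N) \<Longrightarrow> c * CK_norm N a \<le> nrm (by_symmetry a)"
    "\<And>a. a \<in> carrier (CK_group N) \<Longrightarrow> nrm (by_symmetry a) \<le> C * CK_norm N a"
proof -
  let ?S = "unit_sphere N :: ('l forest \<Rightarrow> real) set"
  let ?f = "\<lambda>a. nrm (by_symmetry a)"
  have SG: "?S \<subseteq> carrier (CK_group N)" by (auto simp: unit_sphere_def)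
  have "continuous_on ?S (\<lambda>a. by_symmetry a \<rho>)" for \<rho>
    unfolding by_symmetry_def by (intro continuous_intros continuous_on_eval) simp
  then have 1: "continuous_on ?S by_symmetry" by (simp add: continuous_on_coordinates)
  have 2: "by_symmetry ` ?S \<subseteq> carrier (GL_group N)" using SG by (auto simp: GL_carrier_eq)
  have 3: "continuous_on (carrier (GL_group N)) nrm" using nrm by (simp add: homogeneous_norm_def)
  have cont: "continuous_on ?S ?f" by (rule continuous_on_compose2[OF 3 1 2])
  have pos: "0 \<le> ?f a" "?f a = 0 \<longleftrightarrow> a = unit_series" if "a \<in> carrier (CK_group N)" for a
  proof -
    have "by_symmetry a \<in> carrier (GL_group N)" using that by (simp add: GL_carrier_eq)
    then have "0 \<le> ?f a" "?f a = 0 \<longleftrightarrow> by_symmetry a = unit_series"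
      using nrm unfolding homogeneous_norm_def by blast+
    moreover have "by_symmetry a = unit_series \<longleftrightarrow> a = unit_series"
      using inj_eq[OF inj_by_symmetry, of a unit_series] by (simp add: by_symmetry_unit)
    ultimately show "0 \<le> ?f a" "?f a = 0 \<longleftrightarrow> a = unit_series" by simp_all
  qed
  have hom: "?f a = CK_norm N a * ?f (dilation (1 / CK_norm N a) a)"
    if a: "a \<in> carrier (CK_group N)" and r: "0 < CK_norm N a" for a
  proof -
    have "by_symmetry (dilation (1 / CK_norm N a) a) = dilation (1 / CK_norm N a) (by_symmetry a)"
      by (auto simp: by_symmetry_def dilation_def)
    moreover have "nrm (dilation (1 / CK_norm N a) (by_symmetry a)) = 1 / CK_norm N a * ?f a"
      using nrm a r by (simp add: homogeneous_norm_def GL_carrier_eq)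
    ultimately show ?thesis using r by simp
  qed
  have "\<exists>c C. 0 < c \<and> 0 < C \<and> (\<forall>a\<in>?S. c \<le> ?f a \<and> ?f a \<le> C)"
  proof (cases "?S = {}")
    case True
    then show ?thesis by (intro exI[of _ 1]) auto
  next
    case False
    obtain b where b: "b \<in> ?S" "\<forall>a\<in>?S. ?f b \<le> ?f a"
      using continuous_attains_inf[OF compact_unit_sphere False cont] by blast
    obtain d where d: "d \<in> ?S" "\<forall>a\<in>?S. ?f a \<le> ?f d"
      using continuous_attains_sup[OF compact_unit_sphere False cont] by blast
    have "b \<noteq> unit_series" using b(1) by (auto simp: unit_sphere_def unit_series_def in_forests)
    then have "0 < ?f b" using pos[of b] b SG by (simp add: subset_iff order_less_le)
    then show ?thesis using b d by (intro exI[of _ "?f b"] exI[of _ "?f d"]) (auto intro: less_le_trans)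
  qed
  then obtain c C where cC: "0 < c" "0 < C" "\<And>a. a \<in> ?S \<Longrightarrow> c \<le> ?f a" "\<And>a. a \<in> ?S \<Longrightarrow> ?f a \<le> C" by blast
  have "c * CK_norm N a \<le> ?f a \<and> ?f a \<le> C * CK_norm N a" if a: "a \<in> carrier (CK_group N)" for a
  proof (cases "CK_norm N a = 0")
    case True
    then show ?thesis using CK_norm_eq_0[OF a True] pos[OF a] by simp
  next
    case False
    then have r: "0 < CK_norm N a" using CK_norm_nonneg[OF N, of a] by simp
    show ?thesis
      unfolding hom[OF a r] using cC(3,4)[OF dilation_in_unit_sphere[OF a N r]] r
      by (simp add: mult.commute[of _ "CK_norm N a"])
  qed
  then show ?thesis using that cC by blast
qed

section \<open>Transfer between the two groups\<close>

lemma finite_p_variation_mono: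
  assumes X: "finite_p_variation G nrm p T X" and p: "0 < p" and K: "0 \<le> K"
    and le: "\<And>s t. 0 \<le> s \<Longrightarrow> s < t \<Longrightarrow> t \<le> T \<Longrightarrow> 0 \<le> nrm' (increment G' X' s t) \<and>
      0 \<le> nrm (increment G X s t) \<and> nrm' (increment G' X' s t) \<le> K * nrm (increment G X s t)"
  shows "finite_p_variation G' nrm' p T X'"
proof -
  obtain B where B: "\<And>n \<tau>. 1 \<le> n \<Longrightarrow> \<tau> 0 = 0 \<Longrightarrow> \<tau> n = T \<Longrightarrow> (\<forall>i<n. \<tau> i < \<tau> (Suc i)) \<Longrightarrow>
      (\<Sum>i<n. nrm (increment G X (\<tau> i) (\<tau> (Suc i))) powr p) \<le> B"
    using X unfolding finite_p_variation_def bdd_above_def by blast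
  show ?thesis
    unfolding finite_p_variation_def
  proof (rule bdd_aboveI)
    fix x assume "x \<in> {(\<Sum>i<n. nrm' (increment G' X' (\<tau> i) (\<tau> (Suc i))) powr p) | n \<tau>.
       1 \<le> n \<and> \<tau> 0 = 0 \<and> \<tau> n = T \<and> (\<forall>i<n. \<tau> i < \<tau> (Suc i))}"
    then obtain n \<tau> where x: "x = (\<Sum>i<n. nrm' (increment G' X' (\<tau> i) (\<tau> (Suc i))) powr p)"
      and n: "1 \<le> n" "\<tau> 0 = 0" "\<tau> n = T" "\<forall>i<n. \<tau> i < \<tau> (Suc i)" by blast
    have mono: "\<tau> i \<le> \<tau> j" if "i \<le> j" "j \<le> n" for i j
      using increasing_steps_mono[of n \<tau>] n(4) that by blast
    have "nrm' (increment G' X' (\<tau> i) (\<tau> (Suc i))) powr p \<le> K powr p * nrm (increment G X (\<tau> i) (\<tau> (Suc i))) powr p"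
      if "i < n" for i
    proof -
      have l: "0 \<le> nrm' (increment G' X' (\<tau> i) (\<tau> (Suc i))) \<and> 0 \<le> nrm (increment G X (\<tau> i) (\<tau> (Suc i))) \<and>
          nrm' (increment G' X' (\<tau> i) (\<tau> (Suc i))) \<le> K * nrm (increment G X (\<tau> i) (\<tau> (Suc i)))"
        using mono[of 0 i] mono[of "Suc i" n] n that by (intro le) auto
      then have "nrm' (increment G' X' (\<tau> i) (\<tau> (Suc i))) powr p \<le> (K * nrm (increment G X (\<tau> i) (\<tau> (Suc i)))) powr p"
        using p by (intro powr_mono2) auto
      then show ?thesis using K l by (simp add: powr_mult)
    qed
    then have "x \<le> (\<Sum>i<n. K powr p * nrm (increment G X (\<tau> i) (\<tau> (Suc i))) powr p)"
      unfolding x by (intro sum_mono) auto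
    also have "\<dots> = K powr p * (\<Sum>i<n. nrm (increment G X (\<tau> i) (\<tau> (Suc i))) powr p)"
      by (simp add: sum_distrib_left)
    also have "\<dots> \<le> K powr p * B" using B[OF n] by (intro mult_left_mono) auto
    finally show "x \<le> K powr p * B" .
  qed
qed

text \<open>
  The isomorphism maps increments to increments and changes their norms at most by constant factors.
\<close>

lemma p_variation_path_rescale:
  fixes X :: "real \<Rightarrow> 'l::finite forest \<Rightarrow> real"
  assumes nrm: "homogeneous_norm N nrm" and N: "1 \<le> N" and p: "0 < p"
  shows "p_variation_path (GL_group N) nrm p T (rescale X) \<longleftrightarrow> p_variation_path (CK_group N) (CK_norm N) p T X"
proof -
  obtain c C where c: "0 < c" "0 < C"
    "\<And>a. a \<in> carrier (CK_group N) \<Longrightarrow> c * CK_norm N a \<le> nrm (by_symmetry a)"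
    "\<And>a. a \<in> carrier (CK_group N) \<Longrightarrow> nrm (by_symmetry a) \<le> C * CK_norm N a"
    using homogeneous_norm_equivalent[OF nrm N] by blast
  have carr: "rescale X \<in> {0..T} \<rightarrow> carrier (GL_group N) \<longleftrightarrow> X \<in> {0..T} \<rightarrow> carrier (CK_group N)"
    by (simp add: Pi_iff rescale_eq GL_carrier_eq inj_image_mem_iff[OF inj_by_symmetry])
  have cont: "continuous_on {0..T} (rescale X) \<longleftrightarrow> continuous_on {0..T} X"
  proof
    assume "continuous_on {0..T} X"
    then show "continuous_on {0..T} (rescale X)"
      unfolding continuous_on_coordinates rescale_def by (auto intro!: continuous_intros)
  next
    assume "continuous_on {0..T} (rescale X)"
    then have "continuous_on {0..T} (\<lambda>t. rescale X t \<rho> * real (forest_symmetry \<rho>))" for \<rho>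
      unfolding continuous_on_coordinates by (auto intro!: continuous_intros)
    then show "continuous_on {0..T} X" unfolding continuous_on_coordinates by (simp add: rescale_def)
  qed
  have "finite_p_variation (GL_group N) nrm p T (rescale X) \<longleftrightarrow> finite_p_variation (CK_group N) (CK_norm N) p T X"
    if X: "X \<in> {0..T} \<rightarrow> carrier (CK_group N)"
  proof -
    let ?I = "increment (CK_group N) X"
    have I: "increment (GL_group N) (rescale X) s t = by_symmetry (?I s t)" "?I s t \<in> carrier (CK_group N)"
      if "0 \<le> s" "s < t" "t \<le> T" for s t
      using X that by (auto intro!: increment_rescale increment_carrier)
    have n0: "0 \<le> CK_norm N (?I s t)" for s t by (rule CK_norm_nonneg[OF N])
    have n1: "0 \<le> nrm (by_symmetry (?I s t))" if "0 \<le> s" "s < t" "t \<le> T" for s t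
      using c(3)[OF I(2)[OF that]] n0[of s t] c(1) by (meson mult_nonneg_nonneg less_imp_le order_trans)
    show ?thesis
    proof
      assume "finite_p_variation (CK_group N) (CK_norm N) p T X"
      then show "finite_p_variation (GL_group N) nrm p T (rescale X)"
        by (rule finite_p_variation_mono[OF _ p, of _ _ _ _ C]) (use c I n0 n1 in auto)
    next
      assume "finite_p_variation (GL_group N) nrm p T (rescale X)"
      then show "finite_p_variation (CK_group N) (CK_norm N) p T X"
      proof (rule finite_p_variation_mono[OF _ p, of _ _ _ _ "1 / c"])
        fix s t assume st: "0 \<le> s" "s < t" "t \<le> T"
        have "CK_norm N (?I s t) \<le> 1 / c * nrm (by_symmetry (?I s t))"
          using c(3)[OF I(2)[OF st]] c(1) by (simp add: field_simps)
        then show "0 \<le> CK_norm N (?I s t) \<and> 0 \<le> nrm (increment (GL_group N) (rescale X) s t) \<and>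
            CK_norm N (?I s t) \<le> 1 / c * nrm (increment (GL_group N) (rescale X) s t)"
          using I(1)[OF st] n0 n1[OF st] by simp
      qed (use c in simp)
    qed
  qed
  then show ?thesis unfolding p_variation_path_def using carr cont by blast
qed

lemma rough_extension_rescale:
  fixes X :: "real \<Rightarrow> 'l::finite forest \<Rightarrow> real"
  assumes "homogeneous_norm N nrm" "1 \<le> N" "0 < p"
  shows "rough_extension (GL_group N) nrm p T (rescale X) (rescale Y) \<longleftrightarrow>
    rough_extension (CK_group N) (CK_norm N) p T X Y"
  unfolding rough_extension_def p_variation_path_rescale[OF assms] agree_upto_def by (simp add: rescale_def)

definition unscale :: "(real \<Rightarrow> 'l forest \<Rightarrow> real) \<Rightarrow> real \<Rightarrow> 'l forest \<Rightarrow> real" where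
  "unscale Z = (\<lambda>t \<rho>. Z t \<rho> * real (forest_symmetry \<rho>))"

lemma rescale_unscale [simp]: "rescale (unscale Z) = Z"
  by (simp add: rescale_def unscale_def)

lemma p_variation_path_cong:
  assumes eq: "\<And>t. 0 \<le> t \<Longrightarrow> t \<le> T \<Longrightarrow> X t = Y t" and X: "p_variation_path G nrm p T X"
    and p: "0 < p" and nn: "\<And>s t. 0 \<le> s \<Longrightarrow> s < t \<Longrightarrow> t \<le> T \<Longrightarrow> 0 \<le> nrm (increment G X s t)"
  shows "p_variation_path G nrm p T Y"
proof -
  have inc: "increment G Y s t = increment G X s t" if "0 \<le> s" "s < t" "t \<le> T" for s t
    using that eq by (simp add: increment_def)
  have "finite_p_variation G nrm p T Y"
    by (rule finite_p_variation_mono[of G nrm p T X 1]) (use X p nn inc in \<open>auto simp: p_variation_path_def\<close>)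
  moreover have "continuous_on {0..T} Y"
    by (rule continuous_on_eq[of _ X]) (use X eq in \<open>auto simp: p_variation_path_def\<close>)
  moreover have "Y \<in> {0..T} \<rightarrow> carrier G"
  proof
    fix t assume "t \<in> {0..T}"
    moreover have "X \<in> {0..T} \<rightarrow> carrier G" using X by (simp add: p_variation_path_def)
    ultimately have "X t \<in> carrier G" by blast
    moreover have "X t = Y t" using eq \<open>t \<in> {0..T}\<close> by simp
    ultimately show "Y t \<in> carrier G" by (simp only:)
  qed
  ultimately show ?thesis by (simp add: p_variation_path_def)
qed

lemma agree_upto_iff:
  assumes "b \<in> carrier (CK_group m)" "a \<in> carrier (CK_group N)"
  shows "agree_upto m a b \<longleftrightarrow> truncate m a = b"
proof -
  have "a \<rho> = b \<rho>" if "agree_upto m a b" "forest_degree \<rho> \<le> m" for \<rho>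
    using that CK_carrierD(1)[OF assms(1)] CK_carrierD(1)[OF assms(2)]
    by (cases "\<rho> = {#}") (auto simp: agree_upto_def in_forests)
  then have "agree_upto m a b \<Longrightarrow> truncate m a = truncate m b" by (simp add: truncate_eq_iff)
  moreover have "agree_upto m (truncate m a) b = agree_upto m a b"
    by (auto simp: agree_upto_def in_forests)
  ultimately show ?thesis using truncate_carrier_id[OF assms(1)] by (auto simp: agree_upto_def)
qed

section \<open>The extension problem in both groups\<close>

text \<open>
  A left translation changes the starting point of an extension and keeps its increments. The factor that
  moves \<open>Y 0\<close> to \<open>g\<close> has trivial truncation, so the translated path still extends \<open>X\<close>.
\<close>

lemma rough_extension_start:
  fixes X Y :: "real \<Rightarrow> 'l::finite forest \<Rightarrow> real"
  assumes X: "\<And>t. 0 \<le> t \<Longrightarrow> t \<le> T \<Longrightarrow> X t \<in> carrier (CK_group (integer_part p))"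
    and Y: "rough_extension (CK_group N) (CK_norm N) p T X Y"
    and N: "integer_part p \<le> N" "1 \<le> N" and p: "0 < p" and T: "0 < T"
    and g: "g \<in> carrier (CK_group N)" "agree_upto (integer_part p) g (X 0)"
  shows "\<exists>Z. Z \<in> extensional {0..T} \<and> rough_extension (CK_group N) (CK_norm N) p T X Z \<and> Z 0 = g"
proof -
  let ?G = "CK_group N :: ('l forest \<Rightarrow> real) monoid" and ?m = "integer_part p"
  interpret group ?G by (rule group_CK_group)
  interpret m: group "CK_group ?m :: ('l forest \<Rightarrow> real) monoid" by (rule group_CK_group)
  have Yp: "p_variation_path ?G (CK_norm N) p T Y" using Y by (simp add: rough_extension_def)
  have Yc: "Y t \<in> carrier ?G" if "0 \<le> t" "t \<le> T" for t using Yp that by (auto simp: p_variation_path_def)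
  have YX: "truncate ?m (Y t) = X t" if "0 \<le> t" "t \<le> T" for t
    using Y that agree_upto_iff[OF X[OF that] Yc[OF that]] by (auto simp: rough_extension_def)
  define h where "h = g \<otimes>\<^bsub>?G\<^esub> inv\<^bsub>?G\<^esub> Y 0"
  have h: "h \<in> carrier ?G" using g Yc T by (simp add: h_def)
  have "truncate ?m g = X 0" using agree_upto_iff[OF X g(1), of 0] g(2) T by simp
  then have "truncate ?m h = X 0 \<otimes>\<^bsub>CK_group ?m\<^esub> inv\<^bsub>CK_group ?m\<^esub> X 0"
    using Yc[of 0] T N by (simp add: h_def CK_mult_truncate_lower truncate_inv YX)
  then have th: "truncate ?m h = unit_series" using m.r_inv[OF X[of 0]] T by (simp add: CK_one)
  define W where "W t = h \<otimes>\<^bsub>?G\<^esub> Y t" for t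
  have Wc: "W t \<in> carrier ?G" if "0 \<le> t" "t \<le> T" for t using h Yc[OF that] by (simp add: W_def)
  have inc: "increment ?G W s t = increment ?G Y s t" if "0 \<le> s" "s < t" "t \<le> T" for s t
    unfolding W_def using that by (intro increment_left_mult h Yc) auto
  have "finite_p_variation ?G (CK_norm N) p T W"
    by (rule finite_p_variation_mono[of ?G "CK_norm N" p T Y 1])
      (use Yp p inc CK_norm_nonneg[OF N(2)] in \<open>auto simp: p_variation_path_def\<close>)
  moreover have "continuous_on {0..T} W"
    unfolding continuous_on_coordinates W_def using Yp h Yc
    by (intro allI CK_product_continuous) (auto simp: p_variation_path_def continuous_on_coordinates)
  ultimately have Wp: "p_variation_path ?G (CK_norm N) p T W" using Wc by (auto simp: p_variation_path_def)
  have WX: "truncate ?m (W t) = X t" if "0 \<le> t" "t \<le> T" for t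
    using that N m.l_one[OF X[OF that]] by (simp add: W_def CK_mult_truncate_lower th YX CK_one)
  have "W 0 = g" using g Yc[of 0] T by (simp add: W_def h_def m_assoc)
  define Z where "Z = restrict W {0..T}"
  have ZW: "Z t = W t" if "0 \<le> t" "t \<le> T" for t using that by (simp add: Z_def)
  have "p_variation_path ?G (CK_norm N) p T Z"
    by (rule p_variation_path_cong[OF _ Wp p]) (use ZW CK_norm_nonneg[OF N(2)] in auto)
  moreover have "agree_upto ?m (Z t) (X t)" if "t \<in> {0..T}" for t
    using that agree_upto_iff[OF X[of t] Wc[of t]] WX[of t] ZW[of t] by simp
  ultimately show ?thesis
    using \<open>W 0 = g\<close> T by (intro exI[of _ Z]) (auto simp: rough_extension_def Z_def)
qed

lemma integer_part_bounds:
  assumes "1 \<le> p"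
  shows "1 \<le> integer_part p" "p < real (integer_part p) + 1"
proof -
  have "1 \<le> \<lfloor>p\<rfloor>" using assms by linarith
  then have "real (integer_part p) = of_int \<lfloor>p\<rfloor>" by simp
  then show "p < real (integer_part p) + 1" by linarith
  show "1 \<le> integer_part p" using \<open>1 \<le> \<lfloor>p\<rfloor>\<close> by linarith
qed

lemma rough_extension_increments_unique:
  fixes X Y Y' :: "real \<Rightarrow> 'l::finite forest \<Rightarrow> real"
  assumes X: "\<And>t. 0 \<le> t \<Longrightarrow> t \<le> T \<Longrightarrow> X t \<in> carrier (CK_group (integer_part p))"
    and Y: "rough_extension (CK_group N) (CK_norm N) p T X Y" and Y': "rough_extension (CK_group N) (CK_norm N) p T X Y'"
    and N: "integer_part p \<le> N" and p: "1 \<le> p" and T: "0 < T" and st: "0 \<le> s" "s \<le> t" "t \<le> T"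
  shows "increment (CK_group N) Y s t = increment (CK_group N) Y' s t"
proof (rule extension_unique[of N p T Y Y' "integer_part p"])
  show "1 \<le> integer_part p" "p < real (Suc (integer_part p))" using integer_part_bounds[OF p] by auto
  have c: "Y t \<in> carrier (CK_group N)" "Y' t \<in> carrier (CK_group N)" if "0 \<le> t" "t \<le> T" for t
    using Y Y' that by (auto simp: rough_extension_def p_variation_path_def)
  fix t assume t: "0 \<le> t" "t \<le> T"
  show "truncate (integer_part p) (Y t) = truncate (integer_part p) (Y' t)"
    using Y Y' t agree_upto_iff[OF X[OF t] c(1)[OF t]] agree_upto_iff[OF X[OF t] c(2)[OF t]]
    by (auto simp: rough_extension_def)
qed (use assms in \<open>auto simp: rough_extension_def\<close>)

lemma rough_extension_determined:
  fixes X Y Y' :: "real \<Rightarrow> 'l::finite forest \<Rightarrow> real"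
  assumes X: "\<And>t. 0 \<le> t \<Longrightarrow> t \<le> T \<Longrightarrow> X t \<in> carrier (CK_group (integer_part p))"
    and Y: "rough_extension (CK_group N) (CK_norm N) p T X Y" and Y': "rough_extension (CK_group N) (CK_norm N) p T X Y'"
    and N: "integer_part p \<le> N" and p: "1 \<le> p" and T: "0 < T" and t: "0 \<le> t" "t \<le> T" and "Y 0 = Y' 0"
  shows "Y t = Y' t"
proof -
  have c: "Y t \<in> carrier (CK_group N)" "Y' t \<in> carrier (CK_group N)" if "0 \<le> t" "t \<le> T" for t
    using Y Y' that by (auto simp: rough_extension_def p_variation_path_def)
  have "increment (CK_group N) Y 0 t = increment (CK_group N) Y' 0 t"
    by (rule rough_extension_increments_unique[OF X Y Y' N p T]) (use t in auto)
  then show ?thesis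
    using increment_append[of Y 0 N t] increment_append[of Y' 0 N t] c t T \<open>Y 0 = Y' 0\<close> by auto
qed

lemma rough_extension_exists:
  fixes X :: "real \<Rightarrow> 'l::finite forest \<Rightarrow> real"
  assumes X: "branched_rough_path p T X" and p: "1 \<le> p" and T: "0 < T" and N: "integer_part p \<le> N"
  shows "\<exists>Y. rough_extension (CK_group N) (CK_norm N) p T X Y"
proof -
  have m: "1 \<le> integer_part p" "p < real (Suc (integer_part p))" using integer_part_bounds[OF p] by auto
  have Xp: "p_variation_path (CK_group (integer_part p)) (CK_norm (integer_part p)) p T X"
    using X by (simp add: branched_rough_path_def)
  obtain Y where Y: "p_variation_path (CK_group N) (CK_norm N) p T Y"
    "\<And>t. 0 \<le> t \<Longrightarrow> t \<le> T \<Longrightarrow> truncate (integer_part p) (Y t) = X t"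
    using extension_exists[OF Xp p m T N] by blast
  have "agree_upto (integer_part p) (Y t) (X t)" if "t \<in> {0..T}" for t
    using that Y(2)[of t] Xp Y(1) by (subst agree_upto_iff) (auto simp: p_variation_path_def)
  then show ?thesis using Y(1) by (auto simp: rough_extension_def)
qed

lemma unique_rough_extension_CK:
  fixes X :: "real \<Rightarrow> 'l::finite forest \<Rightarrow> real"
  assumes X: "branched_rough_path p T X" and p: "1 \<le> p" and T: "0 < T" and N: "integer_part p \<le> N" "1 \<le> N"
  shows "unique_rough_extension (CK_group N) (CK_norm N) p T X"
proof -
  have Xc: "X t \<in> carrier (CK_group (integer_part p))" if "0 \<le> t" "t \<le> T" for t
    using X that by (auto simp: branched_rough_path_def p_variation_path_def)
  obtain Y where Y: "rough_extension (CK_group N) (CK_norm N) p T X Y"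
    using rough_extension_exists[OF X p T N(1)] by blast
  have "\<exists>!Z. Z \<in> extensional {0..T} \<and> rough_extension (CK_group N) (CK_norm N) p T X Z \<and> Z 0 = g"
    if g: "g \<in> carrier (CK_group N)" "agree_upto (integer_part p) g (X 0)" for g
  proof (rule ex_ex1I)
    show "\<exists>Z. Z \<in> extensional {0..T} \<and> rough_extension (CK_group N) (CK_norm N) p T X Z \<and> Z 0 = g"
      using rough_extension_start[OF Xc Y N _ T g] p by simp
    fix Z Z' assume Z: "Z \<in> extensional {0..T} \<and> rough_extension (CK_group N) (CK_norm N) p T X Z \<and> Z 0 = g"
      and Z': "Z' \<in> extensional {0..T} \<and> rough_extension (CK_group N) (CK_norm N) p T X Z' \<and> Z' 0 = g"
    have eq: "Z t = Z' t" if "t \<in> {0..T}" for t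
      by (rule rough_extension_determined[OF Xc _ _ N(1) p T]) (use Z Z' that in auto)
    show "Z = Z'"
      by (rule extensionalityI[of Z "{0..T}" Z']) (use Z Z' eq in \<open>simp_all del: atLeastAtMost_iff\<close>)
  qed
  moreover have "increment (CK_group N) Z s t = increment (CK_group N) Z' s t"
    if "rough_extension (CK_group N) (CK_norm N) p T X Z" "rough_extension (CK_group N) (CK_norm N) p T X Z'"
      "0 \<le> s" "s \<le> t" "t \<le> T" for Z Z' s t
    by (rule rough_extension_increments_unique[OF Xc that(1,2) N(1) p T]) (use that in auto)
  ultimately show ?thesis unfolding unique_rough_extension_def using Y by blast
qed

text \<open>
  Every path in the Grossman-Larson group is the image of a path of characters, so extensions of \<open>X\<close> and
  of \<open>rescale X\<close> correspond to each other.
\<close>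

lemma unique_rough_extension_GL:
  fixes X :: "real \<Rightarrow> 'l::finite forest \<Rightarrow> real"
  assumes X: "branched_rough_path p T X" and p: "1 \<le> p" and T: "0 < T" and N: "integer_part p \<le> N" "1 \<le> N"
    and nrm: "homogeneous_norm N nrm"
  shows "unique_rough_extension (GL_group N) nrm p T (rescale X)"
proof -
  let ?R = "rough_extension (GL_group N) nrm p T (rescale X)" and ?Q = "rough_extension (CK_group N) (CK_norm N) p T X"
  have p0: "0 < p" using p by simp
  have Xc: "X t \<in> carrier (CK_group (integer_part p))" if "0 \<le> t" "t \<le> T" for t
    using X that by (auto simp: branched_rough_path_def p_variation_path_def)
  have RQ: "?R (rescale Y) \<longleftrightarrow> ?Q Y" for Y by (rule rough_extension_rescale[OF nrm N(2) p0])
  have RQ': "?R Z \<longleftrightarrow> ?Q (unscale Z)" for Z using RQ[of "unscale Z"] by simp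
  have uniq: "Z t = Z' t" if "?R Z" "?R Z'" "Z 0 = Z' 0" "0 \<le> t" "t \<le> T" for Z Z' t
  proof -
    have "unscale Z t = unscale Z' t"
      by (rule rough_extension_determined[OF Xc _ _ N(1) p T]) (use that RQ' in \<open>auto simp: unscale_def\<close>)
    then show ?thesis by (auto simp: unscale_def fun_eq_iff)
  qed
  have "\<exists>!Z. Z \<in> extensional {0..T} \<and> ?R Z \<and> Z 0 = g"
    if g: "g \<in> carrier (GL_group N)" "agree_upto (integer_part p) g (rescale X 0)" for g
  proof (rule ex_ex1I)
    obtain a where a: "a \<in> carrier (CK_group N)" "g = by_symmetry a" using g by (auto simp: GL_carrier_eq)
    have "agree_upto (integer_part p) a (X 0)"
      using g(2) by (simp add: agree_upto_def a rescale_def by_symmetry_def)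
    then obtain Y where Y: "?Q Y" "Y 0 = a"
      using unique_rough_extension_CK[OF X p T N] a(1) unfolding unique_rough_extension_def by blast
    define Z where "Z = restrict (rescale Y) {0..T}"
    have Yp: "p_variation_path (CK_group N) (CK_norm N) p T Y"
      and YX: "\<forall>t\<in>{0..T}. agree_upto (integer_part p) (Y t) (X t)"
      using Y(1) unfolding rough_extension_def by blast+
    have ZY: "unscale Z t = Y t" if "0 \<le> t" "t \<le> T" for t
      using that by (simp add: Z_def unscale_def rescale_def)
    have "p_variation_path (CK_group N) (CK_norm N) p T (unscale Z)"
      by (rule p_variation_path_cong[OF _ Yp p0]) (use ZY CK_norm_nonneg[OF N(2)] in auto)
    then have "?Q (unscale Z)"
      using YX ZY by (simp add: rough_extension_def)
    then have "?R Z" by (simp add: RQ')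
    moreover have "Z 0 = g" using T Y(2) by (simp add: Z_def a rescale_eq)
    ultimately show "\<exists>Z. Z \<in> extensional {0..T} \<and> ?R Z \<and> Z 0 = g" by (intro exI[of _ Z]) (auto simp: Z_def)
    fix Z Z' assume Z: "Z \<in> extensional {0..T} \<and> ?R Z \<and> Z 0 = g" and Z': "Z' \<in> extensional {0..T} \<and> ?R Z' \<and> Z' 0 = g"
    have eq: "Z t = Z' t" if "t \<in> {0..T}" for t using uniq[of Z Z' t] Z Z' that by auto
    show "Z = Z'"
      by (rule extensionalityI[of Z "{0..T}" Z']) (use Z Z' eq in \<open>simp_all del: atLeastAtMost_iff\<close>)
  qed
  moreover have "increment (GL_group N) Z s t = increment (GL_group N) Z' s t"
    if "?R Z" "?R Z'" "0 \<le> s" "s \<le> t" "t \<le> T" for Z Z' s t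
  proof -
    have Q: "?Q (unscale Z)" "?Q (unscale Z')" using that RQ' by auto
    then have c: "unscale Z t \<in> carrier (CK_group N)" "unscale Z' t \<in> carrier (CK_group N)" if "0 \<le> t" "t \<le> T" for t
      using that by (auto simp: rough_extension_def p_variation_path_def)
    have "increment (CK_group N) (unscale Z) s t = increment (CK_group N) (unscale Z') s t"
      by (rule rough_extension_increments_unique[OF Xc Q N(1) p T]) (use that in auto)
    then show ?thesis
      using increment_rescale[of "unscale Z" s N t] increment_rescale[of "unscale Z'" s N t] c that by simp
  qed
  moreover have "\<exists>Z. ?R Z" using rough_extension_exists[OF X p T N(1)] RQ by blast
  ultimately show ?thesis unfolding unique_rough_extension_def by blast
qed

theorem proposition2p3:
  fixes p T :: real
    and X :: "real \<Rightarrow> 'l::finite forest \<Rightarrow> real"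
    and nrm :: "nat \<Rightarrow> ('l forest \<Rightarrow> real) \<Rightarrow> real"
  assumes "p \<ge> 1" and "T > 0"
    and "branched_rough_path p T X"
    and "\<And>N. homogeneous_norm N (nrm N)"
  shows "p_variation_path (GL_group (integer_part p)) (nrm (integer_part p)) p T (rescale X) \<and>
    (\<forall>s t. 0 \<le> s \<and> s \<le> t \<and> t \<le> T \<longrightarrow> (\<forall>\<rho>\<in>forests (integer_part p).
       increment (GL_group (integer_part p)) (rescale X) s t \<rho> =
       increment (CK_group (integer_part p)) X s t \<rho> / real (forest_symmetry \<rho>))) \<and>
    (\<forall>N\<ge>integer_part p + 1.
       unique_rough_extension (CK_group N) (CK_norm N) p T X \<and>
       unique_rough_extension (GL_group N) (nrm N) p T (rescale X) \<and>
       (\<forall>Y Z. rough_extension (CK_group N) (CK_norm N) p T X Y \<and>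
          rough_extension (GL_group N) (nrm N) p T (rescale X) Z \<longrightarrow>
          (\<forall>s t. 0 \<le> s \<and> s \<le> t \<and> t \<le> T \<longrightarrow> (\<forall>\<rho>\<in>forests N.
             increment (GL_group N) Z s t \<rho> =
             increment (CK_group N) Y s t \<rho> / real (forest_symmetry \<rho>)))))"
proof (intro conjI allI impI ballI)
  let ?m = "integer_part p"
  note p = assms(1) and T = assms(2) and X = assms(3) and nrm = assms(4)
  have p0: "0 < p" using p by simp
  have m: "1 \<le> ?m" using p by (simp add: le_nat_iff)
  have Xp: "p_variation_path (CK_group ?m) (CK_norm ?m) p T X" using X by (simp add: branched_rough_path_def)
  have Xc: "X t \<in> carrier (CK_group ?m)" if "0 \<le> t" "t \<le> T" for t
    using Xp that by (auto simp: p_variation_path_def)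
  show "p_variation_path (GL_group ?m) (nrm ?m) p T (rescale X)"
    using p_variation_path_rescale[OF nrm m p0] Xp by blast
  show "increment (GL_group ?m) (rescale X) s t \<rho> = increment (CK_group ?m) X s t \<rho> / real (forest_symmetry \<rho>)"
    if "0 \<le> s \<and> s \<le> t \<and> t \<le> T" for s t \<rho>
    using that by (subst increment_rescale) (auto intro: Xc simp: by_symmetry_def)
  fix N assume "?m + 1 \<le> N"
  then have N: "?m \<le> N" "1 \<le> N" by auto
  show "unique_rough_extension (CK_group N) (CK_norm N) p T X"
    by (rule unique_rough_extension_CK[OF X p T N])
  show "unique_rough_extension (GL_group N) (nrm N) p T (rescale X)"
    by (rule unique_rough_extension_GL[OF X p T N nrm])
  fix Y Z s t \<rho>
  assume YZ: "rough_extension (CK_group N) (CK_norm N) p T X Y \<and> rough_extension (GL_group N) (nrm N) p T (rescale X) Z"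
    and st: "0 \<le> s \<and> s \<le> t \<and> t \<le> T"
  have Z: "rough_extension (CK_group N) (CK_norm N) p T X (unscale Z)"
    using YZ rough_extension_rescale[OF nrm N(2) p0, of T X "unscale Z"] by simp
  have "unscale Z t \<in> carrier (CK_group N)" if "0 \<le> t" "t \<le> T" for t
    using Z that by (auto simp: rough_extension_def p_variation_path_def)
  then have "increment (GL_group N) Z s t = by_symmetry (increment (CK_group N) (unscale Z) s t)"
    using increment_rescale[of "unscale Z" s N t] st by simp
  also have "increment (CK_group N) (unscale Z) s t = increment (CK_group N) Y s t"
    by (rule rough_extension_increments_unique[OF Xc Z _ N(1) p T]) (use YZ st in auto)
  finally show "increment (GL_group N) Z s t \<rho> = increment (CK_group N) Y s t \<rho> / real (forest_symmetry \<rho>)"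
    by (simp add: by_symmetry_def)
qed

end
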